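(* For any $t\ge0$ and any probability measures $\mu,\nu$ on $\mathbb{R}^d$, $$W_f(\mu p_t,\nu p_t)\le e^{-ct}\,W_f(\mu,\nu)\qquad\text{and}\qquad W^1(\mu p_t,\nu p_t)\le 2\varphi(R_0)^{-1}e^{-ct}\,W^1(\mu,\nu).$$
   Context: Setting. $\sigma\in\mathbb{R}^{d\times d}$ is a constant matrix with $\det\sigma>0$, $b:\mathbb{R}^d\to\mathbb{R}^d$ is locally Lipschitz continuous, $(B_t)$ is a $d$-dimensional Brownian motion, and the unique strong solution of $dX_t=b(X_t)\,dt+\sigma\,dB_t$ is assumed non-explosive for every initial condition. $p_t(x,dy)$ are its transition kernels and $\mu p_t=\int\mu(dx)p_t(x,\cdot)$. $|\cdot|$ is the Euclidean norm, $G\in\mathbb{R}^{d\times d}$ is a symmetric strictly positive definite matrix and $\|z\|=\sqrt{z\cdot Gz}$. For a real number $a$, $a^-=\max(-a,0)$. For $r\in(0,\infty)$, $$\kappa(r)=\inf\Big\{-2\,\frac{|\sigma^{-1}(x-y)|^2}{\|x-y\|^2}\,\frac{(x-y)\cdot G(b(x)-b(y))}{\|x-y\|^2} : x,y\in\mathbb{R}^d,\ \|x-y\|=r\Big\}.$$ It is assumed that $\kappa$ is a continuous (real-valued) function on $(0,\infty)$ with $\liminf_{r\to\infty}\kappa(r)>0$ and $\int_0^1 r\kappa(r)^-\,dr<\infty$. Define $$R_0=\inf\{R\ge0:\kappa(r)\ge0\ \forall r\ge R\},\qquad R_1=\inf\{R\ge R_0:\kappa(r)R(R-R_0)\ge8\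 \forall r\ge R\}$$ (with $r>0$ understood), and for $r\ge 0$ $$\varphi(r)=\exp\Big(-\frac14\int_0^r s\kappa(s)^-ds\Big),\quad \Phi(r)=\int_0^r\varphi(s)\,ds,\quad g(r)=1-\frac12\int_0^{r\wedge R_1}\frac{\Phi(s)}{\varphi(s)}ds\Big/\int_0^{R_1}\frac{\Phi(s)}{\varphi(s)}ds,$$ $$f(r)=\int_0^r\varphi(s)g(s)\,ds,\qquad d_f(x,y)=f(\|x-y\|).$$ Let $\alpha=\sup\{|\sigma^{-1}z|^2:\|z\|=1\}$ and let $c\in(0,\infty)$ be given by $\frac1c=\alpha\int_0^{R_1}\Phi(s)\varphi(s)^{-1}ds$. For probability measures $\mu,\nu$ on $\mathbb{R}^d$, $W_f(\mu,\nu)=\inf_\eta\int d_f(x,y)\,\eta(dx\,dy)$ and $W^1(\mu,\nu)=\inf_\eta\int\|x-y\|\,\eta(dx\,dy)$, the infima being over all couplings $\eta$ of $\mu$ and $\nu$ (values in $[0,\infty]$). *)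

theory Defs
  imports "HOL-Probability.Probability"
begin

section \<open>Diffusions with constant diffusion matrix\<close>

definition brownian_motion :: "'w measure \<Rightarrow> (real \<Rightarrow> 'w \<Rightarrow> real ^ 'n) \<Rightarrow> bool" where
  "brownian_motion M B \<longleftrightarrow>
     prob_space M \<and>
     (\<forall>t\<ge>0. B t \<in> borel_measurable M) \<and>
     (AE \<omega> in M. B 0 \<omega> = 0) \<and>
     (\<forall>(n::nat) t. 0 \<le> t 0 \<and> (\<forall>i<n. t i \<le> t (Suc i)) \<longrightarrow>
        prob_space.indep_vars M (\<lambda>_. borel) (\<lambda>i \<omega>. B (t (Suc i)) \<omega> - B (t i) \<omega>) {..<n}) \<and>
     (\<forall>s t. 0 \<le> s \<and> s < t \<longrightarrow>
        distributed M lborel (\<lambda>\<omega>. B t \<omega> - B s \<omega>)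
          (\<lambda>z. ennreal (\<Prod>i\<in>UNIV. normal_density 0 (sqrt (t - s)) (z $ i)))) \<and>
     (AE \<omega> in M. continuous_on {0..} (\<lambda>t. B t \<omega>))"

definition brownian_filtration ::
    "'w measure \<Rightarrow> (real \<Rightarrow> 'w \<Rightarrow> real ^ 'n) \<Rightarrow> real \<Rightarrow> 'w measure" where
  "brownian_filtration M B t =
     sigma (space M)
       ({B s -` A \<inter> space M | s A. 0 \<le> s \<and> s \<le> t \<and> A \<in> sets borel} \<union> null_sets M)"

text \<open>
  A non-explosive strong solution, started in \<open>x\<close>, of \<open>dX = b(X) dt + \<sigma> dB\<close>. As \<open>\<sigma>\<close> is
  constant and \<open>B\<close> starts in \<open>0\<close>, the stochastic integral of \<open>\<sigma>\<close> up to time \<open>t\<close> is \<open>\<sigma> B\<^sub>t\<close>.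
  Non-explosion is expressed by the equation holding for all \<open>t \<ge> 0\<close>.
\<close>

definition strong_solution ::
    "'w measure \<Rightarrow> (real \<Rightarrow> 'w \<Rightarrow> real ^ 'n) \<Rightarrow> (real ^ 'n \<Rightarrow> real ^ 'n) \<Rightarrow> real ^ 'n ^ 'n \<Rightarrow>
     real ^ 'n \<Rightarrow> (real \<Rightarrow> 'w \<Rightarrow> real ^ 'n) \<Rightarrow> bool" where
  "strong_solution M B b \<sigma> x X \<longleftrightarrow>
     (\<forall>t\<ge>0. X t \<in> borel_measurable (brownian_filtration M B t)) \<and>
     (AE \<omega> in M. continuous_on {0..} (\<lambda>t. X t \<omega>)) \<and>
     (AE \<omega> in M. \<forall>t\<ge>0. X t \<omega> = x + (LBINT s:{0..t}. b (X s \<omega>)) + \<sigma> *v B t \<omega>)"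

text \<open>
  \<open>X x\<close> is the solution started in \<open>x\<close>; then \<open>\<mu>p\<^sub>t\<close> is the Giry bind of \<open>\<mu>\<close> with the kernel.
\<close>

definition transition_kernel ::
    "'w measure \<Rightarrow> ('s \<Rightarrow> real \<Rightarrow> 'w \<Rightarrow> 's::topological_space) \<Rightarrow> real \<Rightarrow> 's \<Rightarrow> 's measure" where
  "transition_kernel M X t x = distr M borel (X x t)"

section \<open>The distance function\<close>

definition sym_pos_def :: "real ^ 'n ^ 'n \<Rightarrow> bool" where
  "sym_pos_def G \<longleftrightarrow> transpose G = G \<and> (\<forall>z. z \<noteq> 0 \<longrightarrow> z \<bullet> (G *v z) > 0)"

definition gnorm :: "real ^ 'n ^ 'n \<Rightarrow> real ^ 'n \<Rightarrow> real" where
  "gnorm G z = sqrt (z \<bullet> (G *v z))"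

text \<open>
  The set whose infimum is \<open>\<kappa>(r)\<close>. It need not be bounded below, and \<open>Inf\<close> on the reals is
  meaningful only if it is.
\<close>

definition kappa_set ::
    "real ^ 'n ^ 'n \<Rightarrow> real ^ 'n ^ 'n \<Rightarrow> (real ^ 'n \<Rightarrow> real ^ 'n) \<Rightarrow> real \<Rightarrow> real set" where
  "kappa_set \<sigma> G b r =
     {- 2 * ((norm (matrix_inv \<sigma> *v (x - y)))\<^sup>2 / (gnorm G (x - y))\<^sup>2)
          * (((x - y) \<bullet> (G *v (b x - b y))) / (gnorm G (x - y))\<^sup>2)
      | x y. gnorm G (x - y) = r}"

definition kappa ::
    "real ^ 'n ^ 'n \<Rightarrow> real ^ 'n ^ 'n \<Rightarrow> (real ^ 'n \<Rightarrow> real ^ 'n) \<Rightarrow> real \<Rightarrow> real" where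
  "kappa \<sigma> G b r = Inf (kappa_set \<sigma> G b r)"

definition neg_part :: "real \<Rightarrow> real" where
  "neg_part a = max (- a) 0"

context
  fixes \<kappa> :: "real \<Rightarrow> real"
begin

definition R0 :: real where
  "R0 = Inf {R. 0 \<le> R \<and> (\<forall>r>0. r \<ge> R \<longrightarrow> \<kappa> r \<ge> 0)}"

definition R1 :: real where
  "R1 = Inf {R. R0 \<le> R \<and> (\<forall>r>0. r \<ge> R \<longrightarrow> \<kappa> r * R * (R - R0) \<ge> 8)}"

definition phi :: "real \<Rightarrow> real" where
  "phi r = exp (- (1/4) * (LBINT s:{0..r}. s * neg_part (\<kappa> s)))"

definition Phi :: "real \<Rightarrow> real" where
  "Phi r = (LBINT s:{0..r}. phi s)"

definition g_fun :: "real \<Rightarrow> real" where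
  "g_fun r = 1 - 1/2 * (LBINT s:{0..min r R1}. Phi s / phi s) / (LBINT s:{0..R1}. Phi s / phi s)"

definition f_fun :: "real \<Rightarrow> real" where
  "f_fun r = (LBINT s:{0..r}. phi s * g_fun s)"

end

definition alpha :: "real ^ 'n ^ 'n \<Rightarrow> real ^ 'n ^ 'n \<Rightarrow> real" where
  "alpha \<sigma> G = Sup {(norm (matrix_inv \<sigma> *v z))\<^sup>2 | z. gnorm G z = 1}"

definition rate :: "real ^ 'n ^ 'n \<Rightarrow> real ^ 'n ^ 'n \<Rightarrow> (real \<Rightarrow> real) \<Rightarrow> real" where
  "rate \<sigma> G \<kappa> = 1 / (alpha \<sigma> G * (LBINT s:{0..R1 \<kappa>}. Phi \<kappa> s / phi \<kappa> s))"

section \<open>Kantorovich distances\<close>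

definition couplings ::
    "'s::topological_space measure \<Rightarrow> 's measure \<Rightarrow> ('s \<times> 's) measure set" where
  "couplings \<mu> \<nu> =
     {\<eta>. sets \<eta> = sets (borel \<Otimes>\<^sub>M borel) \<and> distr \<eta> borel fst = \<mu> \<and> distr \<eta> borel snd = \<nu>}"

definition kantorovich ::
    "('s::topological_space \<Rightarrow> 's \<Rightarrow> real) \<Rightarrow> 's measure \<Rightarrow> 's measure \<Rightarrow> ennreal" where
  "kantorovich d \<mu> \<nu> = (INF \<eta>\<in>couplings \<mu> \<nu>. \<integral>\<^sup>+ (x, y). ennreal (d x y) \<partial>\<eta>)"

definition W_f :: "real ^ 'n ^ 'n \<Rightarrow> (real \<Rightarrow> real) \<Rightarrow>
    (real ^ 'n) measure \<Rightarrow> (real ^ 'n) measure \<Rightarrow> ennreal" where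
  "W_f G \<kappa> = kantorovich (\<lambda>x y. f_fun \<kappa> (gnorm G (x - y)))"

definition W1 :: "real ^ 'n ^ 'n \<Rightarrow> (real ^ 'n) measure \<Rightarrow> (real ^ 'n) measure \<Rightarrow> ennreal" where
  "W1 G = kantorovich (\<lambda>x y. gnorm G (x - y))"

end

(* Reflection coupling without stochastic integrals. Since sigma is constant, the equation is solved
   pathwise: X_t is the limit of Euler schemes evaluated along the Brownian path, hence a measurable
   functional of the starting point and the path. Over a short time h the second component is driven by
   the path reflected in the direction sigma^{-1}(x - y), frozen at the start of the step; reflecting
   only on the rotation invariant event that the path stays small preserves the law exactly, and on the
   complement the coupling is synchronous, so the distance there never exceeds max(r, R_0). A second
   order Taylor expansion of f gives E f(r_h) <= (1 - c h) f(r) + o(h), uniformly on balls, from the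
   differential inequality f'' - r kappa f' / 4 <= - f / (2 I). No reflection is used near the diagonal
   (the Lipschitz drift suffices) nor for r close to or above R_1 (the drift alone contracts), which
   keeps the distance below max(r, R_1). Iterating over t / h steps, with a synchronous coupling after
   the exit from a large ball, produces couplings of the two laws at time t; letting the ball grow, the
   exit probabilities of the two marginals tend to 0 and dominated convergence gives the rate c. *)

theory Submission
  imports Defs
begin

section \<open>Quadratic norms\<close>

text \<open>Two irregularities of \<open>f\<close> force the different regimes of a step. Near 0 its
  second derivative may be unbounded, because r \<kappa>(r)^- is only integrable there, and at
  \<open>R_1\<close> the slope of g jumps; a Taylor bound is uniform only on compact parts of (0,
  R_1). The drift is not controlled at infinity, so what happens after leaving a ball can be paid
  for only by a distance bound that survives iteration. The bound max(r, R_1) does, and under a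
  coupling it is integrable exactly when the cost is. The path size a allowed in one step is fixed
  before h tends to 0. The remainder of the Euler expansion is then of order a h, small relative to
  h by the choice of a, and the exceptional event has probability of order h^2 by fourth moments,
  which is negligible over t/h steps. Truncating to the good event would bias the Gaussian moments.
  The Taylor polynomial is therefore used as a bound on the whole space, and the exceptional event
  enters as a separate correction. Solutions are given for each starting point separately, each with
  its own null set; the limit of Euler schemes supplies one jointly measurable map, without which
  kernels could not be composed.\<close>

locale pos_def_matrix =
  fixes G :: "real ^ 'n ^ 'n"
  assumes spd: "sym_pos_def G"
begin

lemma G_sym: "x \<bullet> (G *v y) = y \<bullet> (G *v x)"
  using spd unfolding sym_pos_def_def
  by (metis dot_lmul_matrix inner_commute matrix_vector_mul_assoc transpose_matrix_vector)

lemma G_pos: "z \<noteq> 0 \<Longrightarrow> z \<bullet> (G *v z) > 0"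
  using spd by (auto simp: sym_pos_def_def)

lemma G_nonneg: "z \<bullet> (G *v z) \<ge> 0"
  by (cases "z = 0") (auto dest: G_pos)

lemma gnorm_nonneg [simp]: "gnorm G z \<ge> 0"
  by (simp add: gnorm_def G_nonneg)

lemma gnorm_sq: "(gnorm G z)\<^sup>2 = z \<bullet> (G *v z)"
  by (simp add: gnorm_def G_nonneg)

lemma gnorm_pos: "z \<noteq> 0 \<Longrightarrow> gnorm G z > 0"
  by (simp add: gnorm_def G_pos)

lemma gnorm_zero [simp]: "gnorm G 0 = 0"
  by (simp add: gnorm_def)

lemma gnorm_scaleR: "gnorm G (c *\<^sub>R z) = \<bar>c\<bar> * gnorm G z"
proof -
  have "(c *\<^sub>R z) \<bullet> (G *v (c *\<^sub>R z)) = c\<^sup>2 * (z \<bullet> (G *v z))"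
    by (simp add: matrix_vector_mult_scaleR power2_eq_square)
  then show ?thesis by (simp add: gnorm_def real_sqrt_mult)
qed

lemma gnorm_sq_add:
  "(gnorm G (x + y))\<^sup>2 = (gnorm G x)\<^sup>2 + 2 * (x \<bullet> (G *v y)) + (gnorm G y)\<^sup>2"
  unfolding gnorm_sq
  by (simp add: matrix_vector_right_distrib inner_add_left inner_add_right G_sym[of y x])

lemma G_Cauchy_Schwarz: "\<bar>x \<bullet> (G *v y)\<bar> \<le> gnorm G x * gnorm G y"
proof (cases "y = 0")
  case False
  \<comment> \<open>The minimiser over \<open>a\<close> of the squared norm of x + a y.\<close>
  define a where "a = - (x \<bullet> (G *v y)) / (gnorm G y)\<^sup>2"
  have p: "(gnorm G y)\<^sup>2 > 0" using gnorm_pos[OF False] by simp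
  have "0 \<le> (gnorm G (x + a *\<^sub>R y))\<^sup>2" by simp
  also have "\<dots> = (gnorm G x)\<^sup>2 + 2 * a * (x \<bullet> (G *v y)) + a\<^sup>2 * (gnorm G y)\<^sup>2"
    unfolding gnorm_sq_add gnorm_scaleR by (simp add: matrix_vector_mult_scaleR power_mult_distrib)
  also have "\<dots> = (gnorm G x)\<^sup>2 - (x \<bullet> (G *v y))\<^sup>2 / (gnorm G y)\<^sup>2"
    using p gnorm_pos[OF False, THEN less_imp_neq, symmetric] by (simp add: a_def power2_eq_square field_simps)
  finally have "(x \<bullet> (G *v y))\<^sup>2 \<le> (gnorm G x * gnorm G y)\<^sup>2"
    using p by (simp add: field_simps power_mult_distrib)
  then show ?thesis by (simp add: abs_le_square_iff[symmetric] abs_mult)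
qed simp

lemma gnorm_triangle: "gnorm G (x + y) \<le> gnorm G x + gnorm G y"
proof (rule power2_le_imp_le)
  show "(gnorm G (x + y))\<^sup>2 \<le> (gnorm G x + gnorm G y)\<^sup>2"
    using G_Cauchy_Schwarz[of x y] unfolding gnorm_sq_add power2_sum by linarith
qed simp

lemma continuous_on_gnorm [continuous_intros]:
  "continuous_on S h \<Longrightarrow> continuous_on S (\<lambda>x. gnorm G (h x))"
proof -
  assume h: "continuous_on S h"
  have "continuous_on S (\<lambda>x. G *v h x)"
    by (rule continuous_on_compose2[OF linear_continuous_on[OF matrix_vector_mul_bounded_linear, of UNIV] h]) simp
  then show ?thesis
    unfolding gnorm_def by (intro continuous_intros h)
qed

lemma borel_measurable_gnorm [measurable]: "gnorm G \<in> borel_measurable borel"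
  using continuous_on_gnorm[OF continuous_on_id] by (intro borel_measurable_continuous_onI) simp

text \<open>By homogeneity both constants are extrema of \<open>gnorm G\<close> over the compact
  Euclidean unit sphere, positive because \<open>G\<close> is definite.\<close>

lemma gnorm_norm_equiv:
  obtains c C where "c > 0" "C > 0" "\<And>z. c * norm z \<le> gnorm G z" "\<And>z. gnorm G z \<le> C * norm z"
proof -
  let ?S = "sphere (0 :: real ^ 'n) 1"
  have ne: "?S \<noteq> {}" by simp
  have co: "continuous_on ?S (gnorm G)" using continuous_on_gnorm[OF continuous_on_id] by simp
  obtain u where u: "u \<in> ?S" "\<And>z. z \<in> ?S \<Longrightarrow> gnorm G u \<le> gnorm G z"
    using continuous_attains_inf[OF compact_sphere ne co] by blast
  obtain v where v: "v \<in> ?S" "\<And>z. z \<in> ?S \<Longrightarrow> gnorm G z \<le> gnorm G v"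
    using continuous_attains_sup[OF compact_sphere ne co] by blast
  have pos: "gnorm G u > 0" "gnorm G v > 0" using u(1) v(1) by (auto intro!: gnorm_pos)
  have sc: "gnorm G z = norm z * gnorm G (z /\<^sub>R norm z)" "z \<noteq> 0 \<Longrightarrow> z /\<^sub>R norm z \<in> ?S" for z
    by (cases "z = 0"; simp add: gnorm_scaleR)+
  have "gnorm G u * norm z \<le> gnorm G z \<and> gnorm G z \<le> gnorm G v * norm z" for z
  proof (cases "z = 0")
    case False
    then show ?thesis
      using u(2)[OF sc(2)[OF False]] v(2)[OF sc(2)[OF False]] by (subst (2 3) sc(1)) (simp add: mult_left_mono mult.commute)
  qed simp
  then show ?thesis using that[OF pos] by blast
qed

end

section \<open>The concave distance function\<close>

lemma LBINT_upto_continuous_on: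
  fixes F :: "real \<Rightarrow> real"
  assumes "\<And>r. r \<ge> 0 \<Longrightarrow> set_integrable lborel {0..r} F"
  shows "continuous_on {0..} (\<lambda>r. LBINT s:{0..r}. F s)"
proof -
  have "continuous_on {0..T} (\<lambda>r. LBINT s:{0..r}. F s)" if "T \<ge> 0" for T
  proof (rule continuous_on_eq)
    show "continuous_on {0..T} (\<lambda>r. integral {0..r} F)"
      by (rule indefinite_integral_continuous_1) (rule set_borel_integral_eq_integral(1)[OF assms[OF that]])
    show "integral {0..r} F = (LBINT s:{0..r}. F s)" if "r \<in> {0..T}" for r
      using set_borel_integral_eq_integral(2)[OF assms, of r] that by simp
  qed
  then have *: "continuous_on {0..<T} (\<lambda>r. LBINT s:{0..r}. F s)" if "T \<ge> 0" for T
    using that continuous_on_subset by (metis atLeastLessThan_subseteq_atLeastAtMost_iff less_le order_refl)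
  show ?thesis
    unfolding continuous_on_eq_continuous_within
  proof
    fix r :: real assume r: "r \<in> {0..}"
    have "continuous (at r within {0..<r+1}) (\<lambda>r. LBINT s:{0..r}. F s)"
      using *[of "r+1"] r by (auto simp: continuous_on_eq_continuous_within)
    moreover have "at r within {0..<r+1} = at r within {0..}"
      by (rule at_within_nhd[of _ "{..<r+1}"]) auto
    ultimately show "continuous (at r within {0..}) (\<lambda>r. LBINT s:{0..r}. F s)"
      by (simp add: continuous_within)
  qed
qed

text \<open>Continuity is required only on the open half-line, because the weight
  \<open>s * neg_part (\<kappa> s)\<close> inside \<open>phi\<close> is merely integrable at
  0.\<close>

lemma LBINT_upto_has_derivative:
  fixes F :: "real \<Rightarrow> real"
  assumes int: "\<And>r. r \<ge> 0 \<Longrightarrow> set_integrable lborel {0..r} F"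
    and co: "continuous_on {0<..} F" and r: "r > 0"
  shows "((\<lambda>r. LBINT s:{0..r}. F s) has_real_derivative F r) (at r)"
proof -
  have "((\<lambda>u. integral {0..u} F) has_vector_derivative F r) (at r within {0..r+1})"
  proof (rule integral_has_vector_derivative_continuous_at[where S = "{}", simplified])
    show "F integrable_on {0..r+1}"
      by (rule set_borel_integral_eq_integral(1)[OF int]) (use r in simp)
    have "isCont F r"
      using co r by (simp add: continuous_on_eq_continuous_at)
    then show "continuous (at r within {0..r+1}) F"
      using continuous_at_imp_continuous_at_within by blast
  qed (use r in auto)
  moreover have "at r within {0..r+1} = at r"
    by (rule at_within_interior) (use r in simp)
  ultimately have "((\<lambda>u. integral {0..u} F) has_real_derivative F r) (at r)"
    by (simp add: has_real_derivative_iff_has_vector_derivative)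
  then show ?thesis
  proof (rule DERIV_cong_ev[THEN iffD1, rotated -1])
    have "eventually (\<lambda>u. u > 0) (nhds r)"
      using r eventually_nhds_in_open[of "{0<..}" r] by auto
    then show "\<forall>\<^sub>F u in nhds r. integral {0..u} F = (LBINT s:{0..u}. F s)"
    proof eventually_elim
      case (elim u)
      then show ?case using set_borel_integral_eq_integral(2)[OF int, of u] by simp
    qed
  qed simp_all
qed

lemma set_integrable_upto_continuous:
  fixes F :: "real \<Rightarrow> real"
  assumes "continuous_on {0..} F"
  shows "set_integrable lborel {0..r} F"
  by (rule borel_integrable_atLeastAtMost'[OF continuous_on_subset[OF assms]]) auto

text \<open>Two-sided derivatives are at hand only for positive arguments; the mean value form with
  an interior point lets the estimates for \<open>Phi\<close>, \<open>J\<close> and \<open>f\<close>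
  start at 0.\<close>

lemma LBINT_upto_MVT:
  fixes F :: "real \<Rightarrow> real"
  assumes co: "continuous_on {0..} F" and r: "0 \<le> r" "r < s"
  shows "\<exists>u>r. u < s \<and> (LBINT v:{0..s}. F v) - (LBINT v:{0..r}. F v) = (s - r) * F u"
proof -
  let ?J = "\<lambda>r. LBINT v:{0..r}. F v"
  note int = set_integrable_upto_continuous[OF co]
  have D: "(?J has_real_derivative F u) (at u)" if "u > 0" for u
    using that by (intro LBINT_upto_has_derivative int continuous_on_subset[OF co]) auto
  have "\<exists>l z. r < z \<and> z < s \<and> DERIV ?J z :> l \<and> ?J s - ?J r = (s - r) * l"
    using r by (intro MVT continuous_on_subset[OF LBINT_upto_continuous_on[OF int]])
      (auto simp: real_differentiable_def intro!: exI D)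
  then obtain l z where z: "r < z" "z < s" "DERIV ?J z :> l" "?J s - ?J r = (s - r) * l" by blast
  moreover have "l = F z" using D[of z] r z DERIV_unique by auto
  ultimately show ?thesis by blast
qed

lemma LBINT_singleton [simp]: "(LBINT s:{a::real}. F s) = (0::real)"
proof -
  have "AE s in lborel. s \<noteq> a" by (rule AE_lborel_singleton)
  then have "AE s in lborel. indicator {a} s *\<^sub>R F s = 0" by eventually_elim auto
  then show ?thesis unfolding set_lebesgue_integral_def by (rule integral_eq_zero_AE)
qed

section \<open>One-dimensional analysis of an abstract function \<kappa>\<close>

locale kappa_function =
  fixes \<kappa> :: "real \<Rightarrow> real"
  assumes kappa_cont: "continuous_on {0<..} \<kappa>"
    and kappa_liminf: "Liminf at_top (\<lambda>r. ereal (\<kappa> r)) > 0"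
    and kappa_int: "(\<integral>\<^sup>+ r\<in>{0<..1}. ennreal (r * neg_part (\<kappa> r)) \<partial>lborel) < \<infinity>"
begin

abbreviation "R_0 \<equiv> R0 \<kappa>"
abbreviation "R_1 \<equiv> R1 \<kappa>"
abbreviation "ph \<equiv> phi \<kappa>"
abbreviation "Ph \<equiv> Phi \<kappa>"
abbreviation "gf \<equiv> g_fun \<kappa>"
abbreviation "f \<equiv> f_fun \<kappa>"

definition "I1 = (LBINT s:{0..R_1}. Ph s / ph s)"
definition "f' r = ph r * gf r"
text \<open>This is the second derivative of \<open>f\<close> only for \<open>0 < r < R_1\<close>.
  The formula continues across \<open>R_1\<close>, whereas the slope of \<open>gf\<close> jumps to 0
  there.\<close>

definition "f'' r = - (1/4) * r * neg_part (\<kappa> r) * f' r - 1/2 * Ph r / I1"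

lemma neg_part_nonneg [simp]: "neg_part a \<ge> 0"
  by (simp add: neg_part_def)

lemma kappa_tail: "\<exists>e>0. \<exists>R\<ge>0. \<forall>r\<ge>R. \<kappa> r \<ge> e"
proof -
  obtain e where e: "0 < e" "e < Liminf at_top (\<lambda>r. ereal (\<kappa> r))"
    using dense[OF kappa_liminf] by blast
  then have ev: "\<forall>\<^sub>F r in at_top. e < ereal (\<kappa> r)"
    by (simp add: less_LiminfD)
  obtain e' where e': "0 < ereal e'" "ereal e' < e" using ereal_dense2[OF e(1)] by auto
  from ev obtain R where "\<And>r. r \<ge> R \<Longrightarrow> e < ereal (\<kappa> r)" by (auto simp: eventually_at_top_linorder)
  then have "\<forall>r\<ge>max R 0. \<kappa> r \<ge> e'" using e' by (metis ereal_less_eq(3) less_imp_le max.bounded_iff order_less_trans)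
  then show ?thesis using e' by (intro exI[of _ e'] conjI exI[of _ "max R 0"]) auto
qed

lemma R0_nonneg: "R_0 \<ge> 0"
proof -
  obtain e R where "e > 0" "R \<ge> 0" "\<forall>r\<ge>R. \<kappa> r \<ge> e" using kappa_tail by blast
  then have "R \<in> {R. 0 \<le> R \<and> (\<forall>r>0. r \<ge> R \<longrightarrow> \<kappa> r \<ge> 0)}" by force
  then show ?thesis unfolding R0_def by (intro cInf_greatest) auto
qed

lemma kappa_nonneg: assumes "r > R_0" shows "\<kappa> r \<ge> 0"
proof -
  obtain e R where "e > 0" "R \<ge> 0" "\<forall>r\<ge>R. \<kappa> r \<ge> e" using kappa_tail by blast
  then have "R \<in> {R. 0 \<le> R \<and> (\<forall>r>0. r \<ge> R \<longrightarrow> \<kappa> r \<ge> 0)}" by force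
  then obtain R' where "R' \<in> {R. 0 \<le> R \<and> (\<forall>r>0. r \<ge> R \<longrightarrow> \<kappa> r \<ge> 0)}" "R' < r"
    using cInf_lessD[of "{R. 0 \<le> R \<and> (\<forall>r>0. r \<ge> R \<longrightarrow> \<kappa> r \<ge> 0)}" r] assms unfolding R0_def by blast
  then show ?thesis using assms R0_nonneg by auto
qed

definition "R1_set = {R. R_0 \<le> R \<and> (\<forall>r>0. r \<ge> R \<longrightarrow> \<kappa> r * R * (R - R_0) \<ge> 8)}"

lemma R1_set_nonempty: "R1_set \<noteq> {}"
proof -
  obtain e R where e: "e > 0" "R \<ge> 0" "\<forall>r\<ge>R. \<kappa> r \<ge> e" using kappa_tail by blast
  \<comment> \<open>Chosen so that the three factors are at least \<open>e\<close>, 1 and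
    \<open>8 / e\<close>, which makes the product at least 8.\<close>
  define S where "S = max R (R_0 + max 1 (8 / e))"
  have S: "S \<ge> R" "S - R_0 \<ge> 8 / e" "S \<ge> 1" "S \<ge> R_0" using R0_nonneg e(1) by (auto simp: S_def)
  have "\<kappa> r * S * (S - R_0) \<ge> 8" if "r \<ge> S" for r
  proof -
    have "8 = e * 1 * (8 / e)" using e by simp
    also have "\<dots> \<le> \<kappa> r * S * (S - R_0)"
      using e S that order_trans[of 0 e "\<kappa> r"] by (intro mult_mono mult_nonneg_nonneg) auto
    finally show ?thesis .
  qed
  then have "S \<in> R1_set" using S by (auto simp: R1_set_def)
  then show ?thesis by blast
qed

lemma R1_eq: "R_1 = Inf R1_set" by (simp add: R1_def R1_set_def)

lemma R1_approx:
  assumes "r > R_1" obtains R where "R \<in> R1_set" "R_1 \<le> R" "R < r"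
proof -
  have "bdd_below R1_set" by (rule bdd_belowI[of _ R_0]) (auto simp: R1_set_def)
  then show ?thesis using that cInf_lessD[OF R1_set_nonempty, of r] cInf_lower assms R1_eq by metis
qed

lemma R1_ge_R0: "R_1 \<ge> R_0"
  unfolding R1_eq using R1_set_nonempty by (intro cInf_greatest) (auto simp: R1_set_def)

text \<open>An infimum need not belong to its set. Members \<open>R\<close> of \<open>R1_set\<close>
  approach \<open>R_1\<close> from above, and the product is continuous in \<open>R\<close>, so the
  bound 8 survives up to an arbitrary \<open>e\<close>.\<close>

lemma kappa_R1_gt: assumes "r > R_1" shows "\<kappa> r * R_1 * (R_1 - R_0) \<ge> 8"
proof (rule field_le_epsilon)
  fix e :: real assume e: "e > 0"
  have r0: "r > 0" using assms R1_ge_R0 R0_nonneg by linarith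
  have "((\<lambda>R. \<kappa> r * R * (R - R_0)) \<longlongrightarrow> \<kappa> r * R_1 * (R_1 - R_0)) (at_right R_1)"
    by (intro tendsto_intros)
  then have "\<forall>\<^sub>F R in at_right R_1. \<kappa> r * R * (R - R_0) < \<kappa> r * R_1 * (R_1 - R_0) + e"
    using e by (intro order_tendstoD) auto
  then obtain b where b: "b > R_1" "\<And>R. R_1 < R \<Longrightarrow> R < b \<Longrightarrow> \<kappa> r * R * (R - R_0) < \<kappa> r * R_1 * (R_1 - R_0) + e"
    by (auto simp: eventually_at_right_field)
  obtain R where R: "R \<in> R1_set" "R_1 \<le> R" "R < min b r" using R1_approx[of "min b r"] b assms by auto
  have "8 \<le> \<kappa> r * R * (R - R_0)" using R r0 by (auto simp: R1_set_def)
  then show "8 \<le> \<kappa> r * R_1 * (R_1 - R_0) + e" using b(2)[of R] R e by (cases "R = R_1") auto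
qed

text \<open>If the two radii coincided, the product bounded below by 8 would vanish. Strictness
  leaves room for a radius between \<open>R_0\<close> and \<open>R_1\<close> at which reflection can
  stop.\<close>

lemma R1_gt_R0: "R_1 > R_0"
proof -
  have "R_1 \<noteq> R_0" using kappa_R1_gt[of "R_1 + 1"] by auto
  then show ?thesis using R1_ge_R0 by auto
qed

lemma R1_pos: "R_1 > 0" using R1_gt_R0 R0_nonneg by simp

lemma kappa_R1: assumes "r \<ge> R_1" shows "\<kappa> r * R_1 * (R_1 - R_0) \<ge> 8"
proof (cases "r = R_1")
  case True
  have "isCont \<kappa> R_1" using kappa_cont R1_pos by (simp add: continuous_on_eq_continuous_at)
  then have "(\<kappa> \<longlongrightarrow> \<kappa> R_1) (at_right R_1)" by (simp add: isCont_def filterlim_at_split)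
  then have "((\<lambda>r. \<kappa> r * R_1 * (R_1 - R_0)) \<longlongrightarrow> \<kappa> R_1 * R_1 * (R_1 - R_0)) (at_right R_1)"
    by (intro tendsto_intros)
  then show ?thesis
    using True kappa_R1_gt by (intro tendsto_lowerbound[where F = "at_right R_1"]) (auto simp: eventually_at_right_field intro!: exI[of _ "R_1 + 1"])
qed (use assms kappa_R1_gt in auto)

lemma kappa_weight_continuous: "continuous_on {0<..} (\<lambda>s. s * neg_part (\<kappa> s))"
  unfolding neg_part_def by (intro continuous_intros kappa_cont)

lemma kappa_weight_integrable: assumes "r \<ge> 0" shows "set_integrable lborel {0..r} (\<lambda>s. s * neg_part (\<kappa> s))"
proof -
  let ?k = "\<lambda>s. s * neg_part (\<kappa> s)"
  have "set_integrable lborel {0<..1} ?k"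
    unfolding set_integrable_def
  proof (rule integrableI_nonneg)
    have "set_borel_measurable borel {0<..} ?k"
      using borel_measurable_continuous_on_indicator[OF _ kappa_weight_continuous] by (simp add: set_borel_measurable_def)
    then have "set_borel_measurable borel {0<..1} ?k"
      by (rule set_borel_measurable_subset) auto
    then show "(\<lambda>x. indicat_real {0<..1} x *\<^sub>R ?k x) \<in> borel_measurable lborel"
      by (simp add: set_borel_measurable_def)
    show "AE x in lborel. 0 \<le> indicat_real {0<..1} x *\<^sub>R ?k x" by (auto simp: indicator_def)
    have "(\<integral>\<^sup>+ x. ennreal (indicat_real {0<..1} x *\<^sub>R ?k x) \<partial>lborel) = (\<integral>\<^sup>+ r\<in>{0<..1}. ennreal (?k r) \<partial>lborel)"
      by (intro nn_integral_cong) (auto simp: indicator_def)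
    then show "(\<integral>\<^sup>+ x. ennreal (indicat_real {0<..1} x *\<^sub>R ?k x) \<partial>lborel) < \<infinity>"
      using kappa_int by simp
  qed
  moreover have "set_integrable lborel {1..r} ?k"
    by (intro borel_integrable_atLeastAtMost' continuous_on_subset[OF kappa_weight_continuous]) auto
  ultimately have "set_integrable lborel ({0<..1} \<union> {1..r}) ?k" by (intro set_integrable_Un) auto
  then have "set_integrable lborel {0<..r} ?k" by (rule set_integrable_subset) auto
  moreover have "(\<lambda>s. indicat_real {0<..r} s *\<^sub>R ?k s) = (\<lambda>s. indicat_real {0..r} s *\<^sub>R ?k s)"
    by (rule ext) (auto simp: indicator_def order_le_less)
  ultimately show ?thesis unfolding set_integrable_def by metis
qed

section \<open>The weights phi and Phi and the normalising integral\<close>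

lemma phi_pos [simp]: "ph r > 0" by (simp add: phi_def)

lemma phi_neq_0 [simp]: "ph r \<noteq> 0" by (simp add: phi_def)

lemma phi_continuous: "continuous_on {0..} ph"
  unfolding phi_def by (intro continuous_intros LBINT_upto_continuous_on kappa_weight_integrable)

lemma phi_0 [simp]: "ph 0 = 1" by (simp add: phi_def)

lemma phi_deriv: assumes "r > 0"
  shows "(ph has_real_derivative - (1/4) * (r * neg_part (\<kappa> r)) * ph r) (at r)"
  unfolding phi_def
  by (rule derivative_eq_intros LBINT_upto_has_derivative kappa_weight_integrable kappa_weight_continuous assms refl | simp)+

lemma phi_antimono: assumes "0 \<le> r" "r \<le> s" shows "ph s \<le> ph r"
proof (rule DERIV_nonpos_imp_decreasing_open[OF assms(2)])
  show "continuous_on {r..s} ph" by (rule continuous_on_subset[OF phi_continuous]) (use assms in auto)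
  show "\<exists>y. (ph has_real_derivative y) (at x) \<and> y \<le> 0" if "r < x" "x < s" for x
    using that assms by (intro exI[of _ "- (1/4) * (x * neg_part (\<kappa> x)) * ph x"] conjI phi_deriv) (auto simp: mult_le_0_iff zero_le_mult_iff less_imp_le)
qed

lemma phi_le_1: "0 \<le> r \<Longrightarrow> ph r \<le> 1"
  using phi_antimono[of 0 r] by simp

text \<open>Beyond \<open>R_0\<close> the negative part of \<kappa> vanishes, so the exponent stops
  growing.\<close>

lemma phi_const: assumes "r \<ge> R_0" shows "ph r = ph R_0"
proof (cases "r = R_0")
  case False
  then have r: "R_0 < r" using assms by simp
  have "ph r = ph R_0"
  proof (rule DERIV_isconst_end[OF r])
    show "continuous_on {R_0..r} ph" by (rule continuous_on_subset[OF phi_continuous]) (use R0_nonneg in auto)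
    show "DERIV ph x :> 0" if "R_0 < x" "x < r" for x
      using phi_deriv[of x] kappa_nonneg[of x] that R0_nonneg by (simp add: neg_part_def)
  qed
  then show ?thesis .
qed simp

lemma phi_ge: "0 \<le> r \<Longrightarrow> ph R_0 \<le> ph r"
  using phi_antimono[of r R_0] phi_const[of r] by (cases "r \<le> R_0") auto

lemma Phi_continuous: "continuous_on {0..} Ph"
  unfolding Phi_def by (intro LBINT_upto_continuous_on set_integrable_upto_continuous phi_continuous)

lemma Phi_deriv: "r > 0 \<Longrightarrow> (Ph has_real_derivative ph r) (at r)"
  unfolding Phi_def
  by (intro LBINT_upto_has_derivative set_integrable_upto_continuous phi_continuous
      continuous_on_subset[OF phi_continuous]) auto

lemma Phi_0 [simp]: "Ph 0 = 0" by (simp add: Phi_def)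

lemma Phi_mono: assumes "0 \<le> r" "r \<le> s" shows "Ph r \<le> Ph s"
proof (rule DERIV_nonneg_imp_increasing_open[OF assms(2)])
  show "continuous_on {r..s} Ph" by (rule continuous_on_subset[OF Phi_continuous]) (use assms in auto)
  show "\<exists>y. (Ph has_real_derivative y) (at x) \<and> 0 \<le> y" if "r < x" "x < s" for x
    using that assms by (intro exI[of _ "ph x"] conjI Phi_deriv) (auto simp: less_imp_le)
qed

lemma Phi_MVT: assumes "0 \<le> r" "r < s" shows "\<exists>u>r. u < s \<and> Ph s - Ph r = (s - r) * ph u"
  unfolding Phi_def by (rule LBINT_upto_MVT[OF phi_continuous assms])

lemma Phi_pos: assumes "r > 0" shows "Ph r > 0"
proof -
  obtain u where "Ph r - Ph 0 = (r - 0) * ph u" using Phi_MVT[of 0 r] assms by auto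
  then show ?thesis using assms by simp
qed

lemma Phi_tail: assumes "r \<ge> R_0" shows "Ph r = Ph R_0 + ph R_0 * (r - R_0)"
proof (cases "r = R_0")
  case False
  then obtain u where u: "R_0 < u" "Ph r - Ph R_0 = (r - R_0) * ph u" using Phi_MVT[of R_0 r] assms R0_nonneg by auto
  then show ?thesis using phi_const[of u] by (simp add: algebra_simps)
qed simp

lemma Phi_ge: assumes "0 \<le> r" shows "Ph r \<ge> ph r * r"
proof (cases "r = 0")
  case False
  then obtain u where u: "0 < u" "u < r" "Ph r - Ph 0 = (r - 0) * ph u" using Phi_MVT[of 0 r] assms by auto
  then show ?thesis using phi_antimono[of u r] assms by (simp add: mult.commute mult_left_mono)
qed simp

lemma Phi_ratio_continuous: "continuous_on {0..} (\<lambda>s. Ph s / ph s)"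
  by (intro continuous_intros Phi_continuous phi_continuous) (metis less_irrefl phi_pos)

lemma Phi_ratio_integrable: "set_integrable lborel {0..r} (\<lambda>s. Ph s / ph s)"
  by (rule set_integrable_upto_continuous[OF Phi_ratio_continuous])

definition "J r = (LBINT s:{0..r}. Ph s / ph s)"

lemma J_continuous: "continuous_on {0..} J"
  unfolding J_def[abs_def] by (rule LBINT_upto_continuous_on[OF Phi_ratio_integrable])

lemma J_deriv: "r > 0 \<Longrightarrow> (J has_real_derivative Ph r / ph r) (at r)"
  unfolding J_def[abs_def]
  by (intro LBINT_upto_has_derivative Phi_ratio_integrable continuous_on_subset[OF Phi_ratio_continuous]) auto

lemma J_0 [simp]: "J 0 = 0" by (simp add: J_def)

lemma J_MVT: assumes "0 \<le> r" "r < s" shows "\<exists>u>r. u < s \<and> J s - J r = (s - r) * (Ph u / ph u)"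
  unfolding J_def by (rule LBINT_upto_MVT[OF Phi_ratio_continuous assms])

lemma J_mono: assumes "0 \<le> r" "r \<le> s" shows "J r \<le> J s"
proof (cases "r = s")
  case False
  then obtain u where "r < u" "J s - J r = (s - r) * (Ph u / ph u)" using J_MVT[of r s] assms by auto
  moreover have "(s - r) * (Ph u / ph u) \<ge> 0"
    using assms \<open>r < u\<close> Phi_pos[of u] by (intro mult_nonneg_nonneg divide_nonneg_nonneg) (auto simp: less_imp_le)
  ultimately show ?thesis by simp
qed simp

lemma I1_eq: "I1 = J R_1" by (simp add: I1_def J_def)

lemma I1_pos: "I1 > 0"
proof -
  obtain u where "0 < u" "J R_1 - J 0 = (R_1 - 0) * (Ph u / ph u)" using J_MVT[of 0 R_1] R1_pos by auto
  then show ?thesis using R1_pos Phi_pos[of u] by (simp add: I1_eq)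
qed

lemma I1_neq_0 [simp]: "I1 \<noteq> 0" using I1_pos by simp

text \<open>On \<open>[R_0, R_1]\<close> the weight is constant and \<open>Ph\<close> is affine, so
  the integral there is explicit. Discarding the part over \<open>[0, R_0]\<close> and half of the
  term with \<open>Ph R_0\<close> leaves a quantity that can be compared directly with the product
  defining \<open>R_1\<close>.\<close>

lemma I1_ge: "I1 \<ge> (R_1 - R_0) * Ph R_1 / (2 * ph R_0)"
proof -
  \<comment> \<open>\<open>J\<close> minus the explicit primitive of the affine ratio on
    \<open>[R_0, R_1]\<close>; its derivative vanishes there.\<close>
  let ?q = "\<lambda>r. J r - (Ph R_0 * (r - R_0) + ph R_0 * (r - R_0)\<^sup>2 / 2) / ph R_0"
  have "?q R_1 = ?q R_0"
  proof (rule DERIV_isconst_end[OF R1_gt_R0])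
    show "continuous_on {R_0..R_1} ?q"
      by (intro continuous_intros continuous_on_subset[OF J_continuous]) (use R0_nonneg phi_pos[of R_0] in auto)
    show "DERIV ?q x :> 0" if "R_0 < x" "x < R_1" for x
    proof -
      have "DERIV ?q x :> Ph x / ph x - (Ph R_0 + ph R_0 * (x - R_0)) / ph R_0"
        using that R0_nonneg by (auto intro!: derivative_eq_intros J_deriv)
      also have "Ph x / ph x - (Ph R_0 + ph R_0 * (x - R_0)) / ph R_0 = 0"
        using that Phi_tail[of x] phi_const[of x] by simp
      finally show ?thesis .
    qed
  qed
  moreover have "J R_0 \<ge> 0" using J_mono[of 0 R_0] R0_nonneg by simp
  ultimately have "J R_1 \<ge> (Ph R_0 * (R_1 - R_0) + ph R_0 * (R_1 - R_0)\<^sup>2 / 2) / ph R_0" by simp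
  moreover have "(R_1 - R_0) * Ph R_1 / (2 * ph R_0) \<le> (Ph R_0 * (R_1 - R_0) + ph R_0 * (R_1 - R_0)\<^sup>2 / 2) / ph R_0"
  proof -
    have "0 \<le> Ph R_0 * (R_1 - R_0)"
      using Phi_mono[of 0 R_0] R0_nonneg R1_gt_R0 by simp
    then have "(R_1 - R_0) * Ph R_1 / 2 \<le> Ph R_0 * (R_1 - R_0) + ph R_0 * (R_1 - R_0)\<^sup>2 / 2"
      unfolding Phi_tail[OF R1_ge_R0]
      by (simp add: algebra_simps power2_eq_square add_divide_distrib diff_divide_distrib)
    from divide_right_mono[OF this less_imp_le[OF phi_pos[of R_0]]] show ?thesis by simp
  qed
  ultimately show ?thesis by (simp add: I1_eq)
qed

lemma g_eq: "gf r = 1 - 1/2 * J (min r R_1) / I1"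
  by (simp add: g_fun_def J_def I1_def)

lemma g_continuous: "continuous_on {0..} gf"
proof -
  have "continuous_on {0..} (\<lambda>r. J (min r R_1))"
    by (rule continuous_on_compose2[OF J_continuous]) (use R1_pos in \<open>auto intro!: continuous_intros\<close>)
  then show ?thesis unfolding g_eq[abs_def] using I1_pos by (intro continuous_intros) auto
qed

lemma g_antimono: assumes "0 \<le> r" "r \<le> s" shows "gf s \<le> gf r"
  using J_mono[of "min r R_1" "min s R_1"] assms R1_pos I1_pos by (simp add: g_eq divide_right_mono min.mono)

lemma g_bounds: assumes "0 \<le> r" shows "1/2 \<le> gf r" "gf r \<le> 1"
  using J_mono[of "min r R_1" R_1] J_mono[of 0 "min r R_1"] assms R1_pos I1_pos by (auto simp: g_eq I1_eq)

lemma g_tail: "r \<ge> R_1 \<Longrightarrow> gf r = 1/2"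
  using I1_pos by (simp add: g_eq I1_eq)

lemma g_deriv: assumes "0 < r" "r < R_1" shows "(gf has_real_derivative - (1/2) * (Ph r / ph r) / I1) (at r)"
proof -
  have "((\<lambda>r. 1 - 1/2 * J r / I1) has_real_derivative - (1/2) * (Ph r / ph r) / I1) (at r)"
    using assms by (auto intro!: derivative_eq_intros J_deriv)
  moreover have "\<forall>\<^sub>F u in nhds r. 1 - 1/2 * J u / I1 = gf u"
    using eventually_nhds_in_open[of "{..<R_1}" r] assms by (auto elim!: eventually_mono simp: g_eq)
  ultimately show ?thesis by (subst (asm) DERIV_cong_ev[OF refl _ refl]) auto
qed

section \<open>Monotonicity, concavity and linear bounds of f\<close>

lemma f'_continuous: "continuous_on {0..} f'"
  unfolding f'_def[abs_def] by (intro continuous_intros phi_continuous g_continuous)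

lemma f'_pos: "0 \<le> r \<Longrightarrow> f' r > 0"
  using g_bounds[of r] by (simp add: f'_def)

lemma f'_le_phi: "0 \<le> r \<Longrightarrow> f' r \<le> ph r"
  using g_bounds[of r] phi_pos[of r] by (simp add: f'_def)

lemma f'_le_1: "0 \<le> r \<Longrightarrow> f' r \<le> 1"
  using f'_le_phi[of r] phi_le_1[of r] by simp

lemma f'_ge: "0 \<le> r \<Longrightarrow> f' r \<ge> ph R_0 / 2"
  unfolding f'_def using mult_mono[OF phi_ge[of r] g_bounds(1)[of r]] phi_pos[of r] by (simp add: less_imp_le)

lemma f'_antimono: "0 \<le> r \<Longrightarrow> r \<le> s \<Longrightarrow> f' s \<le> f' r"
  unfolding f'_def using phi_antimono[of r s] g_antimono[of r s] g_bounds[of s]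
  by (intro mult_mono) (auto simp: less_imp_le)

lemma f_eq: "f r = (LBINT s:{0..r}. f' s)" by (simp add: f_fun_def f'_def)

lemma f_continuous: "continuous_on {0..} f"
  unfolding f_eq[abs_def] by (intro LBINT_upto_continuous_on set_integrable_upto_continuous f'_continuous)

lemma f_deriv: "r > 0 \<Longrightarrow> (f has_real_derivative f' r) (at r)"
  unfolding f_eq[abs_def]
  by (intro LBINT_upto_has_derivative set_integrable_upto_continuous f'_continuous
      continuous_on_subset[OF f'_continuous]) auto

lemma f_0 [simp]: "f 0 = 0" by (simp add: f_eq)

lemma f_MVT: assumes "0 \<le> r" "r < s" shows "\<exists>u>r. u < s \<and> f s - f r = (s - r) * f' u"
  unfolding f_eq by (rule LBINT_upto_MVT[OF f'_continuous assms])

lemma f_mono: assumes "0 \<le> r" "r \<le> s" shows "f r \<le> f s"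
proof (cases "r = s")
  case False
  then obtain u where u: "r < u" "f s - f r = (s - r) * f' u" using f_MVT[of r s] assms by auto
  moreover have "(s - r) * f' u \<ge> 0" using assms u f'_pos[of u] by simp
  ultimately show ?thesis by linarith
qed simp

lemma f_nonneg: "0 \<le> r \<Longrightarrow> 0 \<le> f r"
  using f_mono[of 0 r] by simp

lemma f_Lipschitz: assumes "0 \<le> r" "r \<le> s" shows "f s - f r \<le> s - r"
proof (cases "r = s")
  case False
  then obtain u where u: "r < u" "f s - f r = (s - r) * f' u" using f_MVT[of r s] assms by auto
  then show ?thesis using assms f'_le_1[of u] mult_left_mono[of "f' u" 1 "s - r"] by simp
qed simp

lemma f_le: "0 \<le> r \<Longrightarrow> f r \<le> r"
  using f_Lipschitz[of 0 r] by simp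

lemma f_ge: assumes "0 \<le> r" shows "f r \<ge> ph R_0 / 2 * r"
proof (cases "r = 0")
  case False
  then obtain u where u: "0 < u" "f r - f 0 = (r - 0) * f' u" using f_MVT[of 0 r] assms by auto
  then show ?thesis using assms f'_ge[of u] mult_left_mono[of "ph R_0 / 2" "f' u" r] by (simp add: mult.commute)
qed simp

text \<open>Concavity in tangent form. Only the monotonicity of \<open>f'\<close> enters, so the
  bound is available across \<open>R_1\<close>, where \<open>f\<close> has no second
  derivative.\<close>

lemma f_tangent: assumes "0 < r" "0 \<le> s" shows "f s \<le> f r + f' r * (s - r)"
proof (cases r s rule: linorder_cases)
  case less
  then obtain u where u: "r < u" "f s - f r = (s - r) * f' u" using f_MVT[of r s] assms by auto
  then show ?thesis using less assms mult_left_mono[OF f'_antimono[of r u], of "s - r"] by (simp add: algebra_simps)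
next
  case greater
  then obtain u where u: "s < u" "u < r" "f r - f s = (r - s) * f' u" using f_MVT[of s r] assms by auto
  then show ?thesis using greater assms mult_left_mono[OF f'_antimono[of u r], of "r - s"] by (simp add: algebra_simps)
qed simp

lemma f_le_Phi: assumes "0 \<le> r" shows "f r \<le> Ph r"
proof -
  have "(Ph 0 - f 0) \<le> (Ph r - f r)"
  proof (rule DERIV_nonneg_imp_increasing_open[OF assms])
    show "continuous_on {0..r} (\<lambda>r. Ph r - f r)"
      by (intro continuous_intros continuous_on_subset[OF Phi_continuous] continuous_on_subset[OF f_continuous]) auto
    show "\<exists>y. ((\<lambda>r. Ph r - f r) has_real_derivative y) (at x) \<and> 0 \<le> y" if "0 < x" "x < r" for x
      using f'_le_phi[of x] that by (intro exI[of _ "ph x - f' x"]) (auto intro!: derivative_eq_intros Phi_deriv f_deriv)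
  qed
  then show ?thesis by simp
qed

section \<open>Second derivative and the differential inequality\<close>

lemma f'_deriv: assumes "0 < r" "r < R_1" shows "(f' has_real_derivative f'' r) (at r)"
proof -
  have "((\<lambda>r. ph r * gf r) has_real_derivative
      (- (1/4) * (r * neg_part (\<kappa> r)) * ph r) * gf r + (- (1/2) * (Ph r / ph r) / I1) * ph r) (at r)"
    by (intro DERIV_mult phi_deriv g_deriv assms)
  also have "(- (1/4) * (r * neg_part (\<kappa> r)) * ph r) * gf r + (- (1/2) * (Ph r / ph r) / I1) * ph r = f'' r"
    using I1_neq_0 by (simp add: f''_def f'_def)
  finally show ?thesis by (simp add: f'_def[abs_def])
qed

lemma f''_continuous: "continuous_on {0<..} f''"
  unfolding f''_def[abs_def] neg_part_def
  using I1_pos by (intro continuous_intros kappa_cont continuous_on_subset[OF f'_continuous] continuous_on_subset[OF Phi_continuous]) auto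

text \<open>The factor \<open>ph\<close> is built so that the first term of \<open>f''\<close>
  absorbs the worst drift, as - \<kappa> is at most its negative part. The factor \<open>gf\<close>
  supplies the remaining \<open>- Ph r / (2 * I1)\<close>, and \<open>f\<close> is at most
  \<open>Ph\<close>.\<close>

lemma generator_inside: assumes "0 < r" shows "f'' r - 1/4 * r * \<kappa> r * f' r \<le> - f r / (2 * I1)"
proof -
  have "- \<kappa> r \<le> neg_part (\<kappa> r)" by (simp add: neg_part_def)
  then have "- \<kappa> r * (r * f' r) \<le> neg_part (\<kappa> r) * (r * f' r)"
    using assms f'_pos[of r] by (intro mult_right_mono) auto
  moreover have "f r / (2 * I1) \<le> Ph r / (2 * I1)"
    using f_le_Phi[of r] assms I1_pos by (intro divide_right_mono) auto
  ultimately show ?thesis unfolding f''_def by (simp add: algebra_simps)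
qed

text \<open>Beyond \<open>R_1\<close> the drift contracts without any diffusion term. The ratio of
  \<open>f r\<close> to \<open>r\<close> is at most that of \<open>Ph R_1\<close> to
  \<open>R_1\<close>, and \<open>I1_ge\<close> bounds the normalisation. The constant 8 in the
  definition of \<open>R_1\<close> is then exactly what is needed: 4 against the drift factor 1/4
  and 2 against the value 1/2 of \<open>gf\<close>.\<close>

lemma generator_outside: assumes "r \<ge> R_1" shows "- 1/4 * r * \<kappa> r * f' r \<le> - f r / (2 * I1)"
proof -
  have r: "r > 0" using assms R1_pos by simp
  have fr: "f' r = ph R_0 / 2" using g_tail[OF assms] phi_const[of r] assms R1_ge_R0 by (simp add: f'_def)
  define D where "D = R_1 * (R_1 - R_0)"
  have D: "D > 0" using R1_pos R1_gt_R0 by (simp add: D_def)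
  have k: "\<kappa> r \<ge> 8 / D" using kappa_R1[OF assms] D by (simp add: D_def field_simps)
  have "f r \<le> Ph r" using f_le_Phi r by simp
  also have "Ph r = Ph R_1 + ph R_0 * (r - R_1)"
    using Phi_tail[of r] Phi_tail[of R_1] assms R1_ge_R0 by (simp add: algebra_simps)
  also have "\<dots> \<le> Ph R_1 + Ph R_1 / R_1 * (r - R_1)"
    using Phi_ge[of R_1] R1_pos assms phi_const[OF R1_ge_R0] by (intro add_left_mono mult_right_mono) (auto simp: field_simps)
  also have "\<dots> = Ph R_1 * r / R_1" using R1_pos by (simp add: field_simps)
  finally have 1: "f r \<le> Ph R_1 * r / R_1" .
  have "f r / (2 * I1) \<le> (Ph R_1 * r / R_1) / (2 * ((R_1 - R_0) * Ph R_1 / (2 * ph R_0)))"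
  proof (rule frac_le)
    show "0 \<le> Ph R_1 * r / R_1" "f r \<le> Ph R_1 * r / R_1" "2 * ((R_1 - R_0) * Ph R_1 / (2 * ph R_0)) \<le> 2 * I1"
      using 1 I1_ge Phi_pos[OF R1_pos] r R1_pos by auto
    show "0 < 2 * ((R_1 - R_0) * Ph R_1 / (2 * ph R_0))" using R1_gt_R0 Phi_pos[OF R1_pos] by simp
  qed
  also have "\<dots> = 1/4 * r * (8 / D) * (ph R_0 / 2)"
    using Phi_pos[OF R1_pos] R1_pos R1_gt_R0 phi_pos[of R_0] by (simp add: D_def field_simps)
  also have "\<dots> \<le> 1/4 * r * \<kappa> r * f' r"
    unfolding fr using k r by (intro mult_right_mono mult_left_mono) (auto simp: less_imp_le)
  finally show ?thesis by simp
qed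

text \<open>By continuity the estimate without diffusion persists slightly below \<open>R_1\<close>
  at a cost \<open>e\<close>. Reflection can thus be switched off at some \<open>R < R_1\<close>,
  which leaves a margin that a single reflected step on a good path cannot cross.\<close>

lemma generator_near_R1:
  assumes "e > 0"
  obtains R where "R_0 < R" "0 < R" "R < R_1" "\<And>r. r \<ge> R \<Longrightarrow> - 1/4 * r * \<kappa> r * f' r \<le> - f r / (2 * I1) + e"
proof -
  let ?q = "\<lambda>r. - 1/4 * r * \<kappa> r * f' r + f r / (2 * I1)"
  have "continuous_on {0<..} ?q"
    using I1_pos by (intro continuous_intros kappa_cont continuous_on_subset[OF f'_continuous] continuous_on_subset[OF f_continuous]) auto
  then have "isCont ?q R_1" using R1_pos by (simp add: continuous_on_eq_continuous_at)
  then have "(?q \<longlongrightarrow> ?q R_1) (at_left R_1)" by (simp add: isCont_def filterlim_at_split)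
  moreover have "?q R_1 < e" using generator_outside[of R_1] assms by simp
  ultimately have "\<forall>\<^sub>F r in at_left R_1. ?q r < e" by (rule order_tendstoD)
  then obtain b where b: "b < R_1" "\<And>r. b < r \<Longrightarrow> r < R_1 \<Longrightarrow> ?q r < e"
    by (auto simp: eventually_at_left_field)
  define R where "R = (max (max b R_0) 0 + R_1) / 2"
  have R: "b < R" "R_0 < R" "0 < R" "R < R_1" using b R1_gt_R0 R1_pos by (auto simp: R_def)
  have "- 1/4 * r * \<kappa> r * f' r \<le> - f r / (2 * I1) + e" if "r \<ge> R" for r
    using b(2)[of r] generator_outside[of r] R that assms by (cases "r < R_1") auto
  then show ?thesis using that R by blast
qed

text \<open>The loss \<open>e\<close> is the modulus of continuity of \<open>f''\<close>, uniform on
  a compact part of \<open>(0, R_1)\<close>. The lower end \<open>d\<close> keeps away from a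
  possible singularity of \<kappa> at 0.\<close>

lemma f_Taylor:
  assumes "0 < d" "R < R_1" "e > 0"
  obtains s0 where "s0 > 0" "\<And>r s. d \<le> r \<Longrightarrow> r \<le> R \<Longrightarrow> \<bar>s\<bar> \<le> s0 \<Longrightarrow>
     f (r + s) \<le> f r + f' r * s + (f'' r + e) / 2 * s\<^sup>2"
proof -
  define R' where "R' = (R + R_1) / 2"
  have R': "R < R'" "R' < R_1" using assms by (auto simp: R'_def)
  have "uniformly_continuous_on {d/2..R'} f''"
    using assms by (intro compact_uniformly_continuous continuous_on_subset[OF f''_continuous]) auto
  then obtain s1 where s1: "s1 > 0" "\<And>x y. x \<in> {d/2..R'} \<Longrightarrow> y \<in> {d/2..R'} \<Longrightarrow> dist y x < s1 \<Longrightarrow> dist (f'' y) (f'' x) < e"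
    using assms(3) unfolding uniformly_continuous_on_def by metis
  \<comment> \<open>Keeps \<open>r + s\<close> inside \<open>[d/2, R']\<close> and within the
    modulus of continuity belonging to \<open>e\<close>.\<close>
  define s0 where "s0 = min (s1/2) (min (d/2) (R' - R))"
  have s0: "s0 > 0" "s0 < s1" "s0 \<le> d/2" "s0 \<le> R' - R"
    using s1(1) assms R' by (auto simp: s0_def min_def)
  have "f (r + s) \<le> f r + f' r * s + (f'' r + e) / 2 * s\<^sup>2" if r: "d \<le> r" "r \<le> R" "\<bar>s\<bar> \<le> s0" for r s
  proof (cases "s = 0")
    case False
    let ?D = "\<lambda>m. if m = 0 then f else if m = (1::nat) then f' else f''"
    have "\<exists>t. (if r + s < r then r + s < t \<and> t < r else r < t \<and> t < r + s) \<and>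
         f (r + s) = (\<Sum>m<2. ?D m r / fact m * (r + s - r) ^ m) + ?D 2 t / fact 2 * (r + s - r) ^ 2"
    proof (rule Taylor[of 2 ?D f "d/2" R' r "r + s"])
      show "\<forall>m t. m < 2 \<and> d / 2 \<le> t \<and> t \<le> R' \<longrightarrow> (?D m has_real_derivative ?D (Suc m) t) (at t)"
        using f_deriv f'_deriv assms R' by (auto simp: less_2_cases_iff)
    qed (use r s0 assms R' False in auto)
    then obtain t where t: "if r + s < r then r + s < t \<and> t < r else r < t \<and> t < r + s"
       "f (r + s) = f r + f' r * s + f'' t / 2 * s\<^sup>2"
      by (auto simp: numeral_2_eq_2)
    have "dist (f'' t) (f'' r) < e"
      using t(1) r s0 assms R' by (intro s1(2)) (auto simp: dist_real_def split: if_splits)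
    then have "f'' t \<le> f'' r + e" by (simp add: dist_real_def)
    then show ?thesis unfolding t(2) by (intro add_left_mono mult_right_mono) auto
  qed simp
  then show ?thesis using that s0(1) by blast
qed

end

section \<open>Pathwise solution of the equation\<close>

lemma matrix_vector_norm_bound: "norm (A *v v) \<le> onorm ((*v) A) * norm (v :: real ^ 'n)"
  for A :: "real ^ 'n ^ 'm"
  by (rule onorm[OF matrix_vector_mul_bounded_linear])

lemma norm_le_of_split:
  fixes a p q r :: "'a::real_normed_vector"
  assumes "a = p + q - r" "norm q = Q" "norm r \<le> e"
  shows "norm a \<le> norm p + Q + e"
  using norm_triangle_ineq4[of "p + q" r] norm_triangle_ineq[of p q] assms by simp

text \<open>The path enters through its values and not through increments, so the solution starts in
  \<open>z\<close> when \<open>w 0 = 0\<close>; this is why that condition recurs.\<close>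

definition ode_solution ::
    "(real ^ 'n \<Rightarrow> real ^ 'n) \<Rightarrow> real ^ 'n ^ 'n \<Rightarrow> real \<Rightarrow> real ^ 'n \<Rightarrow> (real \<Rightarrow> real ^ 'n) \<Rightarrow> (real \<Rightarrow> real ^ 'n) \<Rightarrow> bool" where
  "ode_solution b \<sigma> T z w x \<longleftrightarrow> continuous_on {0..T} x \<and>
     (\<forall>t\<in>{0..T}. x t = z + integral {0..t} (\<lambda>s. b (x s)) + \<sigma> *v w t)"

primrec euler ::
    "(real ^ 'n \<Rightarrow> real ^ 'n) \<Rightarrow> real ^ 'n ^ 'n \<Rightarrow> real \<Rightarrow> real ^ 'n \<Rightarrow> (real \<Rightarrow> real ^ 'n) \<Rightarrow> nat \<Rightarrow> real ^ 'n" where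
  "euler b \<sigma> \<eta> z w 0 = z"
| "euler b \<sigma> \<eta> z w (Suc k) = euler b \<sigma> \<eta> z w k + \<eta> *\<^sub>R b (euler b \<sigma> \<eta> z w k)
     + \<sigma> *v (w (\<eta> * real (Suc k)) - w (\<eta> * real k))"

definition dyadic_euler where
  "dyadic_euler b \<sigma> T z w n = euler b \<sigma> (T / 2 ^ n) z w (2 ^ n)"

text \<open>Dyadic schemes make the functional depend on countably many coordinates of the path, so
  it is measurable for the product sigma-algebra. Where the schemes diverge the value is arbitrary,
  and every use supplies convergence separately.\<close>

definition flow where
  "flow b \<sigma> T z w = lim (dyadic_euler b \<sigma> T z w)"

lemma dyadic_le: "0 \<le> T \<Longrightarrow> k \<le> 2 ^ n \<Longrightarrow> T / 2 ^ n * real k \<in> {0..T}"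
proof -
  assume *: "0 \<le> T" "k \<le> 2 ^ n"
  have "real k \<le> 2 ^ n" using *(2) by (metis of_nat_le_iff of_nat_numeral of_nat_power)
  then have "T * real k \<le> T * 2 ^ n" using * by (intro mult_left_mono) auto
  then show ?thesis using * by (simp add: field_simps)
qed

lemma euler_cong:
  assumes "\<And>j. j \<le> k \<Longrightarrow> w (\<eta> * real j) = w' (\<eta> * real j)"
  shows "euler b \<sigma> \<eta> z w k = euler b \<sigma> \<eta> z w' k"
  using assms by (induction k) (auto simp del: of_nat_Suc)

lemma dyadic_euler_cong:
  assumes "0 \<le> T" "\<And>t. t \<in> {0..T} \<Longrightarrow> w t = w' t"
  shows "dyadic_euler b \<sigma> T z w = dyadic_euler b \<sigma> T z w'"
  unfolding dyadic_euler_def fun_eq_iff using assms dyadic_le by (auto intro!: euler_cong)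

lemma flow_cong:
  assumes "0 \<le> T" "\<And>t. t \<in> {0..T} \<Longrightarrow> w t = w' t"
  shows "flow b \<sigma> T z w = flow b \<sigma> T z w'"
  unfolding flow_def using dyadic_euler_cong[OF assms] by simp

lemma flow_0: "flow b \<sigma> 0 z w = z"
proof -
  have "euler b \<sigma> 0 z w k = z" for k by (induction k) auto
  then show ?thesis by (simp add: flow_def dyadic_euler_def[abs_def])
qed

lemma integral_continuous_combine:
  fixes u :: "real \<Rightarrow> 'a::euclidean_space"
  assumes "continuous_on {0..T} u" "0 \<le> s" "s \<le> t" "t \<le> T"
  shows "integral {0..t} u = integral {0..s} u + integral {s..t} u"
  using assms
  by (intro Henstock_Kurzweil_Integration.integral_combine[symmetric] integrable_continuous_interval continuous_on_subset[OF assms(1)]) auto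

lemma ode_solution_increment:
  assumes "ode_solution b \<sigma> T z w x" "continuous_on UNIV b" "0 \<le> s" "s \<le> t" "t \<le> T"
  shows "x t - x s = integral {s..t} (\<lambda>u. b (x u)) + \<sigma> *v (w t - w s)"
proof -
  have "continuous_on {0..T} (\<lambda>u. b (x u))"
    using assms by (auto simp: ode_solution_def intro: continuous_on_compose2)
  from integral_continuous_combine[OF this assms(3-5)] show ?thesis
    using assms by (simp add: ode_solution_def matrix_vector_mult_diff_distrib)
qed

text \<open>The restarted solution is driven by the path re-centred at time \<open>h\<close>. This
  is the deterministic core of the flow property.\<close>

lemma ode_solution_shift:
  assumes sol: "ode_solution b \<sigma> (h + T) z w x" and "continuous_on UNIV b" "0 \<le> h" "0 \<le> T"
  shows "ode_solution b \<sigma> T (x h) (\<lambda>t. w (h + t) - w h) (\<lambda>t. x (h + t))"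
  unfolding ode_solution_def
proof (intro conjI ballI)
  have c: "continuous_on {0..h + T} x" using sol by (simp add: ode_solution_def)
  show "continuous_on {0..T} (\<lambda>t. x (h + t))"
    by (rule continuous_on_compose2[OF c]) (use assms in \<open>auto intro!: continuous_intros\<close>)
  fix t assume t: "t \<in> {0..T}"
  let ?u = "\<lambda>u. b (x u)"
  have cu: "continuous_on {h..h + t} ?u"
    by (rule continuous_on_compose2[OF assms(2)]) (use assms t in \<open>auto intro!: continuous_on_subset[OF c]\<close>)
  have "(?u has_integral integral {h..h + t} ?u) {h..h + t}"
    using cu by (intro integrable_integral integrable_continuous_interval)
  then have "((\<lambda>s. ?u (s + h)) has_integral integral {h..h + t} ?u) {0..t}"
    using has_integral_shift_Icc_real[of ?u h "integral {h..h + t} ?u" 0 t] by (simp add: o_def add.commute)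
  then have "integral {0..t} (\<lambda>s. b (x (h + s))) = integral {h..h + t} ?u"
    by (simp add: add.commute integral_unique)
  then show "x (h + t) = x h + integral {0..t} (\<lambda>s. b (x (h + s))) + \<sigma> *v (w (h + t) - w h)"
    using ode_solution_increment[OF sol assms(2,3), of "h + t"] t by (simp add: algebra_simps)
qed

locale locally_Lipschitz_drift =
  fixes b :: "real ^ 'n \<Rightarrow> real ^ 'n" and \<sigma> :: "real ^ 'n ^ 'n"
  assumes loc_lip: "local_lipschitz (UNIV :: real set) UNIV (\<lambda>_. b)"
begin

lemma b_Lipschitz_on_cball:
  obtains L where "L \<ge> 0" "\<And>x y. norm x \<le> K \<Longrightarrow> norm y \<le> K \<Longrightarrow> norm (b x - b y) \<le> L * norm (x - y)"
proof -
  have "local_lipschitz {0::real} (cball 0 K) (\<lambda>_. b)"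
    by (rule local_lipschitz_subset[OF loc_lip]) auto
  then obtain L where L: "\<And>t::real. t \<in> {0} \<Longrightarrow> L-lipschitz_on (cball 0 K) b"
    by (rule local_lipschitz_compact_implies_lipschitz) auto
  then show ?thesis
    using that[of L] lipschitz_on_nonneg[OF L[of 0]] lipschitz_onD[OF L[of 0]] by (auto simp: dist_norm)
qed

lemma b_continuous: "continuous_on UNIV b"
proof -
  have "isCont b x" for x
  proof -
    obtain L where L: "\<And>u v. norm u \<le> norm x + 1 \<Longrightarrow> norm v \<le> norm x + 1 \<Longrightarrow> norm (b u - b v) \<le> L * norm (u - v)" "L \<ge> 0"
      using b_Lipschitz_on_cball by metis
    have "L-lipschitz_on (ball x 1) b"
    proof (rule lipschitz_onI)
      fix u v assume "u \<in> ball x 1" "v \<in> ball x 1"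
      then have "norm u \<le> norm x + 1" "norm v \<le> norm x + 1"
        using norm_triangle_sub[of u x] norm_triangle_sub[of v x] by (auto simp: dist_norm norm_minus_commute)
      then show "dist (b u) (b v) \<le> L * dist u v" using L by (simp add: dist_norm)
    qed fact
    then have "continuous_on (ball x 1) b" by (rule lipschitz_on_continuous_on)
    then show ?thesis by (simp add: continuous_on_eq_continuous_at)
  qed
  then show ?thesis by (simp add: continuous_on_eq_continuous_at)
qed

lemma b_bounded_on_cball:
  obtains C where "C \<ge> 0" "\<And>x. norm x \<le> K \<Longrightarrow> norm (b x) \<le> C"
proof -
  have "compact (b ` cball 0 K)"
    by (rule compact_continuous_image[OF continuous_on_subset[OF b_continuous]]) auto
  then obtain C where "\<forall>y\<in>b ` cball 0 K. norm y \<le> C" by (auto dest!: compact_imp_bounded simp: bounded_iff)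
  then show ?thesis by (intro that[of "max C 0"]) (auto simp: le_max_iff_disj)
qed

text \<open>With constant \<sigma> the noise increments of scheme and solution cancel exactly, so
  the roughness of the path does not matter: the local error is only the oscillation of
  \<open>b\<close> along the continuous solution. A discrete Gronwall argument sums it up, and at
  the same time keeps the scheme within distance 1 of the solution, so that one Lipschitz constant
  on a ball suffices.\<close>

lemma dyadic_euler_tendsto:
  assumes sol: "ode_solution b \<sigma> T z w x" and T: "0 \<le> T" and w0: "w 0 = 0"
  shows "dyadic_euler b \<sigma> T z w \<longlonglongrightarrow> x T"
proof (rule LIMSEQ_I)
  fix e :: real assume "e > 0"
  \<comment> \<open>The cap 1 is the width of the tube around the solution on which the Lipschitz
    constant is valid.\<close>
  define \<epsilon> where "\<epsilon> = min e 1"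
  have eps: "\<epsilon> > 0" "\<epsilon> \<le> e" "\<epsilon> \<le> 1" using \<open>e > 0\<close> by (auto simp: \<epsilon>_def)
  have xc: "continuous_on {0..T} x" using sol by (simp add: ode_solution_def)
  obtain C where C: "\<And>t. t \<in> {0..T} \<Longrightarrow> norm (x t) \<le> C"
    using compact_imp_bounded[OF compact_continuous_image[OF xc compact_Icc]] unfolding bounded_iff by blast
  obtain L where L: "L \<ge> 0" "\<And>u v. norm u \<le> C + 1 \<Longrightarrow> norm v \<le> C + 1 \<Longrightarrow> norm (b u - b v) \<le> L * norm (u - v)"
    using b_Lipschitz_on_cball by metis
  \<comment> \<open>Allowed oscillation of the drift, small enough that the Gronwall factor still
    gives less than \<epsilon>; \<open>T + 1\<close> covers the case \<open>T = 0\<close>.\<close>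
  define \<theta> where "\<theta> = \<epsilon> / (2 * (T + 1) * exp (L * T))"
  have th: "\<theta> > 0" using eps T by (simp add: \<theta>_def)
  have thT: "\<theta> * T * exp (L * T) < \<epsilon>"
  proof -
    have "\<theta> * T * exp (L * T) = \<epsilon> * (T / (2 * (T + 1)))" using T by (simp add: \<theta>_def divide_simps)
    also have "\<dots> < \<epsilon> * 1" using eps T by (intro mult_strict_left_mono) (auto simp: field_simps)
    finally show ?thesis by simp
  qed
  let ?u = "\<lambda>s. b (x s)"
  have uc: "continuous_on {0..T} ?u"
    by (rule continuous_on_compose2[OF b_continuous xc]) auto
  obtain d where d: "d > 0" "\<And>s t. s \<in> {0..T} \<Longrightarrow> t \<in> {0..T} \<Longrightarrow> dist t s < d \<Longrightarrow> dist (?u t) (?u s) < \<theta>"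
    using compact_uniformly_continuous[OF uc compact_Icc] th unfolding uniformly_continuous_on_def by metis
  have "(\<lambda>n. T * (1 / 2) ^ n) \<longlonglongrightarrow> T * 0"
    by (intro tendsto_intros LIMSEQ_power_zero) auto
  then have "\<forall>\<^sub>F n in sequentially. T * (1 / 2) ^ n < d" using d(1) by (intro order_tendstoD) auto
  then obtain N where N: "\<And>n. n \<ge> N \<Longrightarrow> T / 2 ^ n < d"
    by (auto simp: eventually_sequentially power_divide)
  have "norm (dyadic_euler b \<sigma> T z w n - x T) < e" if "n \<ge> N" for n
  proof -
    define \<eta> where "\<eta> = T / 2 ^ n"
    have eta: "\<eta> \<ge> 0" "\<eta> < d" using T N[OF that] by (auto simp: \<eta>_def)
    have tk: "\<eta> * real k \<in> {0..T}" if "k \<le> 2 ^ n" for k using dyadic_le[OF T that] by (simp add: \<eta>_def)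
    let ?e = "euler b \<sigma> \<eta> z w"
    \<comment> \<open>The bound for step \<open>k\<close> is used twice: to confine the scheme to
      the tube, and then to propagate the error.\<close>
    have main: "k \<le> 2 ^ n \<Longrightarrow> norm (?e k - x (\<eta> * real k)) \<le> \<theta> * (\<eta> * real k) * (1 + L * \<eta>) ^ k" for k
    proof (induction k)
      case 0
      show ?case using sol T w0 by (simp add: ode_solution_def)
    next
      case (Suc k)
      let ?t = "\<eta> * real k" and ?t' = "\<eta> * real (Suc k)"
      have t: "?t \<in> {0..T}" "?t' \<in> {0..T}" using tk[of k] tk[of "Suc k"] Suc.prems by auto
      have tt: "?t \<le> ?t'" "?t' - ?t = \<eta>" using eta by (auto simp: algebra_simps)
      have IH: "norm (?e k - x ?t) \<le> \<theta> * ?t * (1 + L * \<eta>) ^ k" using Suc by simp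
      have pw: "(1 + L * \<eta>) ^ k \<le> exp (L * T)"
      proof -
        have "(1 + L * \<eta>) ^ k \<le> exp (L * \<eta>) ^ k"
          using L eta by (intro power_mono) auto
        also have "\<dots> = exp (L * ?t)" by (simp add: exp_of_nat_mult[symmetric] algebra_simps)
        also have "\<dots> \<le> exp (L * T)" using t L by (auto intro: mult_left_mono)
        finally show ?thesis .
      qed
      have "norm (?e k - x ?t) \<le> \<theta> * T * exp (L * T)"
        by (rule order_trans[OF IH]) (use t th pw L eta T in \<open>intro mult_mono; auto\<close>)
      then have e1: "norm (?e k - x ?t) \<le> 1" using thT eps by linarith
      have nx: "norm (x ?t) \<le> C" using C t by simp
      then have ne: "norm (?e k) \<le> C + 1" using e1 norm_triangle_sub[of "?e k" "x ?t"] by linarith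
      have lip: "norm (b (?e k) - b (x ?t)) \<le> L * norm (?e k - x ?t)" using L(2) ne nx by simp
      have int: "?u integrable_on {?t..?t'}"
        using t by (intro integrable_continuous_interval continuous_on_subset[OF uc]) auto
      have "norm (integral {?t..?t'} (\<lambda>s. ?u s - ?u ?t)) \<le> integral {?t..?t'} (\<lambda>s. \<theta>)"
      proof (rule integral_norm_bound_integral)
        show "(\<lambda>s. ?u s - ?u ?t) integrable_on {?t..?t'}" using int by (intro integrable_diff) auto
        show "norm (?u s - ?u ?t) \<le> \<theta>" if "s \<in> {?t..?t'}" for s
        proof -
          have "?t \<le> s" "s \<le> ?t'" "0 \<le> ?t" "?t' \<le> T" using that t by auto
          then have "s \<in> {0..T}" "dist s ?t < d"
            using tt eta unfolding atLeastAtMost_iff dist_real_def by linarith+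
          then show ?thesis using d(2)[of ?t s] t by (simp add: dist_norm)
        qed
      qed auto
      also have "integral {?t..?t'} (\<lambda>s. \<theta>) = \<eta> * \<theta>" using tt by simp
      also have "integral {?t..?t'} (\<lambda>s. ?u s - ?u ?t) = integral {?t..?t'} ?u - \<eta> *\<^sub>R ?u ?t"
        using int tt by (subst Henstock_Kurzweil_Integration.integral_diff) auto
      finally have rho: "norm (integral {?t..?t'} ?u - \<eta> *\<^sub>R ?u ?t) \<le> \<eta> * \<theta>" .
      have inc: "x ?t' - x ?t = integral {?t..?t'} ?u + \<sigma> *v (w ?t' - w ?t)"
        using t tt by (intro ode_solution_increment[OF sol b_continuous]) auto
      have "?e (Suc k) - x ?t' = (?e k - x ?t) + \<eta> *\<^sub>R (b (?e k) - ?u ?t) - (integral {?t..?t'} ?u - \<eta> *\<^sub>R ?u ?t)"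
        using inc by (simp add: algebra_simps del: of_nat_Suc)
      moreover have "norm (\<eta> *\<^sub>R (b (?e k) - ?u ?t)) = \<eta> * norm (b (?e k) - ?u ?t)" using eta by simp
      ultimately have "norm (?e (Suc k) - x ?t') \<le> norm (?e k - x ?t) + \<eta> * norm (b (?e k) - ?u ?t) + \<eta> * \<theta>"
        using rho by (rule norm_le_of_split)
      also have "\<dots> \<le> norm (?e k - x ?t) + \<eta> * (L * norm (?e k - x ?t)) + \<eta> * \<theta>"
        using lip eta by (intro add_mono mult_left_mono) auto
      also have "\<dots> = (1 + L * \<eta>) * norm (?e k - x ?t) + \<eta> * \<theta>" by (simp add: algebra_simps)
      \<comment> \<open>The new defect is enlarged by the growth factor so that both terms combine
        into one.\<close>
      also have "\<dots> \<le> (1 + L * \<eta>) * (\<theta> * ?t * (1 + L * \<eta>) ^ k) + \<eta> * \<theta> * (1 + L * \<eta>) ^ Suc k"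
      proof (intro add_mono mult_left_mono IH)
        have "\<eta> * \<theta> * 1 \<le> \<eta> * \<theta> * (1 + L * \<eta>) ^ Suc k"
          using L eta th by (intro mult_left_mono one_le_power) auto
        then show "\<eta> * \<theta> \<le> \<eta> * \<theta> * (1 + L * \<eta>) ^ Suc k" by simp
      qed (use L eta in auto)
      also have "\<dots> = \<theta> * ?t' * (1 + L * \<eta>) ^ Suc k" by (simp add: algebra_simps)
      finally show ?case .
    qed
    have "(1 + L * \<eta>) ^ (2 ^ n) \<le> exp (L * \<eta>) ^ (2 ^ n)" using L eta by (intro power_mono) auto
    also have "\<dots> = exp (L * T)" by (simp add: exp_of_nat_mult[symmetric] \<eta>_def)
    finally have pw: "(1 + L * \<eta>) ^ (2 ^ n) \<le> exp (L * T)" .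
    have "\<eta> * real (2 ^ n) = T" by (simp add: \<eta>_def)
    then have "norm (dyadic_euler b \<sigma> T z w n - x T) \<le> \<theta> * T * (1 + L * \<eta>) ^ (2 ^ n)"
      using main[of "2 ^ n"] by (simp add: dyadic_euler_def \<eta>_def)
    also have "\<dots> \<le> \<theta> * T * exp (L * T)" using pw th T by (intro mult_left_mono) auto
    finally show ?thesis using thT eps by linarith
  qed
  then show "\<exists>no. \<forall>n\<ge>no. norm (dyadic_euler b \<sigma> T z w n - x T) < e" by blast
qed

lemma flow_eq_solution:
  assumes "ode_solution b \<sigma> T z w x" "0 \<le> T" "w 0 = 0"
  shows "flow b \<sigma> T z w = x T"
  unfolding flow_def by (rule limI[OF dyadic_euler_tendsto[OF assms]])

text \<open>Convergence of the schemes and a bound on the path at dyadic points replace the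
  existence of a solution. The lemma therefore applies to the reflected path, for which no solution
  of the equation is given.\<close>

lemma flow_local_expansion:
  assumes conv: "convergent (dyadic_euler b \<sigma> h z w)" and h: "0 \<le> h"
    and zK: "norm z \<le> K"
    and L: "L \<ge> 0" "\<And>x y. norm x \<le> K + 1 \<Longrightarrow> norm y \<le> K + 1 \<Longrightarrow> norm (b x - b y) \<le> L * norm (x - y)"
    and C: "\<And>x. norm x \<le> K + 1 \<Longrightarrow> norm (b x) \<le> C"
    and wa: "\<And>n k. k \<le> 2 ^ n \<Longrightarrow> norm (\<sigma> *v (w (h / 2 ^ n * real k) - w 0)) \<le> a"
    and small: "h * C + a \<le> 1"
  shows "norm (flow b \<sigma> h z w - (z + h *\<^sub>R b z + \<sigma> *v (w h - w 0))) \<le> h * (L * (h * C + a))"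
proof -
  have C0: "C \<ge> 0" using C[of z] zK norm_ge_zero[of "b z"] by linarith
  have bd: "norm (dyadic_euler b \<sigma> h z w n - (z + h *\<^sub>R b z + \<sigma> *v (w h - w 0))) \<le> h * (L * (h * C + a))" for n
  proof -
    define \<eta> where "\<eta> = h / 2 ^ n"
    have eta: "\<eta> \<ge> 0" using h by (simp add: \<eta>_def)
    let ?e = "euler b \<sigma> \<eta> z w"
    \<comment> \<open>The first, cruder bound confines the scheme to the ball of radius
      \<open>K + 1\<close>; only then may the Lipschitz constant be used for the second.\<close>
    have main: "k \<le> 2 ^ n \<Longrightarrow> norm (?e k - (z + \<sigma> *v (w (\<eta> * real k) - w 0))) \<le> \<eta> * real k * C \<and>
        norm (?e k - (z + (\<eta> * real k) *\<^sub>R b z + \<sigma> *v (w (\<eta> * real k) - w 0))) \<le> \<eta> * real k * (L * (h * C + a))" for k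
    proof (induction k)
      case 0
      then show ?case by simp
    next
      case (Suc k)
      let ?t = "\<eta> * real k" and ?t' = "\<eta> * real (Suc k)"
      have tt: "?t' = ?t + \<eta>" by (simp add: algebra_simps)
      have "?t \<le> h" using dyadic_le[OF h, of k n] Suc.prems by (simp add: \<eta>_def)
      then have "?t * C \<le> h * C" using C0 by (intro mult_right_mono)
      moreover have "norm (?e k - (z + \<sigma> *v (w ?t - w 0))) \<le> ?t * C" using Suc by simp
      moreover have "norm (\<sigma> *v (w ?t - w 0)) \<le> a" using wa[of k n] Suc.prems by (simp add: \<eta>_def)
      moreover have "norm (?e k - z) \<le> norm (?e k - (z + \<sigma> *v (w ?t - w 0))) + norm (\<sigma> *v (w ?t - w 0))"
        using norm_triangle_ineq[of "?e k - (z + \<sigma> *v (w ?t - w 0))" "\<sigma> *v (w ?t - w 0)"] by simp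
      ultimately have ez: "norm (?e k - z) \<le> h * C + a" by linarith
      then have K: "norm (?e k) \<le> K + 1" "norm z \<le> K + 1" using small zK norm_triangle_sub[of "?e k" z] by auto
      have b1: "norm (b (?e k)) \<le> C" using C K by simp
      have "norm (b (?e k) - b z) \<le> L * norm (?e k - z)" using L K by simp
      also have "\<dots> \<le> L * (h * C + a)" using ez L by (intro mult_left_mono)
      finally have b2: "norm (b (?e k) - b z) \<le> L * (h * C + a)" .
      have split: "\<sigma> *v (w ?t' - w 0) = \<sigma> *v (w ?t - w 0) + \<sigma> *v (w ?t' - w ?t)"
        by (simp add: matrix_vector_mult_diff_distrib)
      have "norm (?e (Suc k) - (z + \<sigma> *v (w ?t' - w 0)))
          = norm ((?e k - (z + \<sigma> *v (w ?t - w 0))) + \<eta> *\<^sub>R b (?e k))"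
        unfolding split by (simp add: algebra_simps)
      also have "\<dots> \<le> ?t * C + \<eta> * C"
        using Suc b1 eta by (intro norm_triangle_le add_mono) (auto intro: mult_left_mono)
      also have "\<dots> = ?t' * C" by (simp add: algebra_simps)
      finally have 1: "norm (?e (Suc k) - (z + \<sigma> *v (w ?t' - w 0))) \<le> ?t' * C" .
      have "norm (?e (Suc k) - (z + ?t' *\<^sub>R b z + \<sigma> *v (w ?t' - w 0)))
          = norm ((?e k - (z + ?t *\<^sub>R b z + \<sigma> *v (w ?t - w 0))) + \<eta> *\<^sub>R (b (?e k) - b z))"
        unfolding split tt by (simp add: algebra_simps)
      also have "\<dots> \<le> ?t * (L * (h * C + a)) + \<eta> * (L * (h * C + a))"
        using Suc b2 eta by (intro norm_triangle_le add_mono) (auto intro: mult_left_mono)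
      also have "\<dots> = ?t' * (L * (h * C + a))" by (simp add: algebra_simps)
      finally show ?case using 1 by blast
    qed
    have "\<eta> * real (2 ^ n) = h" by (simp add: \<eta>_def)
    then show ?thesis using main[of "2 ^ n"] by (simp add: dyadic_euler_def \<eta>_def)
  qed
  have "dyadic_euler b \<sigma> h z w \<longlonglongrightarrow> flow b \<sigma> h z w"
    using conv by (simp add: flow_def convergent_LIMSEQ_iff)
  then have "(\<lambda>n. norm (dyadic_euler b \<sigma> h z w n - (z + h *\<^sub>R b z + \<sigma> *v (w h - w 0)))) \<longlonglongrightarrow>
     norm (flow b \<sigma> h z w - (z + h *\<^sub>R b z + \<sigma> *v (w h - w 0)))"
    by (intro tendsto_intros)
  then show ?thesis by (rule tendsto_upperbound) (use bd in auto)
qed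

end

text \<open>Under a common path the noise cancels in the difference, which becomes continuously
  differentiable inside the interval. After the last time at which the distance is at most the
  claimed bound the distance exceeds \<open>R\<close>, so its square cannot increase.\<close>

lemma (in pos_def_matrix) synchronous_bound:
  assumes x: "ode_solution b \<sigma> T z w x" and y: "ode_solution b \<sigma> T z' w y"
    and cb: "continuous_on UNIV b" and T: "0 \<le> T" and w0: "w 0 = 0"
    and diss: "\<And>u v. gnorm G (u - v) > R \<Longrightarrow> (u - v) \<bullet> (G *v (b u - b v)) \<le> 0"
  shows "gnorm G (x T - y T) \<le> max (gnorm G (z - z')) R"
proof (rule ccontr)
  define m where "m = max (gnorm G (z - z')) R"
  assume "\<not> ?thesis"
  then have gt: "gnorm G (x T - y T) > m" unfolding m_def by (simp only: not_le)
  define D where "D t = x t - y t" for t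
  have xc: "continuous_on {0..T} x" "continuous_on {0..T} y" using x y by (auto simp: ode_solution_def)
  have Dc: "continuous_on {0..T} D" unfolding D_def by (intro continuous_intros xc)
  have D0: "D 0 = z - z'" using x y T w0 by (auto simp: D_def ode_solution_def)
  \<comment> \<open>Closed in a compact interval and containing 0, so it has a largest element: the
    last time below the level.\<close>
  let ?S = "{t \<in> {0..T}. gnorm G (D t) \<le> m}"
  have "?S = {0..T} \<inter> (\<lambda>t. gnorm G (D t)) -` {..m}" by auto
  then have "closedin (top_of_set {0..T}) ?S"
    using continuous_closedin_preimage[OF continuous_on_gnorm[OF Dc] closed_atMost] by metis
  then have "closed ?S" using closedin_closed_trans by blast
  moreover have "bounded ?S" by (rule bounded_subset[OF bounded_closed_interval[of 0 T]]) auto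
  ultimately have "compact ?S" by (simp add: compact_eq_bounded_closed)
  moreover have "0 \<in> ?S" using T D0 by (simp add: m_def)
  ultimately obtain s where s: "s \<in> ?S" "\<And>t. t \<in> ?S \<Longrightarrow> t \<le> s"
    using compact_attains_sup[of ?S] by blast
  have sT: "s < T" using s(1) gt by (cases "s = T") (auto simp: D_def)
  let ?\<psi> = "\<lambda>t. D t \<bullet> (G *v D t)"
  let ?v = "\<lambda>t. b (x t) - b (y t)"
  have vc: "continuous_on {0..T} (\<lambda>t. b (x t))" "continuous_on {0..T} (\<lambda>t. b (y t))"
    by (rule continuous_on_compose2[OF cb xc(1)] continuous_on_compose2[OF cb xc(2)]; simp)+
  have der: "(D has_vector_derivative ?v t) (at t)" if "0 < t" "t < T" for t
  proof -
    have a: "at t within {0..T} = at t" by (rule at_within_interior) (use that in simp)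
    have "((\<lambda>u. integral {0..u} (\<lambda>s. b (x s))) has_vector_derivative b (x t)) (at t)"
      "((\<lambda>u. integral {0..u} (\<lambda>s. b (y s))) has_vector_derivative b (y t)) (at t)"
      using integral_has_vector_derivative[OF vc(1), of t] integral_has_vector_derivative[OF vc(2), of t] that by (auto simp: a)
    then have "((\<lambda>u. (z - z') + (integral {0..u} (\<lambda>s. b (x s)) - integral {0..u} (\<lambda>s. b (y s)))) has_vector_derivative ?v t) (at t)"
      by (subst add_0_left[symmetric], intro has_vector_derivative_add has_vector_derivative_diff has_vector_derivative_const)
    then show ?thesis
    proof (rule has_vector_derivative_transform_within_open)
      show "t \<in> {0<..<T}" using that by simp
      show "(z - z') + (integral {0..u} (\<lambda>s. b (x s)) - integral {0..u} (\<lambda>s. b (y s))) = D u"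
        if "u \<in> {0<..<T}" for u using x y that by (auto simp: ode_solution_def D_def)
    qed simp
  qed
  have deriv_psi: "DERIV ?\<psi> u :> ?v u \<bullet> (G *v D u) + D u \<bullet> (G *v ?v u)" if "s < u" "u < T" for u
  proof -
    have d: "(D has_vector_derivative ?v u) (at u)" using der that s by auto
    have "((\<lambda>t. G *v D t) has_vector_derivative G *v ?v u) (at u)"
      by (rule bounded_linear.has_vector_derivative[OF matrix_vector_mul_bounded_linear d])
    from bounded_bilinear.has_vector_derivative[OF bounded_bilinear_inner d this]
    show ?thesis by (simp add: has_real_derivative_iff_has_vector_derivative add.commute)
  qed
  have "\<exists>l u. s < u \<and> u < T \<and> DERIV ?\<psi> u :> l \<and> ?\<psi> T - ?\<psi> s = (T - s) * l"
  proof (rule MVT[OF sT])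
    have Ds: "continuous_on {s..T} D" by (rule continuous_on_subset[OF Dc]) (use s in auto)
    show "continuous_on {s..T} ?\<psi>"
      by (intro continuous_intros Ds continuous_on_compose2[OF linear_continuous_on[OF matrix_vector_mul_bounded_linear, of UNIV] Ds]) auto
    show "?\<psi> differentiable at u" if "s < u" "u < T" for u
      using deriv_psi[OF that] unfolding real_differentiable_def by blast
  qed
  then obtain l u where u: "s < u" "u < T" "DERIV ?\<psi> u :> l" "?\<psi> T - ?\<psi> s = (T - s) * l" by blast
  have "DERIV ?\<psi> u :> ?v u \<bullet> (G *v D u) + D u \<bullet> (G *v ?v u)" by (rule deriv_psi[OF u(1,2)])
  then have l: "l = 2 * (D u \<bullet> (G *v ?v u))" using DERIV_unique[OF u(3)] by (simp add: G_sym[of "?v u"])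
  have "gnorm G (D u) > m" using s(2)[of u] u s(1) by force
  then have "D u \<bullet> (G *v ?v u) \<le> 0" using diss[of "x u" "y u"] by (simp add: D_def m_def)
  then have "(T - s) * l \<le> 0" using l sT by (intro mult_nonneg_nonpos) auto
  then have "?\<psi> T \<le> ?\<psi> s" using u(4) by linarith
  then have "gnorm G (D T) \<le> gnorm G (D s)" by (simp add: gnorm_def)
  then show False using s(1) gt by (simp add: D_def)
qed

section \<open>Gaussian measures and Brownian paths\<close>

text \<open>Uniqueness of Haar measure: apply Fubini to the product of the two measures.\<close>

lemma translation_invariant_emeasure_cross:
  fixes m l :: "'a::euclidean_space measure"
  assumes "sigma_finite_measure m" "sigma_finite_measure l"
    and [measurable_cong, simp]: "sets m = sets borel" "sets l = sets borel"
    and tm: "\<And>t. distr m borel ((+) t) = m" and tl: "\<And>t. distr l borel ((+) t) = l"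
    and [measurable]: "A \<in> sets borel" "E \<in> sets borel"
  shows "emeasure m A * emeasure l E = emeasure l (uminus -` A) * emeasure m E"
proof -
  interpret m: sigma_finite_measure m by fact
  interpret l: sigma_finite_measure l by fact
  interpret ml: pair_sigma_finite m l ..
  have [measurable]: "uminus -` A \<in> sets borel"
    using measurable_sets_borel[of uminus borel A] by simp
  have [simp]: "space m = UNIV" "space l = UNIV" using sets_eq_imp_space_eq by fastforce+
  have sm: "(\<integral>\<^sup>+x. h (t + x) \<partial>m) = (\<integral>\<^sup>+x. h x \<partial>m)" if [measurable]: "h \<in> borel_measurable borel" for h t
    by (subst (2) tm[of t, symmetric]) (simp add: nn_integral_distr)
  have sl: "(\<integral>\<^sup>+x. h (t + x) \<partial>l) = (\<integral>\<^sup>+x. h x \<partial>l)" if [measurable]: "h \<in> borel_measurable borel" for h t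
    by (subst (2) tl[of t, symmetric]) (simp add: nn_integral_distr)
  have "emeasure m A * emeasure l E = (\<integral>\<^sup>+x. indicator A x * emeasure l E \<partial>m)"
    by (simp add: nn_integral_multc)
  also have "\<dots> = (\<integral>\<^sup>+x. (\<integral>\<^sup>+y. indicator A x * indicator E y \<partial>l) \<partial>m)"
    by (simp add: nn_integral_cmult)
  \<comment> \<open>Shift y by x, exchange the integrals, shift x by -y, exchange back, and shift y
    by x once more: the argument of A becomes -y and that of E becomes x, so the integrals separate
    again.\<close>
  also have "\<dots> = (\<integral>\<^sup>+x. (\<integral>\<^sup>+y. indicator A x * indicator E (x + y) \<partial>l) \<partial>m)"
    by (intro nn_integral_cong sl[symmetric]) simp
  also have "\<dots> = (\<integral>\<^sup>+y. (\<integral>\<^sup>+x. indicator A x * indicator E (x + y) \<partial>m) \<partial>l)"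
    by (rule ml.Fubini'[symmetric]) simp
  also have "\<dots> = (\<integral>\<^sup>+y. (\<integral>\<^sup>+x. indicator A (- y + x) * indicator E x \<partial>m) \<partial>l)"
  proof (rule nn_integral_cong)
    fix y
    show "(\<integral>\<^sup>+x. indicator A x * indicator E (x + y) \<partial>m) = (\<integral>\<^sup>+x. indicator A (- y + x) * indicator E x \<partial>m)"
      using sm[of "\<lambda>x. indicator A (- y + x) * indicator E x" y] by (simp add: add.commute)
  qed
  also have "\<dots> = (\<integral>\<^sup>+x. (\<integral>\<^sup>+y. indicator A (- y + x) * indicator E x \<partial>l) \<partial>m)"
    by (rule ml.Fubini') simp
  also have "\<dots> = (\<integral>\<^sup>+x. emeasure l (uminus -` A) * indicator E x \<partial>m)"
  proof (rule nn_integral_cong)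
    fix x
    have "(\<integral>\<^sup>+y. indicator A (- y + x) * indicator E x \<partial>l) = (\<integral>\<^sup>+y. indicator A (- (x + y) + x) * indicator E x \<partial>l)"
      by (rule sl[symmetric]) simp
    also have "\<dots> = (\<integral>\<^sup>+y. indicator (uminus -` A) y * indicator E x \<partial>l)"
      by (intro nn_integral_cong) (auto simp: indicator_def)
    also have "\<dots> = emeasure l (uminus -` A) * indicator E x"
      by (simp add: nn_integral_multc)
    finally show "(\<integral>\<^sup>+y. indicator A (- y + x) * indicator E x \<partial>l) = emeasure l (uminus -` A) * indicator E x" .
  qed
  also have "\<dots> = emeasure l (uminus -` A) * emeasure m E"
    by (simp add: nn_integral_cmult)
  finally show ?thesis .
qed

lemma emeasure_distr_density:
  assumes [measurable]: "r \<in> borel_measurable M" "g \<in> measurable M N" "A \<in> sets N"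
  shows "emeasure (distr (density M r) N g) A = (\<integral>\<^sup>+z. r z * indicator A (g z) \<partial>M)"
proof -
  have "emeasure (distr (density M r) N g) A = (\<integral>\<^sup>+z. indicator A z \<partial>distr (density M r) N g)"
    by simp
  also have "\<dots> = (\<integral>\<^sup>+z. indicator A (g z) \<partial>density M r)"
    by (rule nn_integral_distr) auto
  also have "\<dots> = (\<integral>\<^sup>+z. r z * indicator A (g z) \<partial>M)"
    by (rule nn_integral_density) auto
  finally show ?thesis .
qed

text \<open>The image measure is translation invariant because Q is linear and onto, and agrees with
  Lebesgue measure on centred balls because Q is an isometry. Comparing the cross identity for both
  measures, with the unit ball as second set, leaves no free factor.\<close>

lemma lborel_orthogonal_transformation:
  fixes Q :: "real ^ 'n \<Rightarrow> real ^ 'n"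
  assumes Q: "orthogonal_transformation Q"
  shows "distr lborel borel Q = lborel"
proof -
  define m where "m = distr lborel borel Q"
  have lin: "linear Q" using Q by (simp add: orthogonal_transformation_def)
  have [measurable]: "Q \<in> borel_measurable borel"
    by (intro borel_measurable_continuous_onI linear_continuous_on linear_conv_bounded_linear[THEN iffD1] lin)
  have [measurable_cong, simp]: "sets m = sets borel" by (simp add: m_def)
  have nQ: "norm (Q x) = norm x" for x using Q by (simp add: orthogonal_transformation)
  have ball: "emeasure m (ball 0 r) = emeasure lborel (ball (0::real^'n) r)" for r
  proof -
    have "Q -` ball 0 r = ball 0 r" by (auto simp: nQ)
    then show ?thesis by (simp add: m_def emeasure_distr)
  qed
  have tm: "distr m borel ((+) t) = m" for t
  proof -
    obtain u where u: "Q u = t" using orthogonal_transformation_surj[OF Q] by (metis surjD)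
    have "distr m borel ((+) t) = distr lborel borel (\<lambda>x. t + Q x)"
      by (simp add: m_def distr_distr o_def)
    also have "(\<lambda>x. t + Q x) = (\<lambda>x. Q (u + x))" by (simp add: u linear_add[OF lin])
    also have "distr lborel borel (\<lambda>x. Q (u + x)) = distr (distr lborel borel ((+) u)) borel Q"
      by (simp add: distr_distr o_def)
    finally show ?thesis by (simp add: lborel_distr_plus m_def)
  qed
  have fin: "emeasure lborel (ball (0::real^'n) r) \<noteq> \<infinity>" "emeasure lborel (ball (0::real^'n) r) \<noteq> \<top>" for r
    using emeasure_lborel_ball_finite[of "0::real^'n" r] by auto
  have sf: "sigma_finite_measure m"
  proof
    show "\<exists>A. countable A \<and> A \<subseteq> sets m \<and> \<Union> A = space m \<and> (\<forall>a\<in>A. emeasure m a \<noteq> \<infinity>)"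
    proof (intro exI conjI)
      have "x \<in> (\<Union>n::nat. ball 0 (real n))" for x :: "real ^ 'n"
        using reals_Archimedean2[of "norm x"] by auto
      then show "\<Union> (range (\<lambda>n::nat. ball (0::real^'n) (real n))) = space m"
        by (auto simp: m_def)
    qed (auto simp: ball fin)
  qed
  have E: "emeasure lborel (ball (0::real^'n) 1) \<noteq> 0"
    using content_ball_eq_0_iff[of "0::real^'n" 1] by (auto simp: measure_def simp del: content_ball_eq_0_iff)
  show ?thesis
  proof (rule measure_eqI)
    fix A :: "(real ^ 'n) set" assume "A \<in> sets (distr lborel borel Q)"
    then have [measurable]: "A \<in> sets borel" by simp
    have "emeasure m A * emeasure lborel (ball (0::real^'n) 1) = emeasure lborel (uminus -` A) * emeasure m (ball 0 1)"
      by (rule translation_invariant_emeasure_cross[OF sf sigma_finite_lborel _ _ tm lborel_distr_plus]; measurable)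
    moreover have "emeasure lborel A * emeasure lborel (ball (0::real^'n) 1) = emeasure lborel (uminus -` A) * emeasure lborel (ball (0::real^'n) 1)"
      by (rule translation_invariant_emeasure_cross[OF sigma_finite_lborel sigma_finite_lborel _ _ lborel_distr_plus lborel_distr_plus]; measurable)
    ultimately have eq: "emeasure m A * emeasure lborel (ball (0::real^'n) 1) = emeasure lborel A * emeasure lborel (ball (0::real^'n) 1)"
      by (simp only: ball)
    have "emeasure m A = emeasure m A * emeasure lborel (ball (0::real^'n) 1) / emeasure lborel (ball (0::real^'n) 1)"
      by (rule mult_divide_eq_ennreal[symmetric, OF E fin(2)])
    also have "\<dots> = emeasure lborel A"
      unfolding eq by (rule mult_divide_eq_ennreal[OF E fin(2)])
    finally show "emeasure (distr lborel borel Q) A = emeasure lborel A" by (simp add: m_def)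
  qed simp
qed

definition gauss :: "real \<Rightarrow> (real ^ 'n) measure" where
  "gauss s = density lborel (\<lambda>z. ennreal (\<Prod>i\<in>UNIV. normal_density 0 (sqrt s) (z $ i)))"

lemma sets_gauss [measurable_cong, simp]: "sets (gauss s) = sets borel"
  by (simp add: gauss_def)

lemma space_gauss [simp]: "space (gauss s) = UNIV"
  by (simp add: gauss_def)

lemma gauss_density_radial:
  fixes z :: "real ^ 'n"
  assumes "s \<ge> 0"
  shows "(\<Prod>i\<in>UNIV. normal_density 0 (sqrt s) (z $ i)) =
     (1 / sqrt (2 * pi * s)) ^ CARD('n) * exp (- (norm z)\<^sup>2 / (2 * s))"
proof -
  have "(\<Prod>i\<in>UNIV. normal_density 0 (sqrt s) (z $ i)) =
      (\<Prod>i\<in>(UNIV :: 'n set). 1 / sqrt (2 * pi * s)) * exp (\<Sum>i\<in>UNIV. - (z $ i)\<^sup>2 / (2 * s))"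
    using assms by (simp add: normal_density_def prod_dividef exp_sum power_one_over)
  also have "(\<Sum>i\<in>UNIV. - (z $ i)\<^sup>2 / (2 * s)) = - (norm z)\<^sup>2 / (2 * s)"
    by (simp add: norm_vec_def L2_set_def sum_nonneg sum_negf sum_divide_distrib[symmetric])
  finally show ?thesis by simp
qed

lemma gauss_orthogonal:
  fixes Q :: "real ^ 'n \<Rightarrow> real ^ 'n"
  assumes Q: "orthogonal_transformation Q" and s: "s \<ge> 0"
  shows "distr (gauss s) borel Q = (gauss s :: (real ^ 'n) measure)"
proof (rule measure_eqI)
  have lin: "linear Q" using Q by (simp add: orthogonal_transformation_def)
  have [measurable]: "Q \<in> borel_measurable borel"
    by (intro borel_measurable_continuous_onI linear_continuous_on linear_conv_bounded_linear[THEN iffD1] lin)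
  have nQ: "norm (Q x) = norm x" for x using Q by (simp add: orthogonal_transformation)
  fix A assume "A \<in> sets (distr (gauss s) borel Q)"
  then have [measurable]: "A \<in> sets borel" by simp
  let ?r = "\<lambda>z::real^'n. ennreal (\<Prod>i\<in>UNIV. normal_density 0 (sqrt s) (z $ i))"
  have "emeasure (distr (gauss s) borel Q) A = (\<integral>\<^sup>+z. ?r z * indicator A (Q z) \<partial>lborel)"
    unfolding gauss_def by (rule emeasure_distr_density) auto
  also have "\<dots> = (\<integral>\<^sup>+z. ?r (Q z) * indicator A (Q z) \<partial>lborel)"
    by (simp only: gauss_density_radial[OF s] nQ)
  also have "\<dots> = (\<integral>\<^sup>+z. ?r z * indicator A z \<partial>(distr lborel borel Q))"
    by (simp add: nn_integral_distr)
  also have "\<dots> = emeasure (gauss s) A"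
    by (simp add: lborel_orthogonal_transformation[OF Q] gauss_def emeasure_density)
  finally show "emeasure (distr (gauss s) borel Q) A = emeasure (gauss s) A" .
qed simp

lemma Basis_real_vec: "(Basis :: (real ^ 'n) set) = (\<lambda>i. axis i 1) ` UNIV"
  by (auto simp: Basis_vec_def)

lemma gauss_coordinate:
  assumes s: "s > 0"
  shows "distr (gauss s :: (real ^ 'n) measure) borel (\<lambda>z. z $ i) = density lborel (normal_density 0 (sqrt s))"
proof (rule measure_eqI)
  fix A assume "A \<in> sets (distr (gauss s :: (real ^ 'n) measure) borel (\<lambda>z. z $ i))"
  then have [measurable]: "A \<in> sets borel" by simp
  let ?nd = "\<lambda>x. ennreal (normal_density 0 (sqrt s) x)"
  \<comment> \<open>The indicator is attached to coordinate \<open>i\<close> alone, so that after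
    factorisation all other integrals equal 1.\<close>
  define u where "u b x = (if b = axis i (1::real) then ?nd x * indicator A x else ?nd x)" for b :: "real ^ 'n" and x
  have one: "(\<integral>\<^sup>+x. ?nd x \<partial>lborel) = 1"
    using emeasure_density[of "?nd" lborel UNIV] prob_space.emeasure_space_1[OF prob_space_normal_density[of "sqrt s" 0]] s by simp
  have inj: "inj (\<lambda>i::'n. axis i (1::real))" by (auto simp: inj_on_def axis_eq_axis)
  have prodB: "(\<Prod>b\<in>Basis. F b) = (\<Prod>j\<in>UNIV. F (axis j 1))" for F :: "real ^ 'n \<Rightarrow> ennreal"
    unfolding Basis_real_vec by (subst prod.reindex[OF inj]) simp
  have "emeasure (distr (gauss s :: (real ^ 'n) measure) borel (\<lambda>z. z $ i)) A =
     (\<integral>\<^sup>+z. ennreal (\<Prod>j\<in>UNIV. normal_density 0 (sqrt s) (z $ j)) * indicator A (z $ i) \<partial>(lborel :: (real ^ 'n) measure))"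
    unfolding gauss_def by (rule emeasure_distr_density) auto
  also have "\<dots> = (\<integral>\<^sup>+z. (\<Prod>b\<in>Basis. u b (z \<bullet> b)) \<partial>(lborel :: (real ^ 'n) measure))"
  proof (rule nn_integral_cong)
    fix z :: "real ^ 'n"
    have "(\<Prod>j\<in>UNIV. u (axis j 1) (z \<bullet> axis j 1)) = (\<Prod>j\<in>UNIV. ?nd (z $ j) * (if j = i then indicator A (z $ i) else 1))"
      by (intro prod.cong) (auto simp: u_def axis_eq_axis inner_axis)
    also have "\<dots> = (\<Prod>j\<in>UNIV. ?nd (z $ j)) * indicator A (z $ i)"
      by (simp add: prod.distrib)
    finally show "ennreal (\<Prod>j\<in>UNIV. normal_density 0 (sqrt s) (z $ j)) * indicator A (z $ i) = (\<Prod>b\<in>Basis. u b (z \<bullet> b))"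
      by (simp add: prodB prod_ennreal)
  qed
  also have "\<dots> = (\<Prod>b\<in>Basis. (\<integral>\<^sup>+x. u b x \<partial>lborel))"
    by (rule nn_integral_lborel_prod) (auto simp: u_def[abs_def])
  also have "\<dots> = (\<Prod>j\<in>UNIV. if j = i then (\<integral>\<^sup>+x. ?nd x * indicator A x \<partial>lborel) else 1)"
    unfolding prodB
  proof (intro prod.cong refl)
    fix j :: 'n
    have "u (axis j 1) = (\<lambda>x. if j = i then ?nd x * indicator A x else ?nd x)"
      by (rule ext) (simp add: u_def axis_eq_axis)
    then show "(\<integral>\<^sup>+x. u (axis j 1) x \<partial>lborel) = (if j = i then (\<integral>\<^sup>+x. ?nd x * indicator A x \<partial>lborel) else 1)"
      using one by simp
  qed
  also have "\<dots> = emeasure (density lborel (normal_density 0 (sqrt s))) A"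
    by (simp add: emeasure_density)
  finally show "emeasure (distr (gauss s :: (real ^ 'n) measure) borel (\<lambda>z. z $ i)) A = emeasure (density lborel (normal_density 0 (sqrt s))) A" .
qed simp

text \<open>Rotate \<open>e\<close> to a coordinate axis and use the rotation invariance of the
  Gaussian measure.\<close>

lemma gauss_inner:
  fixes e :: "real ^ 'n"
  assumes s: "s > 0" and e: "norm e = 1"
  shows "distr (gauss s) borel (\<lambda>z. e \<bullet> z) = density lborel (normal_density 0 (sqrt s))"
proof -
  fix i :: 'n
  have "norm e = norm (axis i (1::real))" using e by (simp add: norm_axis_1)
  then obtain Q where Q: "orthogonal_transformation Q" "Q e = axis i (1::real)"
    by (rule orthogonal_transformation_exists)
  have lin: "linear Q" using Q by (simp add: orthogonal_transformation_def)
  have [measurable]: "Q \<in> borel_measurable borel"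
    by (intro borel_measurable_continuous_onI linear_continuous_on linear_conv_bounded_linear[THEN iffD1] lin)
  have "e \<bullet> z = Q z $ i" for z
  proof -
    have "e \<bullet> z = Q e \<bullet> Q z" using Q(1) by (simp add: orthogonal_transformation_def)
    also have "\<dots> = Q z $ i" by (simp add: Q(2) inner_axis')
    finally show ?thesis .
  qed
  then have "(\<lambda>z. e \<bullet> z) = (\<lambda>z. z $ i) \<circ> Q" by (simp only: o_def)
  then have "distr (gauss s) borel (\<lambda>z. e \<bullet> z) = distr (distr (gauss s) borel Q) borel (\<lambda>z. z $ i)"
    by (simp only:) (rule distr_distr[symmetric]; measurable)
  then show ?thesis using s by (simp add: gauss_orthogonal[OF Q(1)] gauss_coordinate)
qed

section \<open>Brownian paths as random elements of a product space\<close>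

abbreviation path_space :: "(real \<Rightarrow> real ^ 'n) measure" where
  "path_space \<equiv> PiM {0..} (\<lambda>_. borel)"

definition sample_path :: "(real \<Rightarrow> 'w \<Rightarrow> real ^ 'n) \<Rightarrow> 'w \<Rightarrow> real \<Rightarrow> real ^ 'n" where
  "sample_path W \<omega> = (\<lambda>t\<in>{0..}. W t \<omega>)"

definition time_shift :: "real \<Rightarrow> (real \<Rightarrow> 'w \<Rightarrow> real ^ 'n) \<Rightarrow> real \<Rightarrow> 'w \<Rightarrow> real ^ 'n" where
  "time_shift h W t \<omega> = W (h + t) \<omega> - W h \<omega>"

text \<open>Only finite-dimensional data and no continuity: this is stable under rotations and time
  shifts and determines the law on \<open>path_space\<close>. The value 0 at time 0 is demanded
  everywhere, so that values telescope into increments at every point.\<close>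

definition wiener :: "'w measure \<Rightarrow> (real \<Rightarrow> 'w \<Rightarrow> real ^ 'n) \<Rightarrow> bool" where
  "wiener M W \<longleftrightarrow>
     prob_space M \<and>
     (\<forall>t\<ge>0. W t \<in> borel_measurable M) \<and>
     (\<forall>\<omega>\<in>space M. W 0 \<omega> = 0) \<and>
     (\<forall>(n::nat) t. 0 \<le> t 0 \<and> (\<forall>i<n. t i \<le> t (Suc i)) \<longrightarrow>
        prob_space.indep_vars M (\<lambda>_. borel) (\<lambda>i \<omega>. W (t (Suc i)) \<omega> - W (t i) \<omega>) {..<n}) \<and>
     (\<forall>s t. 0 \<le> s \<and> s < t \<longrightarrow> distr M borel (\<lambda>\<omega>. W t \<omega> - W s \<omega>) = gauss (t - s))"

lemma wiener_prob_space: "wiener M W \<Longrightarrow> prob_space M"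
  by (simp add: wiener_def)

lemma wiener_measurable: "wiener M W \<Longrightarrow> t \<ge> 0 \<Longrightarrow> W t \<in> borel_measurable M"
  by (simp add: wiener_def)

lemma wiener_0: "wiener M W \<Longrightarrow> \<omega> \<in> space M \<Longrightarrow> W 0 \<omega> = 0"
  by (simp add: wiener_def)

lemma wiener_increment: "wiener M W \<Longrightarrow> 0 \<le> s \<Longrightarrow> s < t \<Longrightarrow> distr M borel (\<lambda>\<omega>. W t \<omega> - W s \<omega>) = gauss (t - s)"
  by (simp add: wiener_def)

lemma wiener_indep:
  "wiener M W \<Longrightarrow> 0 \<le> t 0 \<Longrightarrow> (\<And>i. i < n \<Longrightarrow> t i \<le> t (Suc i)) \<Longrightarrow>
    prob_space.indep_vars M (\<lambda>_. borel) (\<lambda>i \<omega>. W (t (Suc i)) \<omega> - W (t i) \<omega>) {..<n}"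
  by (simp add: wiener_def)

lemma wiener_marginal: "wiener M W \<Longrightarrow> 0 < t \<Longrightarrow> distr M borel (W t) = gauss t"
proof -
  assume *: "wiener M W" "0 < t"
  have "distr M borel (W t) = distr M borel (\<lambda>\<omega>. W t \<omega> - W 0 \<omega>)"
    by (intro distr_cong) (auto simp: wiener_0[OF *(1)])
  then show ?thesis using wiener_increment[OF *(1), of 0 t] *(2) by simp
qed

lemma path_measurable [measurable]: "wiener M W \<Longrightarrow> sample_path W \<in> measurable M path_space"
  unfolding sample_path_def[abs_def] by (rule measurable_restrict) (simp add: wiener_measurable)

lemma brownian_motion_wiener:
  assumes "brownian_motion M B" shows "wiener M (\<lambda>t \<omega>. B t \<omega> - B 0 \<omega>)"
proof -
  have "distr M borel Y = distr M lborel Y" for Y :: "'a \<Rightarrow> real ^ 'b" by (rule distr_cong) auto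
  with assms show ?thesis
    unfolding wiener_def brownian_motion_def distributed_def gauss_def
    by (auto intro!: borel_measurable_diff)
qed

lemma wiener_orthogonal:
  fixes Q :: "real ^ 'n \<Rightarrow> real ^ 'n"
  assumes W: "wiener M W" and Q: "orthogonal_transformation Q"
  shows "wiener M (\<lambda>t \<omega>. Q (W t \<omega>))"
proof -
  interpret prob_space M using W by (rule wiener_prob_space)
  have lin: "linear Q" using Q by (simp add: orthogonal_transformation_def)
  have Qm [measurable]: "Q \<in> borel_measurable borel"
    by (intro borel_measurable_continuous_onI linear_continuous_on linear_conv_bounded_linear[THEN iffD1] lin)
  have [measurable]: "\<And>t. t \<ge> 0 \<Longrightarrow> W t \<in> borel_measurable M" by (rule wiener_measurable[OF W])
  have diff: "Q x - Q y = Q (x - y)" for x y by (simp add: linear_diff[OF lin])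
  have 1: "distr M borel (\<lambda>\<omega>. Q (W t \<omega> - W s \<omega>)) = gauss (t - s)" if "0 \<le> s" "s < t" for s t
  proof -
    have "distr M borel (\<lambda>\<omega>. Q (W t \<omega> - W s \<omega>)) = distr (distr M borel (\<lambda>\<omega>. W t \<omega> - W s \<omega>)) borel Q"
      using that by (subst distr_distr) (auto simp: o_def)
    then show ?thesis using that by (simp add: wiener_increment[OF W] gauss_orthogonal[OF Q])
  qed
  have 2: "indep_vars (\<lambda>_. borel) (\<lambda>i \<omega>. Q (W (t (Suc i)) \<omega> - W (t i) \<omega>)) {..<n}"
    if "0 \<le> t 0" "\<And>i. i < n \<Longrightarrow> t i \<le> t (Suc i)" for t and n :: nat
    by (rule indep_vars_compose2[OF wiener_indep[OF W that]]) auto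
  show ?thesis
    unfolding wiener_def diff
    using 1 2 prob_space_axioms wiener_0[OF W] linear_0[OF lin] by auto
qed

lemma wiener_shift:
  assumes W: "wiener M W" and h: "0 \<le> h" shows "wiener M (time_shift h W)"
proof -
  interpret prob_space M using W by (rule wiener_prob_space)
  have "indep_vars (\<lambda>_. borel) (\<lambda>i \<omega>. W (h + t (Suc i)) \<omega> - W (h + t i) \<omega>) {..<n}"
    if "0 \<le> t 0" "\<And>i. i < n \<Longrightarrow> t i \<le> t (Suc i)" for t and n :: nat
    using wiener_indep[OF W, of "\<lambda>i. h + t i" n] that h by auto
  moreover have "distr M borel (\<lambda>\<omega>. W (h + t) \<omega> - W (h + s) \<omega>) = gauss (t - s)" if "0 \<le> s" "s < t" for s t
    using wiener_increment[OF W, of "h + s" "h + t"] h that by simp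
  ultimately show ?thesis
    unfolding wiener_def time_shift_def using h prob_space_axioms wiener_measurable[OF W] by auto
qed

lemma finite_times_enumeration:
  fixes J :: "real set"
  assumes "finite J" "J \<subseteq> {0..}"
  shows "\<exists>(t :: nat \<Rightarrow> real) n. t 0 = 0 \<and> n \<ge> 1 \<and> (\<forall>i j. i < j \<longrightarrow> j \<le> n \<longrightarrow> t i < t j) \<and> J \<subseteq> t ` {..n}"
proof -
  \<comment> \<open>The time 0 starts the telescoping sums; the time 1 guarantees at least one
    increment, so that the index set of the product measure is not empty.\<close>
  define S where "S = insert 0 (insert 1 J)"
  define xs where "xs = sorted_list_of_set S"
  define n where "n = card S - 1"
  have S: "finite S" "S \<subseteq> {0..}" "0 \<in> S" using assms by (auto simp: S_def)
  have "card {0, 1::real} \<le> card S" by (rule card_mono) (use S in \<open>auto simp: S_def\<close>)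
  then have n: "n \<ge> 1" "length xs = Suc n" by (auto simp: n_def xs_def)
  have st: "xs ! i < xs ! j" if "i < j" "j \<le> n" for i j
    using sorted_wrt_nth_less[OF strict_sorted_list_of_set[of S]] that n by (simp add: xs_def)
  have set: "set xs = S" using S by (simp add: xs_def)
  have "xs ! 0 \<in> S" using set n nth_mem[of 0 xs] by simp
  then have ge: "xs ! 0 \<ge> 0" using S by auto
  obtain k where k: "k \<le> n" "xs ! k = 0" using S(3) set n by (metis in_set_conv_nth less_Suc_eq_le)
  then have z: "xs ! 0 = 0" using st[of 0 k] ge by (cases "k = 0") auto
  have "J \<subseteq> (\<lambda>i. xs ! i) ` {..n}"
  proof
    fix x assume "x \<in> J"
    then have "x \<in> set xs" using set by (simp add: S_def)
    then show "x \<in> (\<lambda>i. xs ! i) ` {..n}" using n by (auto simp: in_set_conv_nth less_Suc_eq_le)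
  qed
  then show ?thesis using z n(1) st by (intro exI[of _ "\<lambda>i. xs ! i"] exI[of _ n]) blast
qed

lemma wiener_telescope:
  assumes "wiener M W" "t 0 = (0::real)" "\<omega> \<in> space M"
  shows "W (t k) \<omega> = (\<Sum>i<k. W (t (Suc i)) \<omega> - W (t i) \<omega>)"
  by (subst sum_lessThan_telescope) (simp add: assms wiener_0[OF assms(1)])

text \<open>Values at grid times are partial sums of independent Gaussian increments. The right-hand
  side no longer mentions \<open>W\<close>, so it is common to all processes with property
  \<open>wiener\<close>.\<close>

lemma wiener_path_cylinder:
  fixes W :: "real \<Rightarrow> 'w \<Rightarrow> real ^ 'n"
  assumes W: "wiener M W" and t: "t 0 = 0" "n \<ge> 1" "\<And>i j. i < j \<Longrightarrow> j \<le> n \<Longrightarrow> t i < t j"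
    and k: "\<And>j. j \<in> J \<Longrightarrow> k j \<le> n" "\<And>j. j \<in> J \<Longrightarrow> t (k j) = j" and J: "finite J" "J \<subseteq> {0..}"
    and A: "\<And>j. j \<in> J \<Longrightarrow> A j \<in> sets borel"
  shows "emeasure (distr M path_space (sample_path W)) (prod_emb {0..} (\<lambda>_. borel) J (Pi\<^sub>E J A)) =
    emeasure (PiM {..<n} (\<lambda>i. gauss (t (Suc i) - t i)))
      {d \<in> space (PiM {..<n} (\<lambda>_. borel)). \<forall>j\<in>J. (\<Sum>i<k j. d i) \<in> A j}"
proof -
  interpret prob_space M using W by (rule wiener_prob_space)
  let ?inc = "\<lambda>i \<omega>. W (t (Suc i)) \<omega> - W (t i) \<omega>"
  let ?P = "PiM {..<n} (\<lambda>_. borel :: (real ^ 'n) measure)"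
  let ?H = "{d \<in> space ?P. \<forall>j\<in>J. (\<Sum>i<k j. d i) \<in> A j}"
  have tp: "t i \<ge> 0" if "i \<le> n" for i using t(3)[of 0 i] that t(1) by (cases "i = 0") auto
  have incm: "?inc i \<in> borel_measurable M" if "i < n" for i
    using that wiener_measurable[OF W, of "t (Suc i)"] wiener_measurable[OF W, of "t i"] tp by auto
  have indep: "indep_vars (\<lambda>_. borel) ?inc {..<n}"
    using t by (intro wiener_indep[OF W]) (auto simp: less_imp_le)
  have "(\<Pi>\<^sub>M i\<in>{..<n}. distr M borel (?inc i)) = PiM {..<n} (\<lambda>i. gauss (t (Suc i) - t i))"
    using tp t by (intro PiM_cong refl wiener_increment[OF W]) auto
  then have law: "distr M ?P (\<lambda>\<omega>. \<lambda>i\<in>{..<n}. ?inc i \<omega>) = PiM {..<n} (\<lambda>i. gauss (t (Suc i) - t i))"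
    using indep_vars_iff_distr_eq_PiM'[of "{..<n}" ?inc "\<lambda>_. borel"] indep incm t(2)
    by (simp add: lessThan_empty_iff)
  have H: "?H \<in> sets ?P"
  proof (intro sets.sets_Collect_finite_All J)
    fix j assume j: "j \<in> J"
    have "(\<lambda>d. \<Sum>i<k j. d i) \<in> borel_measurable ?P"
      using k(1)[OF j] by (intro borel_measurable_sum measurable_component_singleton) auto
    from measurable_sets[OF this A[OF j]]
    show "{d \<in> space ?P. (\<Sum>i<k j. d i) \<in> A j} \<in> sets ?P" by (simp add: vimage_def Int_def conj_commute)
  qed
  have emb: "prod_emb {0..} (\<lambda>_. borel) J (Pi\<^sub>E J A) \<in> sets path_space"
    using J A by (intro sets_PiM_I) auto
  have mr: "(\<lambda>\<omega>. \<lambda>i\<in>{..<n}. ?inc i \<omega>) \<in> measurable M ?P"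
    by (rule measurable_restrict) (use incm in auto)
  have "sample_path W -` prod_emb {0..} (\<lambda>_. borel) J (Pi\<^sub>E J A) \<inter> space M = {\<omega> \<in> space M. \<forall>j\<in>J. W j \<omega> \<in> A j}"
    using J by (auto simp: prod_emb_iff sample_path_def subset_iff PiE_iff)
  also have "\<dots> = (\<lambda>\<omega>. \<lambda>i\<in>{..<n}. ?inc i \<omega>) -` ?H \<inter> space M"
  proof -
    have "W j \<omega> = (\<Sum>i<k j. (\<lambda>i\<in>{..<n}. ?inc i \<omega>) i)" if "\<omega> \<in> space M" "j \<in> J" for \<omega> j
    proof -
      have "W j \<omega> = W (t (k j)) \<omega>" using k(2)[OF that(2)] by simp
      also have "\<dots> = (\<Sum>i<k j. ?inc i \<omega>)" using W t(1) that(1) by (rule wiener_telescope)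
      also have "\<dots> = (\<Sum>i<k j. (\<lambda>i\<in>{..<n}. ?inc i \<omega>) i)"
        using k(1)[OF that(2)] by (intro sum.cong) auto
      finally show ?thesis .
    qed
    then show ?thesis using measurable_space[OF mr] by (auto simp del: restrict_apply)
  qed
  finally have eq: "sample_path W -` prod_emb {0..} (\<lambda>_. borel) J (Pi\<^sub>E J A) \<inter> space M = (\<lambda>\<omega>. \<lambda>i\<in>{..<n}. ?inc i \<omega>) -` ?H \<inter> space M" .
  have "emeasure (distr M path_space (sample_path W)) (prod_emb {0..} (\<lambda>_. borel) J (Pi\<^sub>E J A))
      = emeasure M ((\<lambda>\<omega>. \<lambda>i\<in>{..<n}. ?inc i \<omega>) -` ?H \<inter> space M)"
    unfolding eq[symmetric] by (rule emeasure_distr[OF path_measurable[OF W] emb])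
  also have "\<dots> = emeasure (distr M ?P (\<lambda>\<omega>. \<lambda>i\<in>{..<n}. ?inc i \<omega>)) ?H"
    by (rule emeasure_distr[OF mr H, symmetric])
  finally show ?thesis by (simp only: law)
qed

text \<open>Cylinders are stable under intersection and generate the path space. Two processes on
  different probability spaces, such as a shifted or a rotated one and the original, therefore have
  the same law.\<close>

lemma wiener_law_unique:
  fixes W :: "real \<Rightarrow> 'w \<Rightarrow> real ^ 'n" and V :: "real \<Rightarrow> 'v \<Rightarrow> real ^ 'n"
  assumes W: "wiener M W" and V: "wiener M' V"
  shows "distr M path_space (sample_path W) = distr M' path_space (sample_path V)"
proof (rule measure_eqI_PiM_infinite)
  fix A :: "real \<Rightarrow> (real ^ 'n) set" and J :: "real set"
  assume J: "finite J" "J \<subseteq> {0..}" and A: "\<And>i. i \<in> J \<Longrightarrow> A i \<in> sets borel"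
  obtain t :: "nat \<Rightarrow> real" and n :: nat where t0: "t 0 = 0" "n \<ge> 1" "\<forall>i j. i < j \<longrightarrow> j \<le> n \<longrightarrow> t i < t j" "J \<subseteq> t ` {..n}"
    using finite_times_enumeration[OF J] by blast
  note t = t0(1,2) t0(3)[rule_format] t0(4)
  have "\<forall>j\<in>J. \<exists>k\<le>n. t k = j" using t(4) by force
  then obtain k where k: "\<And>j. j \<in> J \<Longrightarrow> k j \<le> n" "\<And>j. j \<in> J \<Longrightarrow> t (k j) = j" by metis
  show "emeasure (distr M path_space (sample_path W)) (prod_emb {0..} (\<lambda>_. borel) J (Pi\<^sub>E J A)) =
    emeasure (distr M' path_space (sample_path V)) (prod_emb {0..} (\<lambda>_. borel) J (Pi\<^sub>E J A))"
    using wiener_path_cylinder[OF W t(1-3) k J A] wiener_path_cylinder[OF V t(1-3) k J A] by simp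
next
  interpret prob_space M using W by (rule wiener_prob_space)
  interpret D: prob_space "distr M path_space (sample_path W)"
    by (rule prob_space_distr[OF path_measurable[OF W]])
  show "finite_measure (distr M path_space (sample_path W))" by (rule D.finite_measure_axioms)
qed auto

text \<open>For cylinder events a common time grid through \<open>h\<close> expresses past and
  future by disjoint blocks of independent increments. Independence of the generated sigma-algebras
  follows from stability under intersection.\<close>

lemma wiener_indep_past_future:
  fixes W :: "real \<Rightarrow> 'w \<Rightarrow> real ^ 'n"
  assumes W: "wiener M W" and h: "0 \<le> h"
  shows "prob_space.indep_var M (PiM {0..h} (\<lambda>_. borel)) (\<lambda>\<omega>. \<lambda>t\<in>{0..h}. W t \<omega>) path_space (sample_path (time_shift h W))"
proof -
  interpret prob_space M using W by (rule wiener_prob_space)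
  let ?X = "\<lambda>\<omega>. \<lambda>t\<in>{0..h}. W t \<omega>" and ?Y = "sample_path (time_shift h W)"
  let ?S = "PiM {0..h} (\<lambda>_. borel :: (real ^ 'n) measure)"
  let ?A = "prod_algebra {0..h} (\<lambda>_. borel :: (real ^ 'n) measure)"
  let ?B = "prod_algebra {0..} (\<lambda>_. borel :: (real ^ 'n) measure)"
  have Xm: "?X \<in> measurable M ?S"
    by (rule measurable_restrict) (simp add: wiener_measurable[OF W])
  have Ym: "?Y \<in> measurable M path_space" by (rule path_measurable[OF wiener_shift[OF W h]])
  \<comment> \<open>The preimage of a generated sigma-algebra is generated by the preimages of its
    generators.\<close>
  have gen: "sigma_sets (space M) {X -` A \<inter> space M |A. A \<in> sets (PiM I (\<lambda>_. borel :: (real ^ 'n) measure))} =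
      sigma_sets (space M) {X -` A \<inter> space M |A. A \<in> prod_algebra I (\<lambda>_. borel)}"
    if "X \<in> measurable M (PiM I (\<lambda>_. borel :: (real ^ 'n) measure))" for X :: "'w \<Rightarrow> real \<Rightarrow> real ^ 'n" and I
  proof -
    have "X \<in> space M \<rightarrow> space (PiM I (\<lambda>_. borel))" using measurable_space[OF that] by auto
    then have "{X -` A \<inter> space M |A. A \<in> sets (PiM I (\<lambda>_. borel :: (real ^ 'n) measure))} =
       sigma_sets (space M) {X -` A \<inter> space M |A. A \<in> prod_algebra I (\<lambda>_. borel)}"
      unfolding sets_PiM by (intro sigma_sets_vimage_commute) (simp add: space_PiM)
    then show ?thesis by (simp only:) (rule sigma_sets_sigma_sets_eq, blast)
  qed
  have ist: "Int_stable {X -` A \<inter> space M |A. A \<in> prod_algebra I (\<lambda>_. borel :: (real ^ 'n) measure)}"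
    for X :: "'w \<Rightarrow> real \<Rightarrow> real ^ 'n" and I
  proof (rule Int_stableI)
    fix a b assume "a \<in> {X -` A \<inter> space M |A. A \<in> prod_algebra I (\<lambda>_. borel)}" "b \<in> {X -` A \<inter> space M |A. A \<in> prod_algebra I (\<lambda>_. borel)}"
    then obtain A B where "a = X -` A \<inter> space M" "b = X -` B \<inter> space M"
      and AB: "A \<in> prod_algebra I (\<lambda>_. borel)" "B \<in> prod_algebra I (\<lambda>_. borel)" by blast
    then have "a \<inter> b = X -` (A \<inter> B) \<inter> space M" by blast
    then show "a \<inter> b \<in> {X -` A \<inter> space M |A. A \<in> prod_algebra I (\<lambda>_. borel)}"
      using Int_stableD[OF Int_stable_prod_algebra AB] by blast
  qed
  have ind: "indep_set {?X -` A \<inter> space M |A. A \<in> ?A} {?Y -` A \<inter> space M |A. A \<in> ?B}"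
    unfolding indep_sets2_eq
  proof (intro conjI ballI)
    show "{?X -` A \<inter> space M |A. A \<in> ?A} \<subseteq> events"
      using measurable_sets[OF Xm] by (auto simp: sets_PiM)
    show "{?Y -` A \<inter> space M |A. A \<in> ?B} \<subseteq> events"
      using measurable_sets[OF Ym] by (auto simp: sets_PiM)
    fix a b assume "a \<in> {?X -` A \<inter> space M |A. A \<in> ?A}" "b \<in> {?Y -` A \<inter> space M |A. A \<in> ?B}"
    then obtain A B where ab: "a = ?X -` A \<inter> space M" "b = ?Y -` B \<inter> space M" and AB: "A \<in> ?A" "B \<in> ?B" by blast
    from AB(1) obtain J1 E1 where J1: "A = prod_emb {0..h} (\<lambda>_. borel) J1 (Pi\<^sub>E J1 E1)" "finite J1" "J1 \<subseteq> {0..h}"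
       "\<And>i. i \<in> J1 \<Longrightarrow> E1 i \<in> sets borel" by (elim prod_algebraE) auto
    from AB(2) obtain J2 E2 where J2: "B = prod_emb {0..} (\<lambda>_. borel) J2 (Pi\<^sub>E J2 E2)" "finite J2" "J2 \<subseteq> {0..}"
       "\<And>i. i \<in> J2 \<Longrightarrow> E2 i \<in> sets borel" by (elim prod_algebraE) auto
    \<comment> \<open>The time \<open>h\<close> is put on the grid to split the increments, and the
      times of the future event are moved to absolute time.\<close>
    define J where "J = J1 \<union> insert h ((+) h ` J2)"
    have "finite J" "J \<subseteq> {0..}" using J1 J2 h by (auto simp: J_def subset_iff)
    from finite_times_enumeration[OF this]
    obtain t :: "nat \<Rightarrow> real" and n :: nat where t0: "t 0 = 0" "n \<ge> 1" "\<forall>i j. i < j \<longrightarrow> j \<le> n \<longrightarrow> t i < t j" "J \<subseteq> t ` {..n}"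
      by blast
    note t = t0(1,2) t0(3)[rule_format] t0(4)
    have "\<forall>j\<in>J. \<exists>k\<le>n. t k = j" using t(4) by force
    then obtain k where k: "\<And>j. j \<in> J \<Longrightarrow> k j \<le> n" "\<And>j. j \<in> J \<Longrightarrow> t (k j) = j" by metis
    define m where "m = k h"
    have m: "m \<le> n" "t m = h" using k[of h] by (auto simp: m_def J_def)
    have tp: "t i \<ge> 0" if "i \<le> n" for i using t(3)[of 0 i] that t(1) by (cases "i = 0") auto
    have k1: "k j \<le> m" if "j \<in> J1" for j
    proof (rule ccontr)
      assume "\<not> k j \<le> m"
      moreover have "j \<in> J" "j \<le> h" using that J1(3) by (auto simp: J_def)
      ultimately show False using t(3)[of m "k j"] k[of j] m by simp
    qed
    have k2: "m \<le> k (h + j)" "k (h + j) \<le> n" "t (k (h + j)) = h + j" if "j \<in> J2" for j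
    proof -
      have j: "h + j \<in> J" "j \<ge> 0" using that J2(3) by (auto simp: J_def)
      then show "k (h + j) \<le> n" "t (k (h + j)) = h + j" using k by auto
      then show "m \<le> k (h + j)" using t(3)[of "k (h + j)" m] m j by (cases "m \<le> k (h + j)") auto
    qed
    let ?inc = "\<lambda>i \<omega>. W (t (Suc i)) \<omega> - W (t i) \<omega>"
    let ?N = "\<lambda>_. borel :: (real ^ 'n) measure"
    let ?H1 = "{d \<in> space (PiM {..<m} ?N). \<forall>j\<in>J1. (\<Sum>i<k j. d i) \<in> E1 j}"
    let ?H2 = "{d \<in> space (PiM {m..<n} ?N). \<forall>j\<in>J2. (\<Sum>i\<in>{m..<k (h + j)}. d i) \<in> E2 j}"
    have iv: "indep_vars ?N ?inc {..<n}"
      using t by (intro wiener_indep[OF W]) (auto simp: less_imp_le)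
    have i2: "indep_var (PiM {..<m} ?N) (\<lambda>\<omega>. \<lambda>i\<in>{..<m}. ?inc i \<omega>) (PiM {m..<n} ?N) (\<lambda>\<omega>. \<lambda>i\<in>{m..<n}. ?inc i \<omega>)"
      using m by (intro indep_var_restrict[OF iv]) auto
    have H1: "?H1 \<in> sets (PiM {..<m} ?N)"
    proof (intro sets.sets_Collect_finite_All J1)
      fix j assume j: "j \<in> J1"
      have "(\<lambda>d. \<Sum>i<k j. d i) \<in> borel_measurable (PiM {..<m} ?N)"
        using k1[OF j] by (intro borel_measurable_sum measurable_component_singleton) auto
      from measurable_sets[OF this J1(4)[OF j]]
      show "{d \<in> space (PiM {..<m} ?N). (\<Sum>i<k j. d i) \<in> E1 j} \<in> sets (PiM {..<m} ?N)"
        by (simp add: vimage_def Int_def conj_commute)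
    qed
    have H2: "?H2 \<in> sets (PiM {m..<n} ?N)"
    proof (intro sets.sets_Collect_finite_All J2)
      fix j assume j: "j \<in> J2"
      have "(\<lambda>d. \<Sum>i\<in>{m..<k (h + j)}. d i) \<in> borel_measurable (PiM {m..<n} ?N)"
        using k2[OF j] by (intro borel_measurable_sum measurable_component_singleton) auto
      from measurable_sets[OF this J2(4)[OF j]]
      show "{d \<in> space (PiM {m..<n} ?N). (\<Sum>i\<in>{m..<k (h + j)}. d i) \<in> E2 j} \<in> sets (PiM {m..<n} ?N)"
        by (simp add: vimage_def Int_def conj_commute)
    qed
    have "a = {\<omega> \<in> space M. \<forall>j\<in>J1. W j \<omega> \<in> E1 j}"
      using J1 unfolding ab by (auto simp: prod_emb_iff subset_iff PiE_iff)
    also have "\<dots> = (\<lambda>\<omega>. \<lambda>i\<in>{..<m}. ?inc i \<omega>) -` ?H1 \<inter> space M"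
    proof -
      have "W j \<omega> = (\<Sum>i<k j. (\<lambda>i\<in>{..<m}. ?inc i \<omega>) i)" if "\<omega> \<in> space M" "j \<in> J1" for \<omega> j
      proof -
        have "W j \<omega> = W (t (k j)) \<omega>" using k(2)[of j] that(2) by (simp add: J_def)
        also have "\<dots> = (\<Sum>i<k j. ?inc i \<omega>)" using W t(1) that(1) by (rule wiener_telescope)
        also have "\<dots> = (\<Sum>i<k j. (\<lambda>i\<in>{..<m}. ?inc i \<omega>) i)"
          using k1[OF that(2)] by (intro sum.cong) auto
        finally show ?thesis .
      qed
      then show ?thesis using measurable_space[OF indep_var_rv1[OF i2]] by (auto simp del: restrict_apply)
    qed
    finally have a: "a = (\<lambda>\<omega>. \<lambda>i\<in>{..<m}. ?inc i \<omega>) -` ?H1 \<inter> space M" .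
    have "b = {\<omega> \<in> space M. \<forall>j\<in>J2. W (h + j) \<omega> - W h \<omega> \<in> E2 j}"
      using J2 unfolding ab by (auto simp: prod_emb_iff subset_iff PiE_iff sample_path_def time_shift_def)
    also have "\<dots> = (\<lambda>\<omega>. \<lambda>i\<in>{m..<n}. ?inc i \<omega>) -` ?H2 \<inter> space M"
    proof -
      have "W (h + j) \<omega> - W h \<omega> = (\<Sum>i\<in>{m..<k (h + j)}. (\<lambda>i\<in>{m..<n}. ?inc i \<omega>) i)" if "\<omega> \<in> space M" "j \<in> J2" for \<omega> j
      proof -
        have "W (h + j) \<omega> - W h \<omega> = W (t (k (h + j))) \<omega> - W (t m) \<omega>" using k2(3)[OF that(2)] m by simp
        also have "\<dots> = (\<Sum>i\<in>{m..<k (h + j)}. ?inc i \<omega>)"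
          by (rule sum_Suc_diff'[OF k2(1)[OF that(2)], symmetric])
        also have "\<dots> = (\<Sum>i\<in>{m..<k (h + j)}. (\<lambda>i\<in>{m..<n}. ?inc i \<omega>) i)"
          using k2[OF that(2)] by (intro sum.cong) auto
        finally show ?thesis .
      qed
      then show ?thesis using measurable_space[OF indep_var_rv2[OF i2]] by (auto simp del: restrict_apply)
    qed
    finally have b: "b = (\<lambda>\<omega>. \<lambda>i\<in>{m..<n}. ?inc i \<omega>) -` ?H2 \<inter> space M" .
    have "a \<inter> b = (\<lambda>\<omega>. (\<lambda>i\<in>{..<m}. ?inc i \<omega>, \<lambda>i\<in>{m..<n}. ?inc i \<omega>)) -` (?H1 \<times> ?H2) \<inter> space M"
      unfolding a b by blast
    then show "prob (a \<inter> b) = prob a * prob b"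
      using indep_varD[OF i2 H1 H2] by (simp only: a b)
  qed
  show ?thesis
    unfolding indep_var_eq gen[OF Xm] gen[OF Ym]
    using Xm Ym indep_set_sigma_sets[OF ind ist ist] by blast
qed

text \<open>Chebyshev's inequality with fourth moments in each coordinate at level
  \<open>u / N\<close>, then a union bound: hence the fifth power of the dimension. Second moments
  would not do, since over \<open>2 ^ n\<close> increments of variance \<open>h / 2 ^ n\<close>
  their bounds do not sum over the levels of a chaining argument.\<close>

lemma gauss_norm_tail:
  assumes s: "s > 0" and u: "u > 0"
  shows "emeasure (gauss s :: (real ^ 'n) measure) {z. norm z > u} \<le> ennreal (3 * real CARD('n) ^ 5 * s\<^sup>2 / u ^ 4)"
proof -
  define N where "N = real CARD('n)"
  have N: "N > 0" by (simp add: N_def)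
  define v where "v = u / N"
  have v: "v > 0" using u N by (simp add: v_def)
  have one: "emeasure (gauss s :: (real ^ 'n) measure) {z. \<bar>z $ i\<bar> > v} \<le> ennreal (3 * s\<^sup>2 / v ^ 4)" for i :: 'n
  proof -
    let ?nd = "density lborel (normal_density 0 (sqrt s))"
    have "emeasure (gauss s :: (real ^ 'n) measure) {z. \<bar>z $ i\<bar> > v} = emeasure (distr (gauss s :: (real ^ 'n) measure) borel (\<lambda>z. z $ i)) {x. \<bar>x\<bar> > v}"
      by (subst emeasure_distr) (auto simp: vimage_def)
    also have "\<dots> = (\<integral>\<^sup>+x. indicator {x. \<bar>x\<bar> > v} x \<partial>?nd)"
      unfolding gauss_coordinate[OF s] by simp
    also have "\<dots> = (\<integral>\<^sup>+x. ennreal (normal_density 0 (sqrt s) x) * indicator {x. \<bar>x\<bar> > v} x \<partial>lborel)"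
      by (subst nn_integral_density) auto
    also have "\<dots> \<le> (\<integral>\<^sup>+x. ennreal (normal_density 0 (sqrt s) x * x ^ 4 / v ^ 4) \<partial>lborel)"
    proof (intro nn_integral_mono)
      fix x :: real
      show "ennreal (normal_density 0 (sqrt s) x) * indicator {x. \<bar>x\<bar> > v} x \<le> ennreal (normal_density 0 (sqrt s) x * x ^ 4 / v ^ 4)"
      proof (cases "\<bar>x\<bar> > v")
        case True
        then have "v ^ 4 \<le> \<bar>x\<bar> ^ 4" using v by (intro power_mono) auto
        then have "1 \<le> x ^ 4 / v ^ 4" using v by (simp add: power_even_abs)
        then have "normal_density 0 (sqrt s) x * 1 \<le> normal_density 0 (sqrt s) x * (x ^ 4 / v ^ 4)"
          by (intro mult_left_mono) auto
        then show ?thesis using True by (simp add: ennreal_leI)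
      qed simp
    qed
    also have "\<dots> = ennreal (3 * s\<^sup>2 / v ^ 4)"
    proof (rule nn_integral_eq_integral[THEN trans])
      have "has_bochner_integral lborel (\<lambda>x. normal_density 0 (sqrt s) x * x ^ 4) (3 * s\<^sup>2)"
        using normal_moment_even[of "sqrt s" 0 2] s by (simp add: fact_numeral power_divide power2_eq_square)
      then have hb: "has_bochner_integral lborel (\<lambda>x. normal_density 0 (sqrt s) x * x ^ 4 / v ^ 4) (3 * s\<^sup>2 / v ^ 4)"
        by (intro has_bochner_integral_divide_zero)
      show "integrable lborel (\<lambda>x. normal_density 0 (sqrt s) x * x ^ 4 / v ^ 4)" using hb by (rule integrable.intros)
      show "ennreal (\<integral>x. normal_density 0 (sqrt s) x * x ^ 4 / v ^ 4 \<partial>lborel) = ennreal (3 * s\<^sup>2 / v ^ 4)"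
        by (simp only: has_bochner_integral_integral_eq[OF hb])
    qed auto
    finally show ?thesis .
  qed
  have "{z :: real ^ 'n. norm z > u} \<subseteq> (\<Union>i\<in>UNIV. {z. \<bar>z $ i\<bar> > v})"
  proof
    fix z :: "real ^ 'n" assume z: "z \<in> {z. norm z > u}"
    show "z \<in> (\<Union>i\<in>UNIV. {z. \<bar>z $ i\<bar> > v})"
    proof (rule ccontr)
      assume "\<not> ?thesis"
      then have "(\<Sum>i\<in>UNIV. \<bar>z $ i\<bar>) \<le> (\<Sum>i\<in>(UNIV::'n set). v)"
        by (intro sum_mono) (simp add: not_less)
      then have "norm z \<le> N * v" using norm_le_l1_cart[of z] by (simp add: N_def)
      then show False using z N by (simp add: v_def)
    qed
  qed
  then have "emeasure (gauss s :: (real ^ 'n) measure) {z. norm z > u} \<le> emeasure (gauss s) (\<Union>i\<in>UNIV. {z :: real ^ 'n. \<bar>z $ i\<bar> > v})"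
    by (intro emeasure_mono) auto
  also have "\<dots> \<le> (\<Sum>i\<in>UNIV. emeasure (gauss s) {z :: real ^ 'n. \<bar>z $ i\<bar> > v})"
    by (intro emeasure_subadditive_finite) auto
  also have "\<dots> \<le> (\<Sum>i\<in>(UNIV::'n set). ennreal (3 * s\<^sup>2 / v ^ 4))" by (intro sum_mono one)
  also have "\<dots> = ennreal (N * (3 * s\<^sup>2 / v ^ 4))"
    using v by (simp add: N_def ennreal_of_nat_eq_real_of_nat flip: ennreal_mult)
  also have "N * (3 * s\<^sup>2 / v ^ 4) = 3 * N ^ 5 * s\<^sup>2 / u ^ 4"
  proof -
    have "N ^ 5 = N * N ^ 4" by (simp flip: power_Suc)
    then show ?thesis using N u by (simp add: v_def power_divide)
  qed
  finally show ?thesis by (simp add: N_def)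
qed

text \<open>Every point of level \<open>n + 1\<close> is a point of level \<open>n\<close> or one
  increment of level \<open>n + 1\<close> away from one. The thresholds used up to level
  \<open>n\<close> sum to the stated partial geometric sum.\<close>

lemma dyadic_chaining:
  fixes w :: "real \<Rightarrow> 'a::real_normed_vector"
  assumes w0: "w 0 = 0"
    and inc: "\<And>n k. k < 2 ^ n \<Longrightarrow> norm (w (h / 2 ^ n * real (Suc k)) - w (h / 2 ^ n * real k)) \<le> a / 10 * (9/10) ^ n"
  shows "k \<le> 2 ^ n \<Longrightarrow> norm (w (h / 2 ^ n * real k)) \<le> a * (1 - (9/10) ^ Suc n)"
proof (induction n arbitrary: k)
  case 0
  have a: "a \<ge> 0" using order_trans[OF norm_ge_zero inc[of 0 0]] by simp
  from 0 have "k = 0 \<or> k = 1" by auto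
  then show ?case using inc[of 0 0] w0 a by auto
next
  case (Suc n)
  have a: "a \<ge> 0" using order_trans[OF norm_ge_zero inc[of 0 0]] by simp
  define j where "j = k div 2"
  have half: "h / 2 ^ Suc n * real (2 * j) = h / 2 ^ n * real j" by simp
  have j: "j \<le> 2 ^ n" using Suc.prems by (simp add: j_def)
  have IH: "norm (w (h / 2 ^ Suc n * real (2 * j))) \<le> a * (1 - (9/10) ^ Suc n)"
    unfolding half using j by (rule Suc.IH)
  have step: "a * (1 - (9/10) ^ Suc n) + a / 10 * (9/10) ^ Suc n = a * (1 - (9/10) ^ Suc (Suc n))"
    by (simp add: algebra_simps)
  show ?case
  proof (cases "even k")
    case True
    then have k: "k = 2 * j" by (simp add: j_def)
    have "a / 10 * (9/10) ^ Suc n \<ge> 0" using a by simp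
    then show ?thesis unfolding k using IH step by linarith
  next
    case False
    then have k: "k = Suc (2 * j)" by (simp add: j_def)
    have "norm (w (h / 2 ^ Suc n * real k)) \<le> norm (w (h / 2 ^ Suc n * real (2 * j))) + norm (w (h / 2 ^ Suc n * real k) - w (h / 2 ^ Suc n * real (2 * j)))"
      by (rule norm_triangle_sub)
    also have "norm (w (h / 2 ^ Suc n * real k) - w (h / 2 ^ Suc n * real (2 * j))) \<le> a / 10 * (9/10) ^ Suc n"
      unfolding k using k Suc.prems by (intro inc) auto
    finally show ?thesis using IH step by linarith
  qed
qed

text \<open>Chaining with thresholds \<open>a / 10 * (9 / 10) ^ n\<close>, which sum to \<open>a\<close>; the constant is
  \<open>3 * 10 ^ 4\<close> times the sum of the geometric series with ratio \<open>10000 / 13122\<close>, rounded up.\<close>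

lemma wiener_sup_bound:
  fixes W :: "real \<Rightarrow> 'w \<Rightarrow> real ^ 'n"
  assumes W: "wiener M W" and h: "h > 0" and a: "a > 0"
  shows "emeasure M {\<omega> \<in> space M. \<not> (\<forall>n k. k \<le> 2 ^ n \<longrightarrow> norm (W (h / 2 ^ n * real k) \<omega>) \<le> a)}
     \<le> ennreal (126093 * real CARD('n) ^ 5 * h\<^sup>2 / a ^ 4)"
proof -
  interpret prob_space M using W by (rule wiener_prob_space)
  define N where "N = real CARD('n)"
  let ?an = "\<lambda>n. a / 10 * (9/10) ^ n"
  let ?B = "\<lambda>n k. {\<omega> \<in> space M. norm (W (h / 2 ^ n * real (Suc k)) \<omega> - W (h / 2 ^ n * real k) \<omega>) > ?an n}"
  have Wd: "(\<lambda>\<omega>. W (h / 2 ^ n * real (Suc k)) \<omega> - W (h / 2 ^ n * real k) \<omega>) \<in> borel_measurable M" for n k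
    using h by (intro borel_measurable_diff wiener_measurable[OF W]) auto
  have Bm: "?B n k \<in> sets M" for n k
    using measurable_compose[OF Wd[of n k] borel_measurable_norm] unfolding borel_measurable_iff_greater by blast
  have Bk: "emeasure M (?B n k) \<le> ennreal (3 * N ^ 5 * (h / 2 ^ n)\<^sup>2 / ?an n ^ 4)" for n k
  proof -
    let ?s = "h / 2 ^ n * real k" and ?t = "h / 2 ^ n * real (Suc k)"
    have st: "0 \<le> ?s" "?s < ?t" "?t - ?s = h / 2 ^ n" using h by (auto simp: field_simps)
    have m: "(\<lambda>\<omega>. W ?t \<omega> - W ?s \<omega>) \<in> borel_measurable M" by (rule Wd)
    have "emeasure M (?B n k) = emeasure (distr M borel (\<lambda>\<omega>. W ?t \<omega> - W ?s \<omega>)) {z. norm z > ?an n}"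
      using m by (subst emeasure_distr) (auto intro!: arg_cong[where f = "emeasure M"])
    also have "\<dots> = emeasure (gauss (h / 2 ^ n) :: (real ^ 'n) measure) {z. norm z > ?an n}"
      using wiener_increment[OF W st(1,2)] st(3) by simp
    also have "\<dots> \<le> ennreal (3 * N ^ 5 * (h / 2 ^ n)\<^sup>2 / ?an n ^ 4)"
      unfolding N_def using h a by (intro gauss_norm_tail) auto
    finally show ?thesis .
  qed
  \<comment> \<open>Passing to the next level doubles the number of increments and divides the
    squared variance by 4, while the threshold shrinks by 9/10: the ratio is 1/2 times
    (10/9)^4.\<close>
  let ?q = "10000 / 13122 :: real"
  let ?c = "30000 * N ^ 5 * h\<^sup>2 / a ^ 4"
  have Bn: "emeasure M (\<Union>k<2^n. ?B n k) \<le> ennreal (?c * ?q ^ n)" for n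
  proof -
    have "emeasure M (\<Union>k<2^n. ?B n k) \<le> (\<Sum>k<2^n. emeasure M (?B n k))"
      using Bm by (intro emeasure_subadditive_finite) auto
    also have "\<dots> \<le> (\<Sum>k<(2::nat)^n. ennreal (3 * N ^ 5 * (h / 2 ^ n)\<^sup>2 / ?an n ^ 4))"
      by (intro sum_mono Bk)
    also have "\<dots> = ennreal (2 ^ n * (3 * N ^ 5 * (h / 2 ^ n)\<^sup>2 / ?an n ^ 4))"
      using a by (subst sum_ennreal) (auto simp: N_def)
    also have "2 ^ n * (3 * N ^ 5 * (h / 2 ^ n)\<^sup>2 / ?an n ^ 4) = ?c * ?q ^ n"
    proof -
      define p r where "p = (2::real) ^ n" and "r = (6561/10000::real) ^ n"
      have pr: "p > 0" "r > 0" by (auto simp: p_def r_def)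
      have "((9/10::real) ^ n) ^ 4 = ((9/10) ^ 4) ^ n" by (simp only: power_mult[symmetric] mult.commute)
      also have "(9/10::real) ^ 4 = 6561/10000" by (simp add: power_divide)
      finally have 2: "((9/10::real) ^ n) ^ 4 = r" by (simp only: r_def)
      have "(a / 10 * x) ^ 4 = a ^ 4 / 10000 * x ^ 4" for x :: real
        by (simp add: power_mult_distrib power_divide)
      from this[of "(9/10) ^ n"] have 1: "(a / 10 * (9/10) ^ n) ^ 4 = a ^ 4 / 10000 * r" by (simp only: 2)
      have "p * r = (13122/10000) ^ n" by (simp add: p_def r_def power_mult_distrib[symmetric])
      then have "?q ^ n = 1 / (p * r)" by (simp add: power_divide)
      then show ?thesis
        unfolding 1 p_def[symmetric] using pr a by (simp add: field_simps power2_eq_square)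
    qed
    finally show ?thesis .
  qed
  have "{\<omega> \<in> space M. \<not> (\<forall>n k. k \<le> 2 ^ n \<longrightarrow> norm (W (h / 2 ^ n * real k) \<omega>) \<le> a)} \<subseteq> (\<Union>n. \<Union>k<2^n. ?B n k)"
  proof
    fix \<omega> assume w: "\<omega> \<in> {\<omega> \<in> space M. \<not> (\<forall>n k. k \<le> 2 ^ n \<longrightarrow> norm (W (h / 2 ^ n * real k) \<omega>) \<le> a)}"
    show "\<omega> \<in> (\<Union>n. \<Union>k<2^n. ?B n k)"
    proof (rule ccontr)
      assume "\<not> ?thesis"
      then have inc: "\<And>n k. k < 2 ^ n \<Longrightarrow> norm (W (h / 2 ^ n * real (Suc k)) \<omega> - W (h / 2 ^ n * real k) \<omega>) \<le> ?an n"
        using w by (auto simp: not_less simp del: of_nat_Suc)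
      have "W 0 \<omega> = 0" using w wiener_0[OF W] by blast
      from dyadic_chaining[of "\<lambda>t. W t \<omega>", OF this inc]
      have "norm (W (h / 2 ^ n * real k) \<omega>) \<le> a * (1 - (9/10) ^ Suc n)" if "k \<le> 2 ^ n" for n k
        using that by blast
      moreover have "a * (1 - (9/10) ^ Suc n) \<le> a" for n using a by (simp add: algebra_simps)
      ultimately show False using w by (auto intro: order_trans)
    qed
  qed
  then have "emeasure M {\<omega> \<in> space M. \<not> (\<forall>n k. k \<le> 2 ^ n \<longrightarrow> norm (W (h / 2 ^ n * real k) \<omega>) \<le> a)} \<le> emeasure M (\<Union>n. \<Union>k<2^n. ?B n k)"
    using Bm by (intro emeasure_mono) auto
  also have "\<dots> \<le> (\<Sum>n. emeasure M (\<Union>k<2^n. ?B n k))"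
    using Bm by (intro emeasure_subadditive_countably) auto
  also have "\<dots> \<le> (\<Sum>n. ennreal (?c * ?q ^ n))"
    by (intro suminf_le Bn) auto
  also have "\<dots> = ennreal (\<Sum>n. ?c * ?q ^ n)"
    using a by (intro suminf_ennreal2 summable_mult summable_geometric) (auto simp: N_def)
  also have "(\<Sum>n. ?c * ?q ^ n) = ?c * (1 / (1 - ?q))"
    by (subst suminf_mult, intro summable_geometric, simp, subst suminf_geometric) simp_all
  also have "ennreal (?c * (1 / (1 - ?q))) \<le> ennreal (126093 * N ^ 5 * h\<^sup>2 / a ^ 4)"
  proof (rule ennreal_leI)
    have "N ^ 5 * h\<^sup>2 / a ^ 4 \<ge> 0" using a by (simp add: N_def)
    from mult_right_mono[OF _ this, of "30000 * (1 / (1 - ?q))" 126093]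
    show "?c * (1 / (1 - ?q)) \<le> 126093 * N ^ 5 * h\<^sup>2 / a ^ 4" by (simp add: field_simps)
  qed
  finally show ?thesis by (simp add: N_def)
qed

lemma wiener_inner_moments:
  fixes W :: "real \<Rightarrow> 'w \<Rightarrow> real ^ 'n"
  assumes W: "wiener M W" and h: "h > 0" and e: "norm e = 1"
  shows "has_bochner_integral M (\<lambda>\<omega>. e \<bullet> W h \<omega>) 0"
    and "has_bochner_integral M (\<lambda>\<omega>. (e \<bullet> W h \<omega>)\<^sup>2) h"
    and "has_bochner_integral M (\<lambda>\<omega>. (e \<bullet> W h \<omega>) ^ 4) (3 * h\<^sup>2)"
proof -
  have [measurable]: "W h \<in> borel_measurable M" using wiener_measurable[OF W, of h] h by simp
  have "distr M borel (\<lambda>\<omega>. e \<bullet> W h \<omega>) = distr (distr M borel (W h)) borel (\<lambda>z. e \<bullet> z)"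
    by (subst distr_distr) (auto simp: o_def)
  then have law: "distr M borel (\<lambda>\<omega>. e \<bullet> W h \<omega>) = density lborel (normal_density 0 (sqrt h))"
    using wiener_marginal[OF W h] gauss_inner[OF h e] by simp
  have tr: "has_bochner_integral M (\<lambda>\<omega>. g (e \<bullet> W h \<omega>)) I"
    if hb: "has_bochner_integral lborel (\<lambda>x. normal_density 0 (sqrt h) x * g x) I" and [measurable]: "g \<in> borel_measurable borel" for g and I :: real
  proof -
    have "has_bochner_integral (density lborel (normal_density 0 (sqrt h))) g I"
      by (rule has_bochner_integral_density) (use hb in auto)
    then have "has_bochner_integral (distr M borel (\<lambda>\<omega>. e \<bullet> W h \<omega>)) g I" by (simp only: law)
    then show ?thesis by (auto simp: has_bochner_integral_iff integrable_distr_eq integral_distr)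
  qed
  have sh: "0 < sqrt h" using h by simp
  show "has_bochner_integral M (\<lambda>\<omega>. e \<bullet> W h \<omega>) 0"
    using tr[of "\<lambda>x. x" 0] normal_moment_odd[OF sh, of 0 0] by simp
  show "has_bochner_integral M (\<lambda>\<omega>. (e \<bullet> W h \<omega>)\<^sup>2) h"
    using tr[of "\<lambda>x. x\<^sup>2" h] normal_moment_even[OF sh, of 0 1] h by simp
  show "has_bochner_integral M (\<lambda>\<omega>. (e \<bullet> W h \<omega>) ^ 4) (3 * h\<^sup>2)"
    using tr[of "\<lambda>x. x ^ 4" "3 * h\<^sup>2"] normal_moment_even[OF sh, of 0 2] h
    by (simp add: fact_numeral power_divide power2_eq_square)
qed

section \<open>The flow as a functional of the Brownian path\<close>

context locally_Lipschitz_drift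
begin

lemma b_measurable [measurable]: "b \<in> borel_measurable borel"
  using b_continuous by (rule borel_measurable_continuous_onI)

lemma sigma_measurable [measurable]: "(*v) \<sigma> \<in> borel_measurable borel"
  by (intro borel_measurable_continuous_onI linear_continuous_on matrix_vector_mul_bounded_linear)

lemma euler_measurable:
  assumes "\<And>j. j \<le> k \<Longrightarrow> \<eta> * real j \<in> I"
  shows "(\<lambda>(z, w). euler b \<sigma> \<eta> z w k) \<in> borel_measurable (borel \<Otimes>\<^sub>M PiM I (\<lambda>_. borel))"
  using assms
proof (induction k)
  case 0
  show ?case by simp
next
  case (Suc k)
  let ?N = "borel \<Otimes>\<^sub>M PiM I (\<lambda>_. borel) :: ((real ^ 'n) \<times> (real \<Rightarrow> real ^ 'n)) measure"
  have IH: "(\<lambda>q. euler b \<sigma> \<eta> (fst q) (snd q) k) \<in> borel_measurable ?N"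
    using Suc by (simp add: case_prod_beta)
  have c: "(\<lambda>q. snd q (\<eta> * real j)) \<in> borel_measurable ?N" if "j \<le> Suc k" for j
    by (rule measurable_compose[OF measurable_snd measurable_component_singleton[OF Suc.prems[OF that]]])
  have d: "(\<lambda>q. snd q (\<eta> * real (Suc k)) - snd q (\<eta> * real k)) \<in> borel_measurable ?N"
    by (rule borel_measurable_diff[OF c c]) auto
  show ?case
    unfolding case_prod_beta euler.simps
    by (intro borel_measurable_add IH borel_measurable_scaleR borel_measurable_const
        measurable_compose[OF IH b_measurable] measurable_compose[OF d sigma_measurable])
qed

lemma dyadic_euler_measurable:
  assumes "0 \<le> T" "{0..T} \<subseteq> I"
  shows "(\<lambda>(z, w). dyadic_euler b \<sigma> T z w n) \<in> borel_measurable (borel \<Otimes>\<^sub>M PiM I (\<lambda>_. borel))"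
  unfolding dyadic_euler_def
  using dyadic_le[OF assms(1)] assms(2) by (intro euler_measurable) blast

lemma flow_measurable:
  assumes "0 \<le> T" "{0..T} \<subseteq> I"
  shows "(\<lambda>(z, w). flow b \<sigma> T z w) \<in> borel_measurable (borel \<Otimes>\<^sub>M PiM I (\<lambda>_. borel))"
  unfolding flow_def[abs_def] case_prod_beta
  using dyadic_euler_measurable[OF assms] unfolding case_prod_beta by (rule borel_measurable_lim_metric)

lemma flow_measurable1:
  assumes "0 \<le> T" "{0..T} \<subseteq> I"
  shows "flow b \<sigma> T z \<in> borel_measurable (PiM I (\<lambda>_. borel))"
  using measurable_compose[OF measurable_Pair1'[of z borel "PiM I (\<lambda>_. borel)"] flow_measurable[OF assms]] by simp

lemma dyadic_euler_convergent_sets: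
  assumes "0 \<le> T"
  shows "{w \<in> space path_space. convergent (dyadic_euler b \<sigma> T z w)} \<in> sets path_space"
proof -
  have "dyadic_euler b \<sigma> T z w = (\<lambda>n. dyadic_euler b \<sigma> T z w n)" for w by simp
  moreover have "(\<lambda>w. dyadic_euler b \<sigma> T z w n) \<in> borel_measurable path_space" for n
    using measurable_compose[OF measurable_Pair1'[of z borel path_space] dyadic_euler_measurable[OF assms, of "{0..}" n]] by simp
  from sets_Collect_Cauchy[OF this] show ?thesis by (simp add: Cauchy_convergent_iff)
qed

end

text \<open>Smallness is tested at dyadic points only: these are countably many coordinates, hence a
  measurable event, and the Euler schemes see no others. Only norms occur, so the event is invariant
  under rotations.\<close>

definition good :: "real \<Rightarrow> real \<Rightarrow> (real \<Rightarrow> real ^ 'n) \<Rightarrow> bool" where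
  "good h a w \<longleftrightarrow> (\<forall>n k. k \<le> 2 ^ n \<longrightarrow> norm (w (h / 2 ^ n * real k)) \<le> a)"

definition refl_along :: "'a::real_inner \<Rightarrow> 'a \<Rightarrow> 'a" where
  "refl_along e v = v - (2 * (e \<bullet> v)) *\<^sub>R e"

text \<open>The reflected path drives the second component. Reverting to the original path on the
  rotation invariant complement of the good event preserves the law.\<close>

definition refl_path :: "real \<Rightarrow> real \<Rightarrow> real ^ 'n \<Rightarrow> (real \<Rightarrow> real ^ 'n) \<Rightarrow> real \<Rightarrow> real ^ 'n" where
  "refl_path h a e w = (\<lambda>t\<in>{0..}. if good h a w then refl_along e (w t) else w t)"

lemma refl_along_0 [simp]: "refl_along 0 v = v"
  by (simp add: refl_along_def)

lemma orthogonal_refl_along: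
  assumes "norm e = 1 \<or> e = 0" shows "orthogonal_transformation (refl_along e)"
proof -
  have ip: "refl_along e v \<bullet> refl_along e w = v \<bullet> w + 4 * (e \<bullet> v) * (e \<bullet> w) * (e \<bullet> e - 1)" for v w
    by (simp add: refl_along_def inner_diff_left inner_diff_right inner_commute[of v e] right_diff_distrib)
  have "refl_along e v \<bullet> refl_along e w = v \<bullet> w" for v w
  proof (cases "e = 0")
    case False
    then have "e \<bullet> e = 1" using assms by (simp add: dot_square_norm)
    then show ?thesis by (simp add: ip)
  qed simp
  moreover have "linear (refl_along e)"
    by (rule linearI) (auto simp: refl_along_def inner_add_right algebra_simps)
  ultimately show ?thesis by (simp add: orthogonal_transformation_def)
qed

lemma path_space_undefined: "w \<in> space path_space \<Longrightarrow> t \<notin> {0..} \<Longrightarrow> w t = undefined"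
  unfolding space_PiM by (rule PiE_arb)

lemma refl_path_0: assumes "w \<in> space path_space" shows "refl_path h a 0 w = w"
proof
  fix t show "refl_path h a 0 w t = w t"
    using path_space_undefined[OF assms, of t] by (cases "t \<in> {0..}") (simp_all add: refl_path_def)
qed

lemma good_sets:
  assumes h: "h \<ge> 0"
  shows "{w \<in> space path_space. good h a (w :: real \<Rightarrow> real ^ 'n)} \<in> sets path_space"
proof -
  have m: "{w \<in> space path_space. norm (w (h / 2 ^ n * real k) :: real ^ 'n) \<le> a} \<in> sets path_space" for n k
  proof -
    have "h / 2 ^ n * real k \<in> {0..}" using h by simp
    then have "(\<lambda>w. w (h / 2 ^ n * real k)) \<in> measurable path_space (borel :: (real ^ 'n) measure)"
      by (rule measurable_component_singleton)
    from measurable_compose[OF this borel_measurable_norm]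
    show ?thesis unfolding borel_measurable_iff_le by blast
  qed
  have "{w \<in> space path_space. \<forall>n k. k \<le> 2 ^ n \<longrightarrow> norm (w (h / 2 ^ n * real k) :: real ^ 'n) \<le> a} \<in> sets path_space"
  proof (rule sets.sets_Collect_countable_All, rule sets.sets_Collect_countable_All)
    fix n k :: nat
    show "{w \<in> space path_space. k \<le> 2 ^ n \<longrightarrow> norm (w (h / 2 ^ n * real k) :: real ^ 'n) \<le> a} \<in> sets path_space"
      using m[of n k] by (cases "k \<le> 2 ^ n") simp_all
  qed
  then show ?thesis unfolding good_def .
qed

lemma refl_path_measurable:
  assumes h: "h \<ge> 0"
  shows "(\<lambda>(e, w). refl_path h a e w) \<in> measurable (borel \<Otimes>\<^sub>M path_space) (path_space :: (real \<Rightarrow> real ^ 'n) measure)"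
  unfolding refl_path_def case_prod_beta
proof (rule measurable_restrict)
  let ?N = "borel \<Otimes>\<^sub>M path_space :: ((real ^ 'n) \<times> (real \<Rightarrow> real ^ 'n)) measure"
  fix t :: real assume t: "t \<in> {0..}"
  have wt: "(\<lambda>w. w t) \<in> measurable path_space (borel :: (real ^ 'n) measure)"
    using t by (rule measurable_component_singleton)
  have w: "(\<lambda>q. snd q t) \<in> borel_measurable ?N"
    by (rule measurable_compose[OF measurable_snd wt])
  have "{q \<in> space ?N. good h a (snd q)} = snd -` {w \<in> space path_space. good h a w} \<inter> space ?N"
    by (auto simp: space_pair_measure)
  then have "{q \<in> space ?N. good h a (snd q)} \<in> sets ?N"
    using measurable_sets[OF measurable_snd good_sets[OF h, of a]] by simp
  moreover have "(\<lambda>q. refl_along (fst q) (snd q t)) \<in> borel_measurable ?N"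
    unfolding refl_along_def
    by (rule borel_measurable_diff[OF w borel_measurable_scaleR[OF borel_measurable_times[OF borel_measurable_const
          borel_measurable_inner[OF measurable_fst w]] measurable_fst]])
  ultimately show "(\<lambda>q. if good h a (snd q) then refl_along (fst q) (snd q t) else snd q t) \<in> borel_measurable ?N"
    using w by (rule measurable_If[rotated 2])
qed

lemma refl_path_measurable1:
  assumes h: "h \<ge> 0" shows "refl_path h a e \<in> measurable path_space path_space"
  using measurable_compose[OF measurable_Pair1'[of e borel path_space] refl_path_measurable[OF h, of a]] by simp

text \<open>The full reflection \<open>R\<close> preserves the law and leaves membership in the good
  event unchanged. Splitting a preimage along this event gives one part transported by
  \<open>R\<close> and one part left in place, and the two masses add up again.\<close>

lemma refl_path_law:
  fixes W :: "real \<Rightarrow> 'w \<Rightarrow> real ^ 'n" and e :: "real ^ 'n"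
  assumes W: "wiener M W" and e: "norm e = 1 \<or> e = 0" and h: "h \<ge> 0"
  defines "P \<equiv> distr M path_space (sample_path W)"
  shows "distr P path_space (refl_path h a e) = P"
proof -
  interpret prob_space M using W by (rule wiener_prob_space)
  note orth = orthogonal_refl_along[OF e]
  have nr: "norm (refl_along e v) = norm v" for v using orth by (simp add: orthogonal_transformation)
  define R :: "(real \<Rightarrow> real ^ 'n) \<Rightarrow> real \<Rightarrow> real ^ 'n" where "R = (\<lambda>w. \<lambda>t\<in>{0..}. refl_along e (w t))"
  have lin: "linear (refl_along e)" using orth by (simp add: orthogonal_transformation_def)
  have rm: "refl_along e \<in> borel_measurable borel"
    by (intro borel_measurable_continuous_onI linear_continuous_on linear_conv_bounded_linear[THEN iffD1] lin)
  have Rm: "R \<in> measurable path_space path_space"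
    unfolding R_def
  proof (rule measurable_restrict)
    fix t :: real assume "t \<in> {0..}"
    then have "(\<lambda>w. w t) \<in> measurable path_space (borel :: (real ^ 'n) measure)"
      by (rule measurable_component_singleton)
    from measurable_compose[OF this rm] show "(\<lambda>w. refl_along e (w t)) \<in> borel_measurable path_space" .
  qed
  have sP [simp]: "sets P = sets path_space" "space P = space path_space" by (simp_all add: P_def)
  have mP: "measurable P path_space = measurable path_space path_space"
    by (rule measurable_cong_sets) simp_all
  have RP: "distr P path_space R = P"
  proof -
    have "distr P path_space R = distr M path_space (R \<circ> sample_path W)"
      unfolding P_def by (rule distr_distr[OF Rm path_measurable[OF W]])
    also have "R \<circ> sample_path W = sample_path (\<lambda>t \<omega>. refl_along e (W t \<omega>))"
      by (auto simp: R_def sample_path_def fun_eq_iff)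
    also have "distr M path_space (sample_path (\<lambda>t \<omega>. refl_along e (W t \<omega>))) = P"
      unfolding P_def by (rule wiener_law_unique[OF wiener_orthogonal[OF W orth] W])
    finally show ?thesis .
  qed
  let ?G = "{w \<in> space path_space. good h a w}"
  have G: "?G \<in> sets path_space" by (rule good_sets[OF h])
  have gR: "good h a (R w) \<longleftrightarrow> good h a w" for w
    using h by (auto simp: good_def R_def nr)
  show ?thesis
  proof (rule measure_eqI)
    fix A assume "A \<in> sets (distr P path_space (refl_path h a e))"
    then have A: "A \<in> sets path_space" by simp
    have Rsp: "w \<in> space path_space \<Longrightarrow> R w \<in> space path_space" for w using measurable_space[OF Rm] .
    have id: "refl_path h a e w = w" if "\<not> good h a w" "w \<in> space path_space" for w
    proof
      fix t show "refl_path h a e w t = w t"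
        using that path_space_undefined[of w t] by (cases "t \<in> {0..}") (simp_all add: refl_path_def)
    qed
    have gd: "refl_path h a e w = R w" if "good h a w" for w
      using that by (simp add: refl_path_def R_def)
    have "refl_path h a e -` A \<inter> space path_space = (R -` (A \<inter> ?G) \<inter> space path_space) \<union> (A - ?G)"
    proof (intro equalityI subsetI)
      fix w assume "w \<in> refl_path h a e -` A \<inter> space path_space"
      then show "w \<in> (R -` (A \<inter> ?G) \<inter> space path_space) \<union> (A - ?G)"
        using id[of w] gd[of w] gR[of w] Rsp[of w] by (cases "good h a w") auto
    next
      fix w assume w: "w \<in> (R -` (A \<inter> ?G) \<inter> space path_space) \<union> (A - ?G)"
      then have "w \<in> space path_space" using sets.sets_into_space[OF A] by auto
      then show "w \<in> refl_path h a e -` A \<inter> space path_space"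
        using w id[of w] gd[of w] gR[of w] by (cases "good h a w") auto
    qed
    then have "emeasure (distr P path_space (refl_path h a e)) A = emeasure P ((R -` (A \<inter> ?G) \<inter> space path_space) \<union> (A - ?G))"
      using emeasure_distr[of "refl_path h a e" P path_space A] refl_path_measurable1[OF h, of a e] A by (simp only: mP sP)
    also have "\<dots> = emeasure P (R -` (A \<inter> ?G) \<inter> space path_space) + emeasure P (A - ?G)"
    proof (rule plus_emeasure[symmetric])
      show "R -` (A \<inter> ?G) \<inter> space path_space \<in> sets P"
        using measurable_sets[OF Rm sets.Int[OF A G]] by (simp only: sP)
      show "A - ?G \<in> sets P" using sets.Diff[OF A G] by (simp only: sP)
      show "(R -` (A \<inter> ?G) \<inter> space path_space) \<inter> (A - ?G) = {}" using gR by blast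
    qed
    also have "emeasure P (R -` (A \<inter> ?G) \<inter> space path_space) = emeasure (distr P path_space R) (A \<inter> ?G)"
      using emeasure_distr[of R P path_space "A \<inter> ?G"] sets.Int[OF A G] Rm by (simp only: mP sP)
    also have "\<dots> + emeasure P (A - ?G) = emeasure P ((A \<inter> ?G) \<union> (A - ?G))"
      unfolding RP by (rule plus_emeasure) (use A G sets.Int[OF A G] sets.Diff[OF A G] in \<open>simp_all only: sP, blast\<close>)
    also have "(A \<inter> ?G) \<union> (A - ?G) = A" by blast
    finally show "emeasure (distr P path_space (refl_path h a e)) A = emeasure P A" .
  qed simp
qed

section \<open>The flow driven by the given Brownian motion, and its Markov property\<close>

locale diffusion = pos_def_matrix G + locally_Lipschitz_drift b \<sigma> + kappa_function "kappa \<sigma> G b"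
  for G \<sigma> :: "real ^ 'n ^ 'n" and b :: "real ^ 'n \<Rightarrow> real ^ 'n" +
  fixes M :: "'w measure" and B :: "real \<Rightarrow> 'w \<Rightarrow> real ^ 'n" and X :: "real ^ 'n \<Rightarrow> real \<Rightarrow> 'w \<Rightarrow> real ^ 'n"
  assumes det_pos: "det \<sigma> > 0"
    and brownian: "brownian_motion M B"
    and solution: "\<And>x. strong_solution M B b \<sigma> x (X x)"
    and kappa_bdd: "\<And>r. r > 0 \<Longrightarrow> bdd_below (kappa_set \<sigma> G b r)"
begin

definition "W t \<omega> = B t \<omega> - B 0 \<omega>"
definition "P = distr M path_space (sample_path W)"
abbreviation "F \<equiv> flow b \<sigma>"
abbreviation "p \<equiv> transition_kernel M X"

lemma wiener_W: "wiener M W"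
  using brownian_motion_wiener[OF brownian] by (simp add: W_def[abs_def])

sublocale M: prob_space M using wiener_W by (rule wiener_prob_space)

lemma W_0: "W 0 \<omega> = 0" by (simp add: W_def)

lemma path_W_measurable [measurable]: "sample_path W \<in> measurable M path_space"
  by (rule path_measurable[OF wiener_W])

sublocale P: prob_space P
  unfolding P_def by (rule M.prob_space_distr[OF path_W_measurable])

lemma sets_P [measurable_cong, simp]: "sets P = sets path_space" by (simp add: P_def)
lemma space_P [simp]: "space P = space path_space" by (simp add: P_def)

text \<open>A single null set serves all times \<open>T\<close>, as needed for the flow property and
  for the boundedness of trajectories. Off this set \<open>B 0 = 0\<close>, so \<open>B\<close> may
  be replaced by \<open>W\<close>.\<close>

lemma X_ode: "AE \<omega> in M. \<forall>T\<ge>0. ode_solution b \<sigma> T x (\<lambda>t. W t \<omega>) (\<lambda>t. X x t \<omega>)"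
proof -
  have "AE \<omega> in M. B 0 \<omega> = 0" using brownian by (simp add: brownian_motion_def)
  moreover have "AE \<omega> in M. continuous_on {0..} (\<lambda>t. X x t \<omega>)"
    "AE \<omega> in M. \<forall>t\<ge>0. X x t \<omega> = x + (LBINT s:{0..t}. b (X x s \<omega>)) + \<sigma> *v B t \<omega>"
    using solution[of x] by (auto simp: strong_solution_def)
  ultimately show ?thesis
  proof eventually_elim
    case (elim \<omega>)
    show ?case
    proof (intro allI impI)
      fix T :: real assume T: "0 \<le> T"
      have "(LBINT s:{0..t}. b (X x s \<omega>)) = integral {0..t} (\<lambda>s. b (X x s \<omega>))" if "t \<ge> 0" for t
      proof -
        have "continuous_on {0..t} (\<lambda>s. b (X x s \<omega>))"
          by (rule continuous_on_compose2[OF b_continuous continuous_on_subset[OF elim(2)]]) auto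
        then have "set_integrable lborel {0..t} (\<lambda>s. b (X x s \<omega>))" by (rule borel_integrable_atLeastAtMost')
        then show ?thesis by (rule set_borel_integral_eq_integral(2))
      qed
      then show "ode_solution b \<sigma> T x (\<lambda>t. W t \<omega>) (\<lambda>t. X x t \<omega>)"
        unfolding ode_solution_def using elim continuous_on_subset[OF elim(2), of "{0..T}"] by (simp add: W_def)
    qed
  qed
qed

lemma F_path_eq: "T \<ge> 0 \<Longrightarrow> F T z (sample_path W \<omega>) = F T z (\<lambda>t. W t \<omega>)"
  by (rule flow_cong) (auto simp: sample_path_def)

lemma F_eq_X: "AE \<omega> in M. \<forall>T\<ge>0. F T x (sample_path W \<omega>) = X x T \<omega>"
  using X_ode[of x]
proof eventually_elim
  case (elim \<omega>)
  then show ?case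
    using flow_eq_solution[of _ x "\<lambda>t. W t \<omega>" "\<lambda>t. X x t \<omega>"] by (simp add: F_path_eq W_0)
qed

lemma F_measurable: "T \<ge> 0 \<Longrightarrow> (\<lambda>(z, w). F T z w) \<in> borel_measurable (borel \<Otimes>\<^sub>M path_space)"
  by (rule flow_measurable) auto

lemma F_measurable1: "T \<ge> 0 \<Longrightarrow> F T z \<in> borel_measurable path_space"
  by (rule flow_measurable1) auto

lemma euler_convergent:
  assumes T: "T \<ge> 0" shows "AE w in P. convergent (dyadic_euler b \<sigma> T x w)"
  unfolding P_def
proof (subst AE_distr_iff[OF path_W_measurable])
  show "{w \<in> space path_space. convergent (dyadic_euler b \<sigma> T x w)} \<in> sets path_space"
    by (rule dyadic_euler_convergent_sets[OF T])
  show "AE \<omega> in M. convergent (dyadic_euler b \<sigma> T x (sample_path W \<omega>))"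
    using X_ode[of x]
  proof eventually_elim
    case (elim \<omega>)
    have "dyadic_euler b \<sigma> T x (sample_path W \<omega>) = dyadic_euler b \<sigma> T x (\<lambda>t. W t \<omega>)"
      by (rule dyadic_euler_cong[OF T]) (simp add: sample_path_def)
    then show ?case using dyadic_euler_tendsto[of T x "\<lambda>t. W t \<omega>" "\<lambda>t. X x t \<omega>"] elim T by (auto simp: W_0 convergent_def)
  qed
qed

lemma X_measurable: assumes "t \<ge> 0" shows "X x t \<in> borel_measurable M"
proof -
  have Xf: "X x t \<in> borel_measurable (brownian_filtration M B t)"
    using solution[of x] assms by (simp add: strong_solution_def)
  let ?S = "{B s -` A \<inter> space M | s A. 0 \<le> s \<and> s \<le> t \<and> A \<in> sets borel} \<union> null_sets M"
  have Bm: "B s \<in> borel_measurable M" if "s \<ge> 0" for s using brownian that by (simp add: brownian_motion_def)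
  have S: "?S \<subseteq> sets M" using measurable_sets[OF Bm] by auto
  have "?S \<subseteq> Pow (space M)" using S sets.space_closed by blast
  then have sp: "space (brownian_filtration M B t) = space M" "sets (brownian_filtration M B t) = sigma_sets (space M) ?S"
    by (simp_all add: brownian_filtration_def space_measure_of_conv sets_measure_of)
  have "sets (brownian_filtration M B t) \<subseteq> sets M"
    unfolding sp using sets.sigma_sets_subset[OF S] .
  then show ?thesis using Xf sp(1) by (auto simp: measurable_def)
qed

text \<open>The solutions \<open>X x\<close> are given one starting point at a time. The flow is a
  version that is jointly measurable in starting point and path, which makes the transition kernel
  measurable in \<open>x\<close>.\<close>

lemma p_eq: assumes T: "T \<ge> 0" shows "p T x = distr P borel (F T x)"
proof -
  have "p T x = distr M borel (F T x \<circ> sample_path W)"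
    unfolding transition_kernel_def
  proof (rule distr_cong_AE)
    show "AE \<omega> in M. X x T \<omega> = (F T x \<circ> sample_path W) \<omega>"
      using F_eq_X[of x] by eventually_elim (use T in simp)
    show "F T x \<circ> sample_path W \<in> borel_measurable M"
      by (rule measurable_comp[OF path_W_measurable F_measurable1[OF T]])
  qed (use X_measurable[OF T] in auto)
  also have "\<dots> = distr P borel (F T x)"
    unfolding P_def by (rule distr_distr[OF F_measurable1[OF T] path_W_measurable, symmetric])
  finally show ?thesis .
qed

lemma sets_p [simp, measurable_cong]: "sets (p T x) = sets borel"
  by (simp add: transition_kernel_def)

lemma P_in_prob_algebra: "P \<in> space (prob_algebra path_space)"
  by (simp add: space_prob_algebra P.prob_space_axioms)

lemma p_measurable: assumes T: "T \<ge> 0" shows "p T \<in> measurable borel (prob_algebra borel)"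
proof -
  have "(\<lambda>x. distr P borel (F T x)) \<in> measurable borel (prob_algebra borel)"
    by (rule measurable_distr_prob_space2[OF measurable_const[OF P_in_prob_algebra] F_measurable[OF T]])
  then show ?thesis by (simp add: p_eq[OF T, abs_def])
qed

text \<open>The flow up to time \<open>h\<close> reads the path on \<open>[0, h]\<close> only, so it
  is independent of the re-centred later path, whose law is again \<open>P\<close>.\<close>

lemma flow_Markov:
  assumes h: "h \<ge> 0"
  shows "distr M (borel \<Otimes>\<^sub>M path_space) (\<lambda>\<omega>. (F h x (sample_path W \<omega>), sample_path (time_shift h W) \<omega>)) = p h x \<Otimes>\<^sub>M P"
proof -
  let ?X = "\<lambda>\<omega>. \<lambda>t\<in>{0..h}. W t \<omega>"
  let ?S = "PiM {0..h} (\<lambda>_. borel :: (real ^ 'n) measure)"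
  have iv: "M.indep_var ?S ?X path_space (sample_path (time_shift h W))" by (rule wiener_indep_past_future[OF wiener_W h])
  have Xm: "?X \<in> measurable M ?S" by (rule M.indep_var_rv1[OF iv])
  have Ym: "sample_path (time_shift h W) \<in> measurable M path_space" by (rule M.indep_var_rv2[OF iv])
  have Fm: "F h x \<in> borel_measurable ?S" by (rule flow_measurable1[OF h]) auto
  have FX: "F h x (sample_path W \<omega>) = F h x (?X \<omega>)" for \<omega>
    by (rule flow_cong[OF h]) (auto simp: sample_path_def)
  interpret D1: prob_space "distr M ?S ?X" by (rule M.prob_space_distr[OF Xm])
  interpret D2: prob_space "distr M path_space (sample_path (time_shift h W))" by (rule M.prob_space_distr[OF Ym])
  interpret D3: prob_space "distr (distr M ?S ?X) borel (F h x)" by (rule D1.prob_space_distr) (use Fm in simp)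
  have "distr M (borel \<Otimes>\<^sub>M path_space) (\<lambda>\<omega>. (F h x (sample_path W \<omega>), sample_path (time_shift h W) \<omega>))
     = distr M (borel \<Otimes>\<^sub>M path_space) ((\<lambda>(u, v). (F h x u, v)) \<circ> (\<lambda>\<omega>. (?X \<omega>, sample_path (time_shift h W) \<omega>)))"
    by (intro distr_cong) (auto simp: FX)
  also have "\<dots> = distr (distr M (?S \<Otimes>\<^sub>M path_space) (\<lambda>\<omega>. (?X \<omega>, sample_path (time_shift h W) \<omega>))) (borel \<Otimes>\<^sub>M path_space) (\<lambda>(u, v). (F h x u, v))"
    by (rule distr_distr[symmetric])
       (use Fm in \<open>auto simp: case_prod_beta intro!: measurable_Pair Xm Ym measurable_compose[OF measurable_fst] measurable_snd\<close>)
  also have "distr M (?S \<Otimes>\<^sub>M path_space) (\<lambda>\<omega>. (?X \<omega>, sample_path (time_shift h W) \<omega>)) = distr M ?S ?X \<Otimes>\<^sub>M distr M path_space (sample_path (time_shift h W))"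
    using iv unfolding M.indep_var_distribution_eq by simp
  also have "distr (distr M ?S ?X \<Otimes>\<^sub>M distr M path_space (sample_path (time_shift h W))) (borel \<Otimes>\<^sub>M path_space) (\<lambda>(u, v). (F h x u, v))
     = distr (distr M ?S ?X) borel (F h x) \<Otimes>\<^sub>M distr (distr M path_space (sample_path (time_shift h W))) path_space (\<lambda>v. v)"
    by (rule pair_measure_distr[symmetric]) (use Fm in \<open>auto intro: D2.sigma_finite_measure_axioms simp: distr_id2\<close>)
  also have "distr (distr M ?S ?X) borel (F h x) = distr M borel (F h x \<circ> ?X)"
    by (rule distr_distr[OF Fm Xm])
  also have "\<dots> = distr M borel (F h x \<circ> sample_path W)" by (intro distr_cong) (auto simp: FX)
  also have "\<dots> = p h x"
    unfolding p_eq[OF h] P_def by (rule distr_distr[OF F_measurable1[OF h] path_W_measurable, symmetric])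
  also have "distr (distr M path_space (sample_path (time_shift h W))) path_space (\<lambda>v. v) = P"
    unfolding P_def wiener_law_unique[OF wiener_shift[OF wiener_W h] wiener_W] by (rule distr_id2) simp
  finally show ?thesis .
qed

lemma flow_property:
  assumes h: "h \<ge> 0"
  shows "AE \<omega> in M. \<forall>s\<ge>0. F s (F h x (sample_path W \<omega>)) (sample_path (time_shift h W) \<omega>) = F (h + s) x (sample_path W \<omega>)"
  using X_ode[of x] F_eq_X[of x]
proof eventually_elim
  case (elim \<omega>)
  show ?case
  proof (intro allI impI)
    fix s :: real assume s: "s \<ge> 0"
    have "ode_solution b \<sigma> (h + s) x (\<lambda>t. W t \<omega>) (\<lambda>t. X x t \<omega>)" using elim(1) h s by simp
    from ode_solution_shift[OF this b_continuous h s]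
    have "F s (X x h \<omega>) (\<lambda>t. W (h + t) \<omega> - W h \<omega>) = X x (h + s) \<omega>"
      using s by (rule flow_eq_solution) simp
    moreover have "F s z (sample_path (time_shift h W) \<omega>) = F s z (\<lambda>t. W (h + t) \<omega> - W h \<omega>)" for z
      by (rule flow_cong[OF s]) (simp add: sample_path_def time_shift_def)
    ultimately show "F s (F h x (sample_path W \<omega>)) (sample_path (time_shift h W) \<omega>) = F (h + s) x (sample_path W \<omega>)"
      using elim(2) h s by simp
  qed
qed

end

section \<open>One step of the reflection coupling\<close>

text \<open>The square root is concave and lies below its tangent at
  \<open>u\<^sup>2\<close>.\<close>

lemma sqrt_perturbation:
  fixes u v :: real
  assumes "u > 0" "u\<^sup>2 + v \<ge> 0"
  shows "sqrt (u\<^sup>2 + v) \<le> u + v / (2 * u)"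
proof (rule real_le_lsqrt)
  have "- u\<^sup>2 / (2 * u) \<le> v / (2 * u)" using assms by (intro divide_right_mono) auto
  also have "- u\<^sup>2 / (2 * u) = - u / 2" using assms by (simp add: power2_eq_square)
  finally show "0 \<le> u + v / (2 * u)" using assms(1) by simp
  have "(u + v / (2 * u))\<^sup>2 = u\<^sup>2 + v + (v / (2 * u))\<^sup>2"
    using assms by (simp add: power2_eq_square field_simps)
  then show "u\<^sup>2 + v \<le> (u + v / (2 * u))\<^sup>2" by simp
qed

context diffusion
begin

abbreviation "\<kappa> \<equiv> kappa \<sigma> G b"

definition "S z = norm (matrix_inv \<sigma> *v z)"

lemma sigma_inv: "\<sigma> *v (matrix_inv \<sigma> *v z) = z"
proof -
  have "invertible \<sigma>" using det_pos by (simp add: invertible_det_nz)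
  then have "\<sigma> ** matrix_inv \<sigma> = mat 1"
    using someI_ex[of "\<lambda>A'. \<sigma> ** A' = mat 1 \<and> A' ** \<sigma> = mat 1"] by (simp add: invertible_def matrix_inv_def)
  then show ?thesis by (simp add: matrix_vector_mul_assoc)
qed

lemma S_pos: "z \<noteq> 0 \<Longrightarrow> S z > 0"
  unfolding S_def using sigma_inv[of z] by auto

lemma S_gnorm_equiv:
  obtains s1 where "s1 > 0" "\<And>z. s1 * gnorm G z \<le> S z"
proof -
  obtain c C where cC: "c > 0" "C > 0" "\<And>z. c * norm z \<le> gnorm G z" "\<And>z. gnorm G z \<le> C * norm z"
    by (rule gnorm_norm_equiv) blast
  let ?A = "onorm ((*v) \<sigma>)"
  have "gnorm G z \<le> C * (?A + 1) * S z" for z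
  proof -
    have "norm z \<le> ?A * S z"
      using matrix_vector_norm_bound[of \<sigma> "matrix_inv \<sigma> *v z"] by (simp add: sigma_inv S_def)
    also have "\<dots> \<le> (?A + 1) * S z" by (simp add: S_def algebra_simps)
    finally have "C * norm z \<le> C * ((?A + 1) * S z)" using cC by (intro mult_left_mono) auto
    then show ?thesis using cC(4)[of z] by simp
  qed
  moreover have "C * (?A + 1) > 0"
    using cC onorm_pos_le[OF matrix_vector_mul_bounded_linear, of \<sigma>] by simp
  ultimately show ?thesis
    using that[of "1 / (C * (?A + 1))"] by (simp add: field_simps)
qed

lemma alpha_bound: "(S z)\<^sup>2 \<le> alpha \<sigma> G * (gnorm G z)\<^sup>2"
  and alpha_pos: "alpha \<sigma> G > 0"
proof -
  let ?Q = "{(norm (matrix_inv \<sigma> *v z))\<^sup>2 | z. gnorm G z = 1}"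
  obtain c C where cC: "c > 0" "C > 0" "\<And>z. c * norm z \<le> gnorm G z" "\<And>z. gnorm G z \<le> C * norm z"
    by (rule gnorm_norm_equiv) blast
  have "norm (matrix_inv \<sigma> *v z) \<le> onorm ((*v) (matrix_inv \<sigma>)) / c" if "gnorm G z = 1" for z
  proof -
    have "norm z \<le> 1 / c" using cC(1) cC(3)[of z] that by (simp add: field_simps)
    then have "onorm ((*v) (matrix_inv \<sigma>)) * norm z \<le> onorm ((*v) (matrix_inv \<sigma>)) * (1 / c)"
      by (intro mult_left_mono onorm_pos_le matrix_vector_mul_bounded_linear)
    then show ?thesis using matrix_vector_norm_bound[of "matrix_inv \<sigma>" z] by simp
  qed
  then have bdd: "bdd_above ?Q"
    by (intro bdd_aboveI[of _ "(onorm ((*v) (matrix_inv \<sigma>)) / c)\<^sup>2"]) (auto intro!: power_mono)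
  have scale: "(S z)\<^sup>2 = (gnorm G z)\<^sup>2 * (norm (matrix_inv \<sigma> *v ((1 / gnorm G z) *\<^sub>R z)))\<^sup>2"
     "gnorm G ((1 / gnorm G z) *\<^sub>R z) = 1" if "z \<noteq> 0" for z
    using gnorm_pos[OF that]
    by (simp_all add: S_def gnorm_scaleR matrix_vector_mult_scaleR power_divide)
  have le: "(norm (matrix_inv \<sigma> *v ((1 / gnorm G z) *\<^sub>R z)))\<^sup>2 \<le> alpha \<sigma> G" if "z \<noteq> 0" for z
    unfolding alpha_def by (rule cSup_upper[OF _ bdd]) (use scale(2)[OF that] in blast)
  show "(S z)\<^sup>2 \<le> alpha \<sigma> G * (gnorm G z)\<^sup>2"
  proof (cases "z = 0")
    case False
    then show ?thesis unfolding scale(1)[OF False] using mult_right_mono[OF le[OF False], of "(gnorm G z)\<^sup>2"] by (simp add: mult.commute)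
  qed (simp add: S_def)
  have "(axis undefined 1 :: real ^ 'n) \<noteq> 0" by (simp add: axis_eq_0_iff)
  then obtain z :: "real ^ 'n" where z: "z \<noteq> 0" by blast
  have "0 < (S z)\<^sup>2" using S_pos[OF z] by simp
  then have "0 < (norm (matrix_inv \<sigma> *v ((1 / gnorm G z) *\<^sub>R z)))\<^sup>2"
    unfolding scale(1)[OF z] by (simp add: zero_less_mult_iff)
  then show "alpha \<sigma> G > 0" using le[OF z] by linarith
qed

definition "rate_c = 1 / (alpha \<sigma> G * I1)"

lemma rate_c_eq: "rate \<sigma> G \<kappa> = rate_c"
  by (simp add: rate_def rate_c_def I1_def)

lemma rate_c_pos: "rate_c > 0"
  using alpha_pos I1_pos by (simp add: rate_c_def)

text \<open>The diffusion coefficient of the distance under reflection: doubling the noise along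
  \<open>e\<close> adds \<open>2 / S z\<close> times z for each unit of
  \<open>e \<bullet> w h\<close>, and z has length \<open>gnorm G z\<close>.\<close>

definition "lam z = 2 * gnorm G z / S z"

text \<open>Here the rate acquires its value: half of the squared diffusion coefficient is at least
  \<open>2 / alpha \<sigma> G\<close>, and the differential inequality contributes
  \<open>1 / (2 * I1)\<close>.\<close>

lemma lam_rate: assumes "z \<noteq> 0" "v \<ge> 0" shows "(lam z)\<^sup>2 / 2 * (v / (2 * I1)) \<ge> rate_c * v"
proof -
  have "1 / alpha \<sigma> G \<le> (gnorm G z)\<^sup>2 / (S z)\<^sup>2"
    using alpha_bound[of z] alpha_pos S_pos[OF assms(1)] by (simp add: field_simps)
  then have "(1 / alpha \<sigma> G) * (v / I1) \<le> (gnorm G z)\<^sup>2 / (S z)\<^sup>2 * (v / I1)"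
    using assms I1_pos by (intro mult_right_mono) auto
  then show ?thesis by (simp add: lam_def rate_c_def power_mult_distrib power_divide)
qed

text \<open>The rate of change of the distance caused by the drift alone.\<close>

definition "beta x y = (x - y) \<bullet> (G *v (b x - b y)) / gnorm G (x - y)"

text \<open>The weight in the definition of \<kappa> is such that multiplication by
  \<open>r ^ 3 / (2 * s\<^sup>2)\<close> recovers the drift of the distance, with r and s the two
  norms of x - y. Writing the factor as half of the squared \<open>lam\<close> lets it combine with
  the second-order term.\<close>

lemma beta_le:
  assumes "x \<noteq> y"
  shows "beta x y \<le> - (lam (x - y))\<^sup>2 / 2 * (1/4 * gnorm G (x - y) * \<kappa> (gnorm G (x - y)))"
proof -
  let ?r = "gnorm G (x - y)" and ?I = "(x - y) \<bullet> (G *v (b x - b y))" and ?s = "S (x - y)"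
  have r: "?r > 0" "?s > 0" using assms by (auto intro!: gnorm_pos S_pos)
  have "\<kappa> ?r \<le> - 2 * (?s\<^sup>2 / ?r\<^sup>2) * (?I / ?r\<^sup>2)"
    unfolding kappa_def S_def using kappa_bdd[OF r(1)]
    by (intro cInf_lower) (auto simp: kappa_set_def)
  then have "?r ^ 3 / (2 * ?s\<^sup>2) * \<kappa> ?r \<le> ?r ^ 3 / (2 * ?s\<^sup>2) * (- 2 * (?s\<^sup>2 / ?r\<^sup>2) * (?I / ?r\<^sup>2))"
    using r by (intro mult_left_mono) auto
  also have "\<dots> = - beta x y" using r by (simp add: beta_def field_simps power2_eq_square power3_eq_cube)
  also have "?r ^ 3 / (2 * ?s\<^sup>2) * \<kappa> ?r = (lam (x - y))\<^sup>2 / 2 * (1/4 * ?r * \<kappa> ?r)"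
    using r by (simp add: lam_def field_simps power2_eq_square power3_eq_cube)
  finally show ?thesis by simp
qed

lemma dissipative:
  assumes "gnorm G (u - v) > R_0" shows "(u - v) \<bullet> (G *v (b u - b v)) \<le> 0"
proof -
  have r: "gnorm G (u - v) > 0" using assms R0_nonneg by simp
  then have uv: "u \<noteq> v" by auto
  have "(lam (u - v))\<^sup>2 / 2 * (1/4 * gnorm G (u - v) * \<kappa> (gnorm G (u - v))) \<ge> 0"
    using kappa_nonneg[OF assms] r by simp
  then have "beta u v \<le> 0" using beta_le[OF uv] by simp
  then show ?thesis using r by (simp add: beta_def divide_le_0_iff)
qed

lemma abs_beta_le: assumes "x \<noteq> y" shows "\<bar>beta x y\<bar> \<le> gnorm G (b x - b y)"
  using G_Cauchy_Schwarz[of "x - y" "b x - b y"] gnorm_pos[of "x - y"] assms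
  by (simp add: beta_def field_simps)

lemma gnorm_diff_measurable:
  assumes "u \<in> borel_measurable N" "v \<in> borel_measurable N"
  shows "(\<lambda>w. gnorm G (u w - v w)) \<in> borel_measurable N"
  by (rule measurable_compose[OF borel_measurable_diff[OF assms] borel_measurable_gnorm])

lemma synchronous:
  assumes T: "T \<ge> 0"
  shows "AE w in P. gnorm G (F T x w - F T y w) \<le> max (gnorm G (x - y)) R_0"
  unfolding P_def
proof (subst AE_distr_iff[OF path_W_measurable])
  have "(\<lambda>w. gnorm G (F T x w - F T y w)) \<in> borel_measurable path_space"
    by (intro gnorm_diff_measurable F_measurable1 T)
  then show "{w \<in> space path_space. gnorm G (F T x w - F T y w) \<le> max (gnorm G (x - y)) R_0} \<in> sets path_space"
    unfolding borel_measurable_iff_le by blast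
  show "AE \<omega> in M. gnorm G (F T x (sample_path W \<omega>) - F T y (sample_path W \<omega>)) \<le> max (gnorm G (x - y)) R_0"
    using X_ode[of x] X_ode[of y] F_eq_X[of x] F_eq_X[of y]
  proof eventually_elim
    case (elim \<omega>)
    have "gnorm G (X x T \<omega> - X y T \<omega>) \<le> max (gnorm G (x - y)) R_0"
      by (rule synchronous_bound[of b \<sigma> T x "\<lambda>t. W t \<omega>" _ y])
         (use elim T b_continuous dissipative in \<open>auto simp: W_0\<close>)
    then show ?case using elim T by simp
  qed
qed

lemma path_0: "AE w in P. w 0 = 0"
  unfolding P_def
proof (subst AE_distr_iff[OF path_W_measurable])
  have "(\<lambda>w. w 0) \<in> measurable path_space (borel :: (real ^ 'n) measure)"
    by (rule measurable_component_singleton) simp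
  from measurable_sets[OF this, of "{0}"] show "{w \<in> space path_space. w 0 = (0 :: real ^ 'n)} \<in> sets path_space"
    by (simp add: vimage_def Int_def conj_commute)
qed (simp add: sample_path_def W_0)

text \<open>Both components are expanded to first order. Original and reflected noise differ exactly
  by twice the component along \<open>e\<close>, and the two remainders make up
  \<open>h * \<rho>\<close>.\<close>

lemma one_step_good:
  assumes conv: "convergent (dyadic_euler b \<sigma> h x w)" "convergent (dyadic_euler b \<sigma> h y (refl_path h a e w))"
    and h: "0 < h" and w0: "w 0 = 0" and good: "good h a w" and a: "0 < a"
    and K: "norm x \<le> K" "norm y \<le> K"
    and L: "L \<ge> 0" "\<And>x y. norm x \<le> K + 1 \<Longrightarrow> norm y \<le> K + 1 \<Longrightarrow> norm (b x - b y) \<le> L * norm (x - y)"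
    and C: "\<And>x. norm x \<le> K + 1 \<Longrightarrow> norm (b x) \<le> C"
    and small: "h * C + onorm ((*v) \<sigma>) * a \<le> 1"
    and Cg: "Cg > 0" "\<And>z. gnorm G z \<le> Cg * norm z"
    and e: "norm e = 1 \<or> e = 0"
  defines "\<rho> \<equiv> 2 * Cg * L * (h * C + onorm ((*v) \<sigma>) * a)"
  shows "gnorm G (F h x w - F h y (refl_path h a e w)) \<le>
      gnorm G ((x - y) + h *\<^sub>R (b x - b y) + (2 * (e \<bullet> w h)) *\<^sub>R (\<sigma> *v e)) + h * \<rho>"
proof -
  let ?w' = "refl_path h a e w"
  let ?a = "onorm ((*v) \<sigma>) * a"
  have nr: "norm (refl_along e v) = norm v" for v
    using orthogonal_refl_along[OF e] by (simp add: orthogonal_transformation)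
  have w': "?w' t = refl_along e (w t)" if "t \<ge> 0" for t
    using that good by (simp add: refl_path_def)
  have w'0: "?w' 0 = 0" using w0 by (simp add: w' refl_along_def)
  have sb: "norm (\<sigma> *v v) \<le> ?a" if "norm v \<le> a" for v
    using matrix_vector_norm_bound[of \<sigma> v] mult_left_mono[OF that onorm_pos_le[OF matrix_vector_mul_bounded_linear, of \<sigma>]]
    by linarith
  have tp: "h / 2 ^ n * real k \<ge> 0" for n k using h by simp
  have g: "norm (w (h / 2 ^ n * real k)) \<le> a" if "k \<le> 2 ^ n" for n k
    using good that unfolding good_def by blast
  have 1: "norm (F h x w - (x + h *\<^sub>R b x + \<sigma> *v (w h - w 0))) \<le> h * (L * (h * C + ?a))"
  proof (rule flow_local_expansion[OF conv(1) _ K(1) L C _ small])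
    fix n k :: nat assume "k \<le> 2 ^ n"
    then show "norm (\<sigma> *v (w (h / 2 ^ n * real k) - w 0)) \<le> ?a"
      using g[of k n] w0 sb by simp
  qed (use h in auto)
  have 2: "norm (F h y ?w' - (y + h *\<^sub>R b y + \<sigma> *v (?w' h - ?w' 0))) \<le> h * (L * (h * C + ?a))"
  proof (rule flow_local_expansion[OF conv(2) _ K(2) L C _ small])
    fix n k :: nat assume "k \<le> 2 ^ n"
    then show "norm (\<sigma> *v (?w' (h / 2 ^ n * real k) - ?w' 0)) \<le> ?a"
      using g[of k n] w'0 w'[OF tp] nr sb by simp
  qed (use h in auto)
  let ?D = "F h x w - F h y ?w'"
  let ?m = "(x - y) + h *\<^sub>R (b x - b y) + (2 * (e \<bullet> w h)) *\<^sub>R (\<sigma> *v e)"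
  have ww: "w h - ?w' h = (2 * (e \<bullet> w h)) *\<^sub>R e" using h by (simp add: w' refl_along_def)
  have "\<sigma> *v (w h - ?w' h) = (2 * (e \<bullet> w h)) *\<^sub>R (\<sigma> *v e)"
    unfolding ww by (simp add: matrix_vector_mult_scaleR)
  then have dec: "?D - ?m = (F h x w - (x + h *\<^sub>R b x + \<sigma> *v (w h - w 0))) - (F h y ?w' - (y + h *\<^sub>R b y + \<sigma> *v (?w' h - ?w' 0)))"
    by (simp add: w0 w'0 matrix_vector_mult_diff_distrib algebra_simps)
  have "norm (?D - ?m) \<le> norm (F h x w - (x + h *\<^sub>R b x + \<sigma> *v (w h - w 0))) + norm (F h y ?w' - (y + h *\<^sub>R b y + \<sigma> *v (?w' h - ?w' 0)))"
    unfolding dec by (rule norm_triangle_ineq4)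
  also have "\<dots> \<le> h * (L * (h * C + ?a)) + h * (L * (h * C + ?a))" by (rule add_mono[OF 1 2])
  finally have "norm (?D - ?m) \<le> 2 * (h * (L * (h * C + ?a)))" by (simp only: mult_2)
  then have "Cg * norm (?D - ?m) \<le> Cg * (2 * (h * (L * (h * C + ?a))))" using Cg(1) by (intro mult_left_mono) auto
  with Cg(2)[of "?D - ?m"] have "gnorm G (?D - ?m) \<le> Cg * (2 * (h * (L * (h * C + ?a))))" by (rule order_trans)
  also have "\<dots> = h * \<rho>" by (simp add: \<rho>_def)
  finally have "gnorm G (?D - ?m) \<le> h * \<rho>" .
  moreover have "gnorm G ?D \<le> gnorm G ?m + gnorm G (?D - ?m)"
    using gnorm_triangle[of ?m "?D - ?m"] by simp
  ultimately show ?thesis by linarith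
qed

text \<open>The reflection direction is mapped by \<sigma> to a multiple of x - y, so the noise
  merely rescales the difference by a factor \<open>q\<close>. This factor cancels in the linear
  drift term, and \<open>q \<ge> 1/2\<close> keeps the quadratic remainder bounded.\<close>

lemma gnorm_drift_expansion:
  assumes xy: "x \<noteq> y" and q: "q \<ge> 1/2" and h: "h \<ge> 0"
  shows "gnorm G (q *\<^sub>R (x - y) + h *\<^sub>R (b x - b y)) \<le>
     q * gnorm G (x - y) + h * beta x y + h\<^sup>2 * (gnorm G (b x - b y))\<^sup>2 / gnorm G (x - y)"
proof -
  let ?r = "gnorm G (x - y)" and ?d = "b x - b y"
  have r: "?r > 0" using xy by (intro gnorm_pos) simp
  have sq: "(gnorm G (q *\<^sub>R (x - y) + h *\<^sub>R ?d))\<^sup>2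
      = (q * ?r)\<^sup>2 + (2 * q * h * ((x - y) \<bullet> (G *v ?d)) + h\<^sup>2 * (gnorm G ?d)\<^sup>2)"
    unfolding gnorm_sq_add by (simp add: gnorm_scaleR power_mult_distrib matrix_vector_mult_scaleR)
  have "gnorm G (q *\<^sub>R (x - y) + h *\<^sub>R ?d) = sqrt ((q * ?r)\<^sup>2 + (2 * q * h * ((x - y) \<bullet> (G *v ?d)) + h\<^sup>2 * (gnorm G ?d)\<^sup>2))"
    unfolding sq[symmetric] by simp
  also have "\<dots> \<le> q * ?r + (2 * q * h * ((x - y) \<bullet> (G *v ?d)) + h\<^sup>2 * (gnorm G ?d)\<^sup>2) / (2 * (q * ?r))"
  proof (rule sqrt_perturbation)
    show "0 < q * ?r" using q r by simp
    show "0 \<le> (q * ?r)\<^sup>2 + (2 * q * h * ((x - y) \<bullet> (G *v ?d)) + h\<^sup>2 * (gnorm G ?d)\<^sup>2)"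
      unfolding sq[symmetric] by simp
  qed
  also have "(2 * q * h * ((x - y) \<bullet> (G *v ?d)) + h\<^sup>2 * (gnorm G ?d)\<^sup>2) / (2 * (q * ?r))
      = h * beta x y + h\<^sup>2 * (gnorm G ?d)\<^sup>2 / (2 * q * ?r)"
    using q r by (simp add: beta_def add_divide_distrib)
  also have "h\<^sup>2 * (gnorm G ?d)\<^sup>2 / (2 * q * ?r) \<le> h\<^sup>2 * (gnorm G ?d)\<^sup>2 / ?r"
    using q r by (intro divide_left_mono) auto
  finally show ?thesis by simp
qed

definition "step_dist h a e x y w = gnorm G (F h x w - F h y (refl_path h a e w))"

lemma step_dist_nonneg [simp]: "step_dist h a e x y w \<ge> 0"
  by (simp add: step_dist_def)

lemma refl_path_measurable_P: "h \<ge> 0 \<Longrightarrow> refl_path h a e \<in> measurable P path_space"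
  using refl_path_measurable1[of h a e] by (simp only: measurable_cong_sets[OF sets_P refl])

lemma refl_path_P_law:
  "norm e = 1 \<or> e = 0 \<Longrightarrow> h \<ge> 0 \<Longrightarrow> distr P path_space (refl_path h a e) = P"
  unfolding P_def by (rule refl_path_law[OF wiener_W])

lemma euler_refl_convergent:
  assumes e: "norm e = 1 \<or> e = 0" and h: "h \<ge> 0"
  shows "AE w in P. convergent (dyadic_euler b \<sigma> h y (refl_path h a e w))"
proof -
  have "AE w in distr P path_space (refl_path h a e). convergent (dyadic_euler b \<sigma> h y w)"
    unfolding refl_path_P_law[OF e h] by (rule euler_convergent[OF h])
  then show ?thesis by (rule AE_distrD[OF refl_path_measurable_P[OF h]])
qed

lemma step_dist_synchronous:
  assumes h: "h \<ge> 0"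
  shows "AE w in P. e = 0 \<or> \<not> good h a w \<longrightarrow> step_dist h a e x y w \<le> max (gnorm G (x - y)) R_0"
  using synchronous[OF h, of x y] AE_space
proof eventually_elim
  case (elim w)
  have "refl_path h a e w = w" if "e = 0 \<or> \<not> good h a w"
  proof (cases "e = 0")
    case True
    then show ?thesis using refl_path_0 elim(2) by simp
  next
    case False
    show ?thesis
    proof
      fix t show "refl_path h a e w t = w t"
        using False that path_space_undefined[of w t] elim(2) by (cases "t \<in> {0..}") (simp_all add: refl_path_def)
    qed
  qed
  then show ?case using elim(1) by (auto simp: step_dist_def)
qed

definition "bad h a = {w \<in> space P. \<not> good h a w}"

lemma bad_sets: "h \<ge> 0 \<Longrightarrow> bad h a \<in> sets P"
proof -
  assume "h \<ge> 0"
  have "bad h a = space P - {w \<in> space path_space. good h a w}" by (auto simp: bad_def)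
  also have "\<dots> \<in> sets P" using good_sets[OF \<open>h \<ge> 0\<close>] by (intro sets.compl_sets) simp
  finally show ?thesis .
qed

definition "cbad = 126093 * real CARD('n) ^ 5"

lemma prob_bad:
  assumes h: "h > 0" and a: "a > 0"
  shows "measure P (bad h a) \<le> cbad * h\<^sup>2 / a ^ 4"
proof -
  have ge: "h / 2 ^ n * real k \<ge> 0" for n k using h by simp
  have "emeasure P (bad h a) = emeasure M (sample_path W -` bad h a \<inter> space M)"
    unfolding P_def using bad_sets[of h a] h by (intro emeasure_distr path_W_measurable) simp
  also have "sample_path W -` bad h a \<inter> space M = {\<omega> \<in> space M. \<not> (\<forall>n k. k \<le> 2 ^ n \<longrightarrow> norm (W (h / 2 ^ n * real k) \<omega>) \<le> a)}"
    using measurable_space[OF path_W_measurable] ge by (auto simp: bad_def good_def sample_path_def)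
  also have "emeasure M \<dots> \<le> ennreal (cbad * h\<^sup>2 / a ^ 4)"
    unfolding cbad_def by (rule wiener_sup_bound[OF wiener_W h a])
  finally show ?thesis
    unfolding P.emeasure_eq_measure by (subst (asm) ennreal_le_iff) (auto simp: cbad_def)
qed

lemma path_moments:
  assumes h: "h > 0" and e: "norm e = 1"
  shows "has_bochner_integral P (\<lambda>w. e \<bullet> w h) 0"
    and "has_bochner_integral P (\<lambda>w. (e \<bullet> w h)\<^sup>2) h"
    and "has_bochner_integral P (\<lambda>w. (e \<bullet> w h) ^ 4) (3 * h\<^sup>2)"
proof -
  have "(\<lambda>w. w h) \<in> measurable path_space (borel :: (real ^ 'n) measure)"
    by (rule measurable_component_singleton) (use h in simp)
  then have m: "(\<lambda>w. e \<bullet> w h) \<in> borel_measurable path_space"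
    by (rule borel_measurable_inner[OF borel_measurable_const])
  have eq: "e \<bullet> sample_path W \<omega> h = e \<bullet> W h \<omega>" for \<omega> using h by (simp add: sample_path_def)
  show "has_bochner_integral P (\<lambda>w. e \<bullet> w h) 0"
    unfolding P_def by (rule has_bochner_integral_distr[OF m path_W_measurable]) (simp only: eq wiener_inner_moments[OF wiener_W h e])
  show "has_bochner_integral P (\<lambda>w. (e \<bullet> w h)\<^sup>2) h"
    unfolding P_def by (rule has_bochner_integral_distr[OF borel_measurable_power[OF m] path_W_measurable]) (simp only: eq wiener_inner_moments[OF wiener_W h e])
  show "has_bochner_integral P (\<lambda>w. (e \<bullet> w h) ^ 4) (3 * h\<^sup>2)"
    unfolding P_def by (rule has_bochner_integral_distr[OF borel_measurable_power[OF m] path_W_measurable]) (simp only: eq wiener_inner_moments[OF wiener_W h e])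
qed

text \<open>The polynomial is an upper bound on the whole space after a correction on the bad event.
  Its expectation therefore uses the exact Gaussian moments: the linear term vanishes and the
  quadratic one yields \<open>u2 * h\<close>.\<close>

lemma quadratic_expectation_bound:
  assumes h: "h > 0" and a: "a > 0" and D: "D \<ge> 0" and Y: "\<And>w. Y w \<ge> 0"
    and le: "AE w in P. Y w \<le> u0 + u1 * (e \<bullet> w h) + u2 * (e \<bullet> w h)\<^sup>2 + indicator (bad h a) w * (D * (1 + (e \<bullet> w h)\<^sup>2))"
    and e: "norm e = 1"
  shows "(\<integral>\<^sup>+w. ennreal (Y w) \<partial>P) \<le> ennreal (u0 + u2 * h + D * (2 * (cbad * h\<^sup>2 / a ^ 4) + 3 * h\<^sup>2))"
proof -
  let ?\<xi> = "\<lambda>w. e \<bullet> w h" and ?B = "bad h a"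
  let ?m = "\<lambda>w. u0 + u1 * ?\<xi> w + u2 * (?\<xi> w)\<^sup>2 + D * (2 * indicator ?B w + (?\<xi> w) ^ 4)"
  have B: "has_bochner_integral P (indicator ?B) (measure P ?B)"
    using bad_sets[of h a] h by (intro has_bochner_integral_real_indicator) (auto simp: P.emeasure_eq_measure)
  have c: "has_bochner_integral P (\<lambda>w. u0) u0"
    using P.prob_space by (simp add: has_bochner_integral_iff)
  have hb: "has_bochner_integral P ?m (u0 + u1 * 0 + u2 * h + D * (2 * measure P ?B + 3 * h\<^sup>2))"
    by (intro has_bochner_integral_add has_bochner_integral_mult_right c path_moments[OF h e] B)
  have "AE w in P. Y w \<le> ?m w"
    using le
  proof eventually_elim
    case (elim w)
    \<comment> \<open>The square is traded for a fourth power outside the indicator; the expectation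
      is then a full moment of order \<open>h\<^sup>2\<close>, and no correlation with the bad event
      has to be estimated.\<close>
    have "indicator ?B w * (D * (1 + (?\<xi> w)\<^sup>2)) \<le> D * (2 * indicator ?B w + (?\<xi> w) ^ 4)"
    proof (cases "w \<in> ?B")
      case True
      have "(?\<xi> w)\<^sup>2 \<le> 1 + ((?\<xi> w)\<^sup>2)\<^sup>2"
        using zero_le_power2[of "(?\<xi> w)\<^sup>2 - 1/2"] by (simp add: power2_diff power_divide)
      then have "D * (1 + (?\<xi> w)\<^sup>2) \<le> D * (2 + (?\<xi> w) ^ 4)"
        using D by (intro mult_left_mono) auto
      then show ?thesis using True by simp
    qed (use D in \<open>auto simp: mult_nonneg_nonneg\<close>)
    then show ?case using elim by linarith
  qed
  moreover from this have "AE w in P. 0 \<le> ?m w"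
    by eventually_elim (use Y order_trans in blast)
  ultimately have "(\<integral>\<^sup>+w. ennreal (Y w) \<partial>P) \<le> (\<integral>\<^sup>+w. ennreal (?m w) \<partial>P)"
    by (intro nn_integral_mono_AE) (auto elim!: eventually_mono intro: ennreal_leI)
  also have "\<dots> = ennreal (integral\<^sup>L P ?m)"
    by (rule nn_integral_eq_integral) (use hb \<open>AE w in P. 0 \<le> ?m w\<close> in \<open>auto intro: integrable.intros\<close>)
  also have "integral\<^sup>L P ?m = u0 + u2 * h + D * (2 * measure P ?B + 3 * h\<^sup>2)"
    using has_bochner_integral_integral_eq[OF hb] by simp
  also have "\<dots> \<le> u0 + u2 * h + D * (2 * (cbad * h\<^sup>2 / a ^ 4) + 3 * h\<^sup>2)"
    using prob_bad[OF h a] D by (intro add_left_mono mult_left_mono add_right_mono) auto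
  finally show ?thesis by (simp add: ennreal_leI)
qed

text \<open>The error is deliberately weakened to the form of the reflected case, so that all
  regimes share the same term.\<close>

lemma constant_expectation_bound:
  assumes h: "h > 0" and a: "a > 0" and D: "D \<ge> 0" and u0: "u0 \<ge> 0"
    and le: "AE w in P. Y w \<le> u0 + indicator (bad h a) w * D"
  shows "(\<integral>\<^sup>+w. ennreal (Y w) \<partial>P) \<le> ennreal (u0 + D * (2 * (cbad * h\<^sup>2 / a ^ 4) + 3 * h\<^sup>2))"
proof -
  have "(\<integral>\<^sup>+w. ennreal (Y w) \<partial>P) \<le> (\<integral>\<^sup>+w. ennreal u0 + ennreal D * indicator (bad h a) w \<partial>P)"
    using le
    by (intro nn_integral_mono_AE) (auto elim!: eventually_mono simp: indicator_def u0 D ennreal_leI simp flip: ennreal_plus)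
  also have "\<dots> = ennreal u0 + ennreal D * emeasure P (bad h a)"
    using bad_sets[of h a] h by (subst nn_integral_add) (auto simp: nn_integral_cmult_indicator P.emeasure_space_1[unfolded space_P] mult.commute)
  also have "\<dots> = ennreal (u0 + D * measure P (bad h a))"
    using u0 D by (simp add: P.emeasure_eq_measure ennreal_mult)
  also have "\<dots> \<le> ennreal (u0 + D * (2 * (cbad * h\<^sup>2 / a ^ 4) + 3 * h\<^sup>2))"
  proof (intro ennreal_leI add_left_mono mult_left_mono D)
    have "cbad * h\<^sup>2 / a ^ 4 \<ge> 0" by (simp add: cbad_def)
    then show "measure P (bad h a) \<le> 2 * (cbad * h\<^sup>2 / a ^ 4) + 3 * h\<^sup>2"
      using prob_bad[OF h a] zero_le_power2[of h] by linarith
  qed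
  finally show ?thesis .
qed

text \<open>The direction of reflection; the value \<open>0\<close> stands for the synchronous coupling, as
  \<open>refl_along 0\<close> is the identity.\<close>

definition dirn :: "real \<Rightarrow> real \<Rightarrow> real ^ 'n \<Rightarrow> real ^ 'n \<Rightarrow> real ^ 'n" where
  "dirn \<delta> R x y = (if \<delta> \<le> gnorm G (x - y) \<and> gnorm G (x - y) \<le> R
     then (1 / S (x - y)) *\<^sub>R (matrix_inv \<sigma> *v (x - y)) else 0)"

lemma norm_dirn: "\<delta> > 0 \<Longrightarrow> norm (dirn \<delta> R x y) = 1 \<or> dirn \<delta> R x y = 0"
proof (cases "\<delta> \<le> gnorm G (x - y) \<and> gnorm G (x - y) \<le> R")
  case True
  assume "\<delta> > 0"
  then have "x - y \<noteq> 0" using True by auto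
  then have "S (x - y) > 0" by (rule S_pos)
  then show ?thesis using True by (auto simp: dirn_def S_def)
qed (auto simp: dirn_def)

end

lemma abs_add3_le: "\<bar>u\<bar> \<le> U \<Longrightarrow> \<bar>v\<bar> \<le> V \<Longrightarrow> \<bar>w\<bar> \<le> W \<Longrightarrow> \<bar>u + v + w\<bar> \<le> U + V + (W :: real)"
  by linarith

text \<open>On the bad event the Taylor polynomial is no upper bound and may even be very negative;
  this multiple of \<open>1 + x\<^sup>2\<close> compensates for that.\<close>

lemma quadratic_domination:
  fixes x :: real
  assumes "Y \<le> d" "\<bar>u0\<bar> \<le> A0" "\<bar>u1\<bar> \<le> A1" "\<bar>u2\<bar> \<le> A2" "0 \<le> d"
  shows "Y \<le> u0 + u1 * x + u2 * x\<^sup>2 + (d + A0 + A1 + A2) * (1 + x\<^sup>2)"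
proof -
  have x: "\<bar>x\<bar> \<le> 1 + x\<^sup>2"
    using zero_le_power2[of "\<bar>x\<bar> - 1/2"] by (simp add: power2_diff power_divide)
  define p1 p2 p3 where "p1 = A1 * (1 + x\<^sup>2)" and "p2 = A2 * (1 + x\<^sup>2)" and "p3 = (d + A0) * (1 + x\<^sup>2)"
  have "\<bar>u1 * x\<bar> \<le> p1" "\<bar>u2 * x\<^sup>2\<bar> \<le> p2"
    unfolding abs_mult p1_def p2_def using assms x by (intro mult_mono; auto)+
  moreover have "d + A0 \<le> p3"
    using assms mult_left_mono[of 1 "1 + x\<^sup>2" "d + A0"] by (simp add: p3_def)
  moreover have "(d + A0 + A1 + A2) * (1 + x\<^sup>2) = p3 + p1 + p2"
    by (simp add: p1_def p2_def p3_def algebra_simps)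
  ultimately show ?thesis using assms by linarith
qed

section \<open>One-step estimates on a ball with fixed constants\<close>

locale local_bounds = diffusion G \<sigma> b M B X
  for G \<sigma> :: "real ^ 'n ^ 'n" and b :: "real ^ 'n \<Rightarrow> real ^ 'n"
    and M :: "'w measure" and B :: "real \<Rightarrow> 'w \<Rightarrow> real ^ 'n" and X :: "real ^ 'n \<Rightarrow> real \<Rightarrow> 'w \<Rightarrow> real ^ 'n" +
  fixes K L C cg Cg s1 :: real
  assumes L: "L \<ge> 0" "\<And>x y. norm x \<le> K + 1 \<Longrightarrow> norm y \<le> K + 1 \<Longrightarrow> norm (b x - b y) \<le> L * norm (x - y)"
    and C: "C \<ge> 0" "\<And>x. norm x \<le> K + 1 \<Longrightarrow> norm (b x) \<le> C"
    and cg: "cg > 0" "\<And>z. cg * norm z \<le> gnorm G z"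
    and Cg: "Cg > 0" "\<And>z. gnorm G z \<le> Cg * norm z"
    and s1: "s1 > 0" "\<And>z. s1 * gnorm G z \<le> S z"
begin

text \<open>Roles of the constants that follow: \<Lambda> bounds \<open>lam\<close>,
  \<open>Q\<close> the difference of the drifts, \<open>rho\<close> the remainder of the two
  expansions, \<open>eta\<close> adds to it the quadratic drift term at distance at least \<delta>,
  and \<open>Dr\<close> bounds the distance after a synchronous step.\<close>

definition "As = onorm ((*v) \<sigma>)"
definition "\<Lambda> = 2 / s1"
definition "Q = 2 * Cg * C"
definition "rho h a = 2 * Cg * L * (h * C + As * a)"
definition "eta \<delta> h a = h * Q\<^sup>2 / \<delta> + rho h a"
definition "Dr = 2 * Cg * K + R_0"

lemma As_nonneg: "As \<ge> 0"
  unfolding As_def by (rule onorm_pos_le[OF matrix_vector_mul_bounded_linear])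

lemma Lambda_pos: "\<Lambda> > 0" using s1 by (simp add: \<Lambda>_def)
lemma Q_nonneg: "Q \<ge> 0" using Cg C by (simp add: Q_def)

lemma rho_nonneg: "h \<ge> 0 \<Longrightarrow> a \<ge> 0 \<Longrightarrow> rho h a \<ge> 0"
  using Cg C L As_nonneg by (simp add: rho_def)

lemma eta_nonneg: "h \<ge> 0 \<Longrightarrow> a \<ge> 0 \<Longrightarrow> \<delta> > 0 \<Longrightarrow> eta \<delta> h a \<ge> 0"
  using rho_nonneg[of h a] by (simp add: eta_def)

lemma lam_bounds: assumes "z \<noteq> 0" shows "0 < lam z" "lam z \<le> \<Lambda>"
proof -
  have "gnorm G z > 0" "S z > 0" using assms by (auto intro: gnorm_pos S_pos)
  then show "0 < lam z" "lam z \<le> \<Lambda>"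
    using s1(1) s1(2)[of z] by (auto simp: lam_def \<Lambda>_def field_simps)
qed

lemma gnorm_drift_le:
  assumes "norm x \<le> K" "norm y \<le> K" shows "gnorm G (b x - b y) \<le> Q"
proof -
  have "norm (b x - b y) \<le> C + C"
    using norm_triangle_ineq4[of "b x" "b y"] C(2)[of x] C(2)[of y] assms by linarith
  then have "Cg * norm (b x - b y) \<le> Cg * (C + C)" using Cg by (intro mult_left_mono) auto
  then show ?thesis using Cg(2)[of "b x - b y"] by (simp add: Q_def)
qed

lemma beta_bound: assumes "norm x \<le> K" "norm y \<le> K" "x \<noteq> y" shows "\<bar>beta x y\<bar> \<le> Q"
  using abs_beta_le[OF assms(3)] gnorm_drift_le[OF assms(1,2)] by linarith

lemma dist_le_Dr: assumes "norm x \<le> K" "norm y \<le> K" shows "max (gnorm G (x - y)) R_0 \<le> Dr"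
proof -
  have "norm (x - y) \<le> 2 * K" using norm_triangle_ineq4[of x y] assms by linarith
  then have "Cg * norm (x - y) \<le> Cg * (2 * K)" using Cg by (intro mult_left_mono) auto
  then have "gnorm G (x - y) \<le> 2 * Cg * K" using Cg(2)[of "x - y"] by simp
  moreover have "2 * Cg * K \<ge> 0" using Cg assms(1) order_trans[OF norm_ge_zero assms(1)] by simp
  ultimately show ?thesis using R0_nonneg by (simp add: Dr_def)
qed

lemma good_step:
  assumes h: "0 < h" and a: "0 < a" and K: "norm x \<le> K" "norm y \<le> K"
    and small: "h * C + As * a \<le> 1" and e: "norm e = 1 \<or> e = 0"
  shows "AE w in P. good h a w \<longrightarrow> step_dist h a e x y w \<le>
      gnorm G ((x - y) + h *\<^sub>R (b x - b y) + (2 * (e \<bullet> w h)) *\<^sub>R (\<sigma> *v e)) + h * rho h a"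
  using euler_convergent[OF less_imp_le[OF h], of x] euler_refl_convergent[OF e less_imp_le[OF h], of y a] path_0
proof eventually_elim
  case (elim w)
  show ?case
    unfolding step_dist_def rho_def As_def
    using one_step_good[OF elim(1,2) h elim(3) _ a K L C(2) small[unfolded As_def] Cg e] by blast
qed

lemma step_sync:
  assumes h: "0 < h" and a: "0 < a" and K: "norm x \<le> K" "norm y \<le> K"
    and small: "h * C + As * a \<le> 1" and \<delta>: "0 < \<delta>" "\<delta> \<le> gnorm G (x - y)"
  shows "AE w in P. good h a w \<longrightarrow> step_dist h a 0 x y w \<le> gnorm G (x - y) + h * (beta x y + eta \<delta> h a)"
proof -
  have xy: "x \<noteq> y" using \<delta> by auto
  have "gnorm G (1 *\<^sub>R (x - y) + h *\<^sub>R (b x - b y)) \<le> 1 * gnorm G (x - y) + h * beta x y + h\<^sup>2 * (gnorm G (b x - b y))\<^sup>2 / gnorm G (x - y)"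
    using h by (intro gnorm_drift_expansion xy) auto
  also have "h\<^sup>2 * (gnorm G (b x - b y))\<^sup>2 / gnorm G (x - y) \<le> h\<^sup>2 * Q\<^sup>2 / \<delta>"
    using \<delta> gnorm_drift_le[OF K] by (intro frac_le mult_left_mono power_mono) auto
  also have "h\<^sup>2 * Q\<^sup>2 / \<delta> = h * (h * Q\<^sup>2 / \<delta>)" by (simp add: power2_eq_square)
  finally have "gnorm G (x - y + h *\<^sub>R (b x - b y)) + h * rho h a \<le> gnorm G (x - y) + h * (beta x y + eta \<delta> h a)"
    by (simp add: eta_def algebra_simps)
  moreover have "AE w in P. good h a w \<longrightarrow> step_dist h a 0 x y w \<le>
      gnorm G ((x - y) + h *\<^sub>R (b x - b y) + (2 * (0 \<bullet> w h)) *\<^sub>R (\<sigma> *v 0)) + h * rho h a"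
    by (rule good_step[OF h a K small]) simp
  ultimately show ?thesis by (auto elim!: eventually_mono)
qed

text \<open>Near the diagonal the expansion of the norm would divide by the distance. The Lipschitz
  bound avoids this and gives a growth proportional to \<delta>.\<close>

lemma step_near:
  assumes h: "0 < h" and a: "0 < a" and K: "norm x \<le> K" "norm y \<le> K"
    and small: "h * C + As * a \<le> 1" and \<delta>: "gnorm G (x - y) \<le> \<delta>"
  shows "AE w in P. good h a w \<longrightarrow> step_dist h a 0 x y w \<le> gnorm G (x - y) + h * (Cg * L * \<delta> / cg + rho h a)"
proof -
  have "norm (b x - b y) \<le> L * norm (x - y)" using L K by simp
  also have "\<dots> \<le> L * (\<delta> / cg)"
    using cg(1) order_trans[OF cg(2) \<delta>] L(1) by (intro mult_left_mono) (auto simp: field_simps)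
  finally have "Cg * norm (b x - b y) \<le> Cg * (L * (\<delta> / cg))" using Cg by (intro mult_left_mono) auto
  then have "gnorm G (b x - b y) \<le> Cg * L * \<delta> / cg" using Cg(2)[of "b x - b y"] by simp
  then have "gnorm G (h *\<^sub>R (b x - b y)) \<le> h * (Cg * L * \<delta> / cg)"
    using h by (simp only: gnorm_scaleR abs_of_pos) (rule mult_left_mono, auto)
  then have "gnorm G (x - y + h *\<^sub>R (b x - b y)) + h * rho h a \<le> gnorm G (x - y) + h * (Cg * L * \<delta> / cg + rho h a)"
    using gnorm_triangle[of "x - y" "h *\<^sub>R (b x - b y)"] unfolding distrib_left by linarith
  moreover have "AE w in P. good h a w \<longrightarrow> step_dist h a 0 x y w \<le>
      gnorm G ((x - y) + h *\<^sub>R (b x - b y) + (2 * (0 \<bullet> w h)) *\<^sub>R (\<sigma> *v 0)) + h * rho h a"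
    by (rule good_step[OF h a K small]) simp
  ultimately show ?thesis by (auto elim!: eventually_mono)
qed

text \<open>The direction is the normalised preimage of x - y under \<sigma>, so the noise acts
  along x - y itself and the distance moves by \<open>lam (x - y)\<close> times a scalar Gaussian
  variable.\<close>

lemma step_refl:
  assumes h: "0 < h" and a: "0 < a" and K: "norm x \<le> K" "norm y \<le> K"
    and small: "h * C + As * a \<le> 1" and \<delta>: "0 < \<delta>" "\<delta> \<le> gnorm G (x - y)" "gnorm G (x - y) \<le> R"
    and as: "4 * a \<le> s1 * \<delta>"
  defines "e \<equiv> dirn \<delta> R x y"
  shows "norm e = 1" and "AE w in P. good h a w \<longrightarrow> \<bar>e \<bullet> w h\<bar> \<le> a \<and> step_dist h a e x y w \<le>
      gnorm G (x - y) + lam (x - y) * (e \<bullet> w h) + h * (beta x y + eta \<delta> h a)"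
proof -
  let ?z = "x - y" let ?r = "gnorm G ?z" and ?s = "S ?z"
  have xy: "x \<noteq> y" using \<delta> by auto
  have sp: "?s > 0" "?r > 0" using xy by (auto intro!: S_pos gnorm_pos)
  have e: "e = (1 / ?s) *\<^sub>R (matrix_inv \<sigma> *v ?z)" using \<delta> by (simp add: e_def dirn_def)
  show ne: "norm e = 1" using sp by (simp add: e S_def)
  have se: "\<sigma> *v e = (1 / ?s) *\<^sub>R ?z" by (simp add: e matrix_vector_mult_scaleR sigma_inv)
  \<comment> \<open>Guarantees that the rescaling factor of x - y stays above 1/2 on good
    paths.\<close>
  have sd: "4 * a \<le> ?s"
  proof -
    have "s1 * \<delta> \<le> s1 * ?r" using \<delta> s1 by simp
    then show ?thesis using as s1(2)[of ?z] by linarith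
  qed
  have "AE w in P. good h a w \<longrightarrow> step_dist h a e x y w \<le>
      gnorm G (?z + h *\<^sub>R (b x - b y) + (2 * (e \<bullet> w h)) *\<^sub>R (\<sigma> *v e)) + h * rho h a"
    by (rule good_step[OF h a K small]) (simp add: ne)
  then show "AE w in P. good h a w \<longrightarrow> \<bar>e \<bullet> w h\<bar> \<le> a \<and> step_dist h a e x y w \<le>
      ?r + lam ?z * (e \<bullet> w h) + h * (beta x y + eta \<delta> h a)"
  proof eventually_elim
    case (elim w)
    show ?case
    proof
      assume g: "good h a w"
      \<comment> \<open>The endpoint \<open>h\<close> is itself a dyadic point: level 0, index
        1.\<close>
      have "norm (w (h / 2 ^ 0 * real 1)) \<le> a" using g unfolding good_def by (metis one_le_numeral power_0 order_refl)
      then have wh: "\<bar>e \<bullet> w h\<bar> \<le> a" using Cauchy_Schwarz_ineq2[of e "w h"] ne by simp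
      let ?x = "e \<bullet> w h" and ?q = "1 + 2 * (e \<bullet> w h) / ?s"
      have q: "?q \<ge> 1/2" using wh sd sp by (simp add: field_simps)
      have eq: "?z + h *\<^sub>R (b x - b y) + (2 * ?x) *\<^sub>R (\<sigma> *v e) = ?q *\<^sub>R ?z + h *\<^sub>R (b x - b y)"
        by (simp add: se scaleR_add_left)
      have "gnorm G (?q *\<^sub>R ?z + h *\<^sub>R (b x - b y)) \<le> ?q * ?r + h * beta x y + h\<^sup>2 * (gnorm G (b x - b y))\<^sup>2 / ?r"
        using h by (intro gnorm_drift_expansion xy q) auto
      also have "h\<^sup>2 * (gnorm G (b x - b y))\<^sup>2 / ?r \<le> h\<^sup>2 * Q\<^sup>2 / \<delta>"
        using \<delta> gnorm_drift_le[OF K] by (intro frac_le mult_left_mono power_mono) auto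
      also have "h\<^sup>2 * Q\<^sup>2 / \<delta> = h * (h * Q\<^sup>2 / \<delta>)" by (simp add: power2_eq_square)
      also have "?q * ?r = ?r + lam ?z * ?x" by (simp add: lam_def algebra_simps)
      finally have "gnorm G (?q *\<^sub>R ?z + h *\<^sub>R (b x - b y)) + h * rho h a \<le> ?r + lam ?z * ?x + h * (beta x y + eta \<delta> h a)"
        by (simp add: eta_def algebra_simps)
      then show "\<bar>?x\<bar> \<le> a \<and> step_dist h a e x y w \<le> ?r + lam ?z * ?x + h * (beta x y + eta \<delta> h a)"
        using elim g wh unfolding eq by auto
    qed
  qed
qed

lemma f_step_bad:
  assumes h: "h \<ge> 0" and K: "norm x \<le> K" "norm y \<le> K"
  shows "AE w in P. \<not> good h a w \<longrightarrow> f (step_dist h a e x y w) \<le> Dr"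
  using step_dist_synchronous[OF h, of e a x y]
proof eventually_elim
  case (elim w)
  then show ?case
    using f_le[of "step_dist h a e x y w"] dist_le_Dr[OF K] by auto
qed

lemma Dr_nonneg: "norm (x :: real ^ 'n) \<le> K \<Longrightarrow> norm (y :: real ^ 'n) \<le> K \<Longrightarrow> Dr \<ge> 0"
  using dist_le_Dr[of x y] R0_nonneg by simp

text \<open>The price of the bad event. For fixed \<open>a\<close> it is of order
  \<open>h\<^sup>2\<close>, hence negligible against \<open>h\<close> even after summation over all
  steps.\<close>

definition "pe h a = 2 * (cbad * h\<^sup>2 / a ^ 4) + 3 * h\<^sup>2"

lemma not_good_indicator: "w \<in> space P \<Longrightarrow> indicator (bad h a) w = (if good h a w then 0 else 1 :: real)"
  by (simp add: bad_def indicator_def)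

text \<open>No contraction is claimed near the diagonal. The cost is at most \<delta> there, so the
  missing decrease \<open>rate_c * h * f r\<close> is charged to the error.\<close>

lemma expectation_near:
  assumes h: "0 < h" and a: "0 < a" and K: "norm x \<le> K" "norm y \<le> K"
    and small: "h * C + As * a \<le> 1" "h * rate_c \<le> 1" and \<delta>: "0 < \<delta>" "gnorm G (x - y) \<le> \<delta>"
  shows "(\<integral>\<^sup>+w. ennreal (f (step_dist h a 0 x y w)) \<partial>P) \<le>
     ennreal ((1 - rate_c * h) * f (gnorm G (x - y)) + h * (Cg * L * \<delta> / cg + rho h a + rate_c * \<delta>) + Dr * pe h a)"
  unfolding pe_def
proof (rule constant_expectation_bound[OF h a Dr_nonneg[OF K]])
  let ?r = "gnorm G (x - y)"
  let ?u = "(1 - rate_c * h) * f ?r + h * (Cg * L * \<delta> / cg + rho h a + rate_c * \<delta>)"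
  have f0: "f ?r \<ge> 0" "f ?r \<le> \<delta>" using f_le[of ?r] \<delta> by (auto intro: f_nonneg)
  have nn: "Cg * L * \<delta> / cg + rho h a + rate_c * \<delta> \<ge> 0"
    using Cg L cg \<delta> rho_nonneg[of h a] h a rate_c_pos by (intro add_nonneg_nonneg) auto
  show u0: "0 \<le> ?u"
  proof (rule add_nonneg_nonneg)
    show "0 \<le> (1 - rate_c * h) * f ?r" using small(2) f0(1) by (simp add: mult.commute)
    show "0 \<le> h * (Cg * L * \<delta> / cg + rho h a + rate_c * \<delta>)" by (rule mult_nonneg_nonneg[OF less_imp_le[OF h] nn])
  qed
  show "AE w in P. f (step_dist h a 0 x y w) \<le> ?u + indicator (bad h a) w * Dr"
    using step_near[OF h a K small(1) \<delta>(2)] f_step_bad[OF less_imp_le[OF h] K, of a 0] AE_space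
  proof eventually_elim
    case (elim w)
    show ?case
    proof (cases "good h a w")
      case True
      let ?d = "h * (Cg * L * \<delta> / cg + rho h a)"
      have d: "?d \<ge> 0" using Cg L cg \<delta> rho_nonneg[of h a] h a by simp
      have "f (step_dist h a 0 x y w) \<le> f (?r + ?d)" using elim(1) True by (intro f_mono) auto
      also have "\<dots> \<le> f ?r + ?d" using f_Lipschitz[of ?r "?r + ?d"] d by simp
      also have "f ?r + ?d \<le> ?u"
        using mult_left_mono[OF f0(2), of "rate_c * h"] rate_c_pos h by (simp add: algebra_simps)
      finally show ?thesis using True elim(3) by (simp add: not_good_indicator)
    next
      case False
      then show ?thesis using elim u0 by (simp add: not_good_indicator)
    qed
  qed
qed

text \<open>The tangent bound replaces the Taylor expansion: without reflection no second-order term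
  is needed, and the kink of \<open>f'\<close> at \<open>R_1\<close> is harmless.\<close>

lemma expectation_far:
  assumes h: "0 < h" and a: "0 < a" and K: "norm x \<le> K" "norm y \<le> K"
    and small: "h * C + As * a \<le> 1" "h * rate_c \<le> 1" and \<delta>: "0 < \<delta>" "\<delta> \<le> gnorm G (x - y)"
    and gen: "- 1/4 * gnorm G (x - y) * \<kappa> (gnorm G (x - y)) * f' (gnorm G (x - y)) \<le> - f (gnorm G (x - y)) / (2 * I1) + e1"
    and e1: "e1 \<ge> 0"
  shows "(\<integral>\<^sup>+w. ennreal (f (step_dist h a 0 x y w)) \<partial>P) \<le>
     ennreal ((1 - rate_c * h) * f (gnorm G (x - y)) + h * (\<Lambda>\<^sup>2 / 2 * e1 + eta \<delta> h a) + Dr * pe h a)"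
  unfolding pe_def
proof (rule constant_expectation_bound[OF h a Dr_nonneg[OF K]])
  let ?r = "gnorm G (x - y)"
  let ?u = "(1 - rate_c * h) * f ?r + h * (\<Lambda>\<^sup>2 / 2 * e1 + eta \<delta> h a)"
  have xy: "x \<noteq> y" "x - y \<noteq> 0" using \<delta> by auto
  have r: "?r > 0" using \<delta> by simp
  have f0: "f ?r \<ge> 0" by (auto intro: f_nonneg)
  have et: "eta \<delta> h a \<ge> 0" using eta_nonneg h a \<delta> by simp
  show u0: "0 \<le> ?u"
  proof (rule add_nonneg_nonneg)
    show "0 \<le> (1 - rate_c * h) * f ?r" using small(2) f0(1) by (simp add: mult.commute)
    show "0 \<le> h * (\<Lambda>\<^sup>2 / 2 * e1 + eta \<delta> h a)"
      using h et e1 by (intro mult_nonneg_nonneg add_nonneg_nonneg) auto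
  qed
  have drift: "f' ?r * beta x y \<le> - rate_c * f ?r + \<Lambda>\<^sup>2 / 2 * e1"
  proof -
    let ?l = "(lam (x - y))\<^sup>2 / 2"
    have "f' ?r * beta x y \<le> f' ?r * (- ?l * (1/4 * ?r * \<kappa> ?r))"
      using beta_le[OF xy(1)] f'_pos[of ?r] by (intro mult_left_mono) auto
    also have "\<dots> = ?l * (- 1/4 * ?r * \<kappa> ?r * f' ?r)" by simp
    also have "\<dots> \<le> ?l * (- f ?r / (2 * I1) + e1)" using gen by (intro mult_left_mono) auto
    also have "\<dots> = - (?l * (f ?r / (2 * I1))) + ?l * e1" by (simp add: algebra_simps)
    also have "\<dots> \<le> - (rate_c * f ?r) + \<Lambda>\<^sup>2 / 2 * e1"
      using lam_rate[OF xy(2) f0] lam_bounds[OF xy(2)] e1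
      by (intro add_mono mult_right_mono divide_right_mono power_mono) auto
    finally show ?thesis by simp
  qed
  show "AE w in P. f (step_dist h a 0 x y w) \<le> ?u + indicator (bad h a) w * Dr"
    using step_sync[OF h a K small(1) \<delta>] f_step_bad[OF less_imp_le[OF h] K, of a 0] AE_space
  proof eventually_elim
    case (elim w)
    show ?case
    proof (cases "good h a w")
      case True
      let ?d = "h * (beta x y + eta \<delta> h a)"
      have sd: "step_dist h a 0 x y w \<le> ?r + ?d" using elim(1) True by blast
      then have "?r + ?d \<ge> 0" using step_dist_nonneg order_trans by blast
      have "f (step_dist h a 0 x y w) \<le> f (?r + ?d)" using sd by (intro f_mono) auto
      also have "\<dots> \<le> f ?r + f' ?r * ?d" using f_tangent[OF r \<open>?r + ?d \<ge> 0\<close>] by simp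
      also have "f' ?r * ?d = h * (f' ?r * beta x y + f' ?r * eta \<delta> h a)" by (simp add: algebra_simps)
      also have "\<dots> \<le> h * ((- rate_c * f ?r + \<Lambda>\<^sup>2 / 2 * e1) + 1 * eta \<delta> h a)"
        using h drift f'_le_1[of ?r] et by (intro mult_left_mono add_mono mult_right_mono) auto
      also have "f ?r + \<dots> = ?u" by (simp add: algebra_simps)
      finally show ?thesis using True elim(3) by (simp add: not_good_indicator)
    next
      case False
      then show ?thesis using elim u0 by (simp add: not_good_indicator)
    qed
  qed
qed

text \<open>The only regime that needs second-order terms: the expected square of the Gaussian
  variable brings in \<open>f''\<close>, whose negative part pays for an expanding drift.
  \<open>D\<close> collects the constants that dominate cost and polynomial on the bad
  event.\<close>

lemma expectation_refl:
  assumes h: "0 < h" "h \<le> 1" and a: "0 < a" and K: "norm x \<le> K" "norm y \<le> K"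
    and small: "h * C + As * a \<le> 1" and \<delta>: "0 < \<delta>" "\<delta> \<le> gnorm G (x - y)" "gnorm G (x - y) \<le> R"
    and as: "4 * a \<le> s1 * \<delta>"
    and Taylor: "\<And>r s. \<delta> \<le> r \<Longrightarrow> r \<le> R \<Longrightarrow> \<bar>s\<bar> \<le> s0 \<Longrightarrow> f (r + s) \<le> f r + f' r * s + (f'' r + e2) / 2 * s\<^sup>2"
    and e2: "0 \<le> e2" "e2 \<le> 1"
    and f2: "\<And>r. \<delta> \<le> r \<Longrightarrow> r \<le> R \<Longrightarrow> \<bar>f'' r\<bar> \<le> D2"
    and s0: "\<Lambda> * a + h * (Q + eta \<delta> h a) \<le> s0" and eta1: "eta \<delta> h a \<le> 1"
  defines "D \<equiv> 2 * Dr + (Q + 1) + (D2 + 1) * (Q + 1)\<^sup>2 + (\<Lambda> + (D2 + 1) * \<Lambda> * (Q + 1)) + (D2 + 1) * \<Lambda>\<^sup>2"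
  shows "(\<integral>\<^sup>+w. ennreal (f (step_dist h a (dirn \<delta> R x y) x y w)) \<partial>P) \<le>
     ennreal ((1 - rate_c * h) * f (gnorm G (x - y)) + h * (\<Lambda>\<^sup>2 / 2 * e2 + eta \<delta> h a + h * (D2 + 1) * (Q + 1)\<^sup>2) + D * pe h a)"
proof -
  let ?r = "gnorm G (x - y)" and ?e = "dirn \<delta> R x y" and ?l = "lam (x - y)"
  let ?q = "beta x y + eta \<delta> h a" and ?F = "f'' (gnorm G (x - y)) + e2"
  \<comment> \<open>The Taylor polynomial, expanded in powers of the Gaussian variable after
    inserting its multiple by \<open>lam\<close> plus \<open>h\<close> times the drift.\<close>
  define u0 where "u0 = f ?r + f' ?r * (h * ?q) + ?F / 2 * (h * ?q)\<^sup>2"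
  define u1 where "u1 = f' ?r * ?l + ?F * ?l * (h * ?q)"
  define u2 where "u2 = ?F / 2 * ?l\<^sup>2"
  have xy: "x \<noteq> y" "x - y \<noteq> 0" using \<delta> by auto
  have r: "?r > 0" using \<delta> by simp
  have f0: "f ?r \<ge> 0" by (auto intro: f_nonneg)
  have fD: "f ?r \<le> Dr" using f_le[of ?r] dist_le_Dr[OF K] by simp
  have Dr: "Dr \<ge> 0" using Dr_nonneg[OF K] .
  have et: "eta \<delta> h a \<ge> 0" using eta_nonneg h a \<delta> by simp
  have lb: "0 < ?l" "?l \<le> \<Lambda>" using lam_bounds[OF xy(2)] by auto
  have qb: "\<bar>?q\<bar> \<le> Q + eta \<delta> h a" "\<bar>?q\<bar> \<le> Q + 1" using beta_bound[OF K xy(1)] et eta1 by linarith+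
  have hq: "\<bar>h * ?q\<bar> \<le> Q + 1"
    using mult_mono[OF h(2) qb(2)] h by (simp add: abs_mult)
  have D2: "D2 \<ge> 0" using f2[OF \<delta>(2,3)] by linarith
  have Fb: "\<bar>?F\<bar> \<le> D2 + 1" using f2[OF \<delta>(2,3)] e2 by linarith
  have f'b: "0 \<le> f' ?r" "f' ?r \<le> 1" using f'_pos[of ?r] f'_le_1[of ?r] by auto
  note ne = step_refl(1)[OF h(1) a K small \<delta> as]
  have a0: "\<bar>u0\<bar> \<le> Dr + (Q + 1) + (D2 + 1) * (Q + 1)\<^sup>2"
  proof -
    have "\<bar>f' ?r * (h * ?q)\<bar> \<le> 1 * (Q + 1)"
      unfolding abs_mult[of "f' ?r"] using f'b hq by (intro mult_mono) auto
    moreover have "\<bar>?F / 2 * (h * ?q)\<^sup>2\<bar> \<le> (D2 + 1) * (Q + 1)\<^sup>2"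
    proof -
      have "(h * ?q)\<^sup>2 \<le> (Q + 1)\<^sup>2" using hq Q_nonneg by (simp add: abs_le_square_iff[symmetric])
      then show ?thesis unfolding abs_mult using Fb D2 by (intro mult_mono) auto
    qed
    moreover have "\<bar>f ?r\<bar> \<le> Dr" using f0 fD by simp
    ultimately have "\<bar>u0\<bar> \<le> Dr + 1 * (Q + 1) + (D2 + 1) * (Q + 1)\<^sup>2"
      unfolding u0_def by (intro abs_add3_le)
    then show ?thesis by simp
  qed
  have a1: "\<bar>u1\<bar> \<le> \<Lambda> + (D2 + 1) * \<Lambda> * (Q + 1)"
  proof -
    have "\<bar>f' ?r * ?l\<bar> \<le> 1 * \<Lambda>" unfolding abs_mult using f'b lb by (intro mult_mono) auto
    moreover have "\<bar>?F * ?l * (h * ?q)\<bar> \<le> (D2 + 1) * \<Lambda> * (Q + 1)"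
      unfolding abs_mult[of "?F * ?l"] abs_mult[of ?F] using Fb lb hq D2 Lambda_pos by (intro mult_mono) auto
    ultimately show ?thesis unfolding u1_def by linarith
  qed
  have a2: "\<bar>u2\<bar> \<le> (D2 + 1) * \<Lambda>\<^sup>2"
    unfolding u2_def abs_mult using Fb lb D2 by (intro mult_mono) (auto intro: power_mono)
  \<comment> \<open>Regrouped into the shape required by \<open>quadratic_domination\<close>: the
    bound for the cost followed by those for the three coefficients.\<close>
  have Deq: "D = Dr + (Dr + (Q + 1) + (D2 + 1) * (Q + 1)\<^sup>2) + (\<Lambda> + (D2 + 1) * \<Lambda> * (Q + 1)) + (D2 + 1) * \<Lambda>\<^sup>2"
    by (simp add: D_def)
  have D0: "D \<ge> 0" using a0 a1 a2 Dr unfolding D_def by linarith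
  have "(\<integral>\<^sup>+w. ennreal (f (step_dist h a ?e x y w)) \<partial>P) \<le> ennreal (u0 + u2 * h + D * (2 * (cbad * h\<^sup>2 / a ^ 4) + 3 * h\<^sup>2))"
  proof (rule quadratic_expectation_bound[OF h(1) a D0 _ _ ne])
    show "f (step_dist h a ?e x y w) \<ge> 0" for w by (simp add: f_nonneg)
    show "AE w in P. f (step_dist h a ?e x y w) \<le> u0 + u1 * (?e \<bullet> w h) + u2 * (?e \<bullet> w h)\<^sup>2
        + indicator (bad h a) w * (D * (1 + (?e \<bullet> w h)\<^sup>2))"
      using step_refl(2)[OF h(1) a K small \<delta> as] f_step_bad[OF less_imp_le[OF h(1)] K, of a ?e] AE_space
    proof eventually_elim
      case (elim w)
      let ?x = "?e \<bullet> w h"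
      show ?case
      proof (cases "good h a w")
        case True
        let ?s = "?l * ?x + h * ?q"
        have x: "\<bar>?x\<bar> \<le> a" and sd: "step_dist h a ?e x y w \<le> ?r + ?s" using elim(1) True by auto
        have "\<bar>?l * ?x\<bar> \<le> \<Lambda> * a" unfolding abs_mult using lb x by (intro mult_mono) auto
        moreover have "\<bar>h * ?q\<bar> \<le> h * (Q + eta \<delta> h a)" unfolding abs_mult using h qb by (simp add: mult_left_mono)
        ultimately have "\<bar>?s\<bar> \<le> s0" using s0 by linarith
        have "f (step_dist h a ?e x y w) \<le> f (?r + ?s)" using sd by (intro f_mono) auto
        also have "\<dots> \<le> f ?r + f' ?r * ?s + ?F / 2 * ?s\<^sup>2" by (rule Taylor[OF \<delta>(2,3) \<open>\<bar>?s\<bar> \<le> s0\<close>])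
        also have "\<dots> = u0 + u1 * ?x + u2 * ?x\<^sup>2"
          by (simp add: u0_def u1_def u2_def power2_sum power_mult_distrib algebra_simps add_divide_distrib)
        finally show ?thesis using True elim(3) by (simp add: not_good_indicator)
      next
        case False
        have "f (step_dist h a ?e x y w) \<le> Dr" using elim False by blast
        from quadratic_domination[OF this a0 a1 a2 Dr]
        have "f (step_dist h a ?e x y w) \<le> u0 + u1 * ?x + u2 * ?x\<^sup>2 + D * (1 + ?x\<^sup>2)"
          unfolding Deq .
        then show ?thesis using False elim(3) by (simp add: not_good_indicator)
      qed
    qed
  qed
  also have "\<dots> \<le> ennreal ((1 - rate_c * h) * f ?r + h * (\<Lambda>\<^sup>2 / 2 * e2 + eta \<delta> h a + h * (D2 + 1) * (Q + 1)\<^sup>2) + D * pe h a)"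
  proof (rule ennreal_leI)
    let ?l2 = "?l\<^sup>2 / 2"
    \<comment> \<open>Drift and diffusion terms share the factor \<open>?l2\<close>, so the
      one-dimensional differential inequality applies although the diffusion coefficient depends on
      x - y.\<close>
    have main: "f' ?r * beta x y + f'' ?r * ?l2 \<le> - rate_c * f ?r"
    proof -
      have "f' ?r * beta x y \<le> f' ?r * (- ?l2 * (1/4 * ?r * \<kappa> ?r))"
        using beta_le[OF xy(1)] f'b by (intro mult_left_mono) auto
      then have "f' ?r * beta x y + f'' ?r * ?l2 \<le> ?l2 * (f'' ?r - 1/4 * ?r * \<kappa> ?r * f' ?r)"
        by (simp add: algebra_simps)
      also have "\<dots> \<le> ?l2 * (- f ?r / (2 * I1))" using generator_inside[OF r] by (intro mult_left_mono) auto
      also have "\<dots> \<le> - rate_c * f ?r" using lam_rate[OF xy(2) f0] by simp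
      finally show ?thesis .
    qed
    have t1: "f' ?r * eta \<delta> h a \<le> 1 * eta \<delta> h a" using f'b et by (intro mult_right_mono) auto
    have t2: "e2 * ?l2 \<le> \<Lambda>\<^sup>2 / 2 * e2"
      using lb e2 mult_left_mono[OF power_mono[OF lb(2), of 2] e2(1)] by (simp add: mult.commute)
    have t3: "?F / 2 * (h * ?q\<^sup>2) \<le> h * (D2 + 1) * (Q + 1)\<^sup>2"
    proof -
      have "?q\<^sup>2 \<le> (Q + 1)\<^sup>2" using qb(2) Q_nonneg by (simp add: abs_le_square_iff[symmetric])
      then have "?F / 2 * (h * ?q\<^sup>2) \<le> (D2 + 1) * (h * (Q + 1)\<^sup>2)"
        using Fb h D2 by (intro mult_mono mult_left_mono) auto
      then show ?thesis by (simp add: mult_ac)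
    qed
    have "u0 + u2 * h = f ?r + h * ((f' ?r * beta x y + f'' ?r * ?l2) + f' ?r * eta \<delta> h a + e2 * ?l2 + ?F / 2 * (h * ?q\<^sup>2))"
      by (simp add: u0_def u2_def algebra_simps power2_eq_square add_divide_distrib)
    also have "\<dots> \<le> f ?r + h * (- rate_c * f ?r + 1 * eta \<delta> h a + \<Lambda>\<^sup>2 / 2 * e2 + h * (D2 + 1) * (Q + 1)\<^sup>2)"
      using main t1 t2 t3 h by (intro add_left_mono mult_left_mono add_mono) auto
    also have "\<dots> = (1 - rate_c * h) * f ?r + h * (\<Lambda>\<^sup>2 / 2 * e2 + eta \<delta> h a + h * (D2 + 1) * (Q + 1)\<^sup>2)"
      by (simp add: algebra_simps)
    finally show "u0 + u2 * h + D * (2 * (cbad * h\<^sup>2 / a ^ 4) + 3 * h\<^sup>2) \<le>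
       (1 - rate_c * h) * f ?r + h * (\<Lambda>\<^sup>2 / 2 * e2 + eta \<delta> h a + h * (D2 + 1) * (Q + 1)\<^sup>2) + D * pe h a"
      by (simp add: pe_def)
  qed
  finally show ?thesis .
qed

end

lemma eventually_at_right_mult_le:
  fixes u v :: real
  assumes "v > 0" shows "\<forall>\<^sub>F h in at_right 0. h * u \<le> v"
proof -
  have "((\<lambda>h. h * u) \<longlongrightarrow> 0 * u) (at_right 0)" by (intro tendsto_intros)
  then have "\<forall>\<^sub>F h in at_right 0. h * u < v" using assms by (intro order_tendstoD) auto
  then show ?thesis by (rule eventually_mono) simp
qed

text \<open>Reflection starts only from distances up to \<open>R\<close>, and on a good path one
  step adds at most \<open>R_1 - R\<close>; in all other cases the step is synchronous. The bound
  can be iterated without growing.\<close>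

lemma (in local_bounds) step_range:
  assumes h: "0 < h" and a: "0 < a" and K: "norm x \<le> K" "norm y \<le> K"
    and small: "h * C + As * a \<le> 1" and \<delta>: "0 < \<delta>"
    and as: "4 * a \<le> s1 * \<delta>"
    and s0: "\<Lambda> * a + h * (Q + eta \<delta> h a) \<le> R_1 - R"
  shows "AE w in P. step_dist h a (dirn \<delta> R x y) x y w \<le> max (gnorm G (x - y)) R_1"
proof (cases "\<delta> \<le> gnorm G (x - y) \<and> gnorm G (x - y) \<le> R")
  case True
  then have \<delta>R: "\<delta> \<le> gnorm G (x - y)" "gnorm G (x - y) \<le> R" by auto
  have xy: "x \<noteq> y" "x - y \<noteq> 0" using \<delta> \<delta>R by auto
  show ?thesis
    using step_refl(2)[OF h a K small \<delta> \<delta>R as] step_dist_synchronous[OF less_imp_le[OF h], of "dirn \<delta> R x y" a x y]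
  proof eventually_elim
    case (elim w)
    show ?case
    proof (cases "good h a w")
      case True
      let ?x = "dirn \<delta> R x y \<bullet> w h"
      have x: "\<bar>?x\<bar> \<le> a" and sd: "step_dist h a (dirn \<delta> R x y) x y w \<le> gnorm G (x - y) + lam (x - y) * ?x + h * (beta x y + eta \<delta> h a)"
        using elim True by auto
      have "\<bar>lam (x - y) * ?x\<bar> \<le> \<Lambda> * a"
        unfolding abs_mult using lam_bounds[OF xy(2)] x by (intro mult_mono) auto
      moreover have "h * (beta x y + eta \<delta> h a) \<le> h * (Q + eta \<delta> h a)"
        using beta_bound[OF K xy(1)] h by (intro mult_left_mono) auto
      ultimately have "step_dist h a (dirn \<delta> R x y) x y w \<le> R_1" using sd s0 \<delta>R by linarith
      then show ?thesis by simp
    next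
      case False
      then show ?thesis using elim(2) R1_ge_R0 by auto
    qed
  qed
next
  case False
  then have "dirn \<delta> R x y = 0" by (auto simp: dirn_def)
  then show ?thesis
    using step_dist_synchronous[OF less_imp_le[OF h], of "dirn \<delta> R x y" a x y] R1_ge_R0
    by (auto elim!: eventually_mono)
qed

text \<open>The error is proportional to \<open>h\<close>, so \<open>t / h\<close> steps accumulate
  at most \<open>\<epsilon> * t\<close>. The bound is confined to the ball of radius
  \<open>k\<close>, where the drift is under control.\<close>

definition (in diffusion) "contracting_step k \<epsilon> h a \<delta> R \<longleftrightarrow> (\<forall>x y. norm x \<le> k \<longrightarrow> norm y \<le> k \<longrightarrow>
     (\<integral>\<^sup>+w. ennreal (f (step_dist h a (dirn \<delta> R x y) x y w)) \<partial>P) \<le> ennreal (exp (- rate_c * h) * f (gnorm G (x - y)) + \<epsilon> * h) \<and>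
     (AE w in P. step_dist h a (dirn \<delta> R x y) x y w \<le> max (gnorm G (x - y)) R_1))"

text \<open>The order of choices matters: \<epsilon> fixes the losses \<open>e1\<close> and
  \<open>e2\<close>, then \<open>R\<close> and \<delta>, then the Taylor radius and the bound on
  \<open>f''\<close>, then \<open>a\<close>, and only then \<open>h\<close>. Each regime may spend
  \<open>3 * \<epsilon> / 4\<close> on drift, Taylor and Euler errors and
  \<open>\<epsilon> / 4\<close> on the bad event.\<close>

lemma (in local_bounds) one_step_local:
  assumes \<epsilon>: "\<epsilon> > 0"
  shows "\<exists>R \<delta> a h0. \<delta> > 0 \<and> h0 > 0 \<and> (\<forall>h. 0 < h \<longrightarrow> h < h0 \<longrightarrow> contracting_step K \<epsilon> h a \<delta> R)"
proof -
  have cancel: "u * (\<epsilon> / (4 * u)) = \<epsilon> / 4" if "u > 0" for u :: real using that by simp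
  define e1 where "e1 = \<epsilon> / (4 * (\<Lambda>\<^sup>2 + 1))"
  define e2 where "e2 = min 1 e1"
  have e1: "e1 > 0" using \<epsilon> by (simp add: e1_def add_nonneg_pos)
  have e2: "0 < e2" "e2 \<le> 1" "e2 \<le> e1" using e1 by (auto simp: e2_def)
  have Le1: "\<Lambda>\<^sup>2 / 2 * e1 \<le> \<epsilon> / 4"
  proof -
    have "\<Lambda>\<^sup>2 / 2 * e1 \<le> (\<Lambda>\<^sup>2 + 1) * e1" using e1 by (intro mult_right_mono) auto
    also have "\<dots> = \<epsilon> / 4"
    proof -
      have "\<Lambda>\<^sup>2 + 1 > 0" by (intro add_nonneg_pos) auto
      then show ?thesis unfolding e1_def by (rule cancel)
    qed
    finally show ?thesis .
  qed
  have Le2: "\<Lambda>\<^sup>2 / 2 * e2 \<le> \<epsilon> / 4" by (rule order_trans[OF mult_left_mono[OF e2(3)] Le1]) simp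
  obtain R where R: "R_0 < R" "0 < R" "R < R_1" "\<And>r. r \<ge> R \<Longrightarrow> - 1/4 * r * \<kappa> r * f' r \<le> - f r / (2 * I1) + e1"
    using generator_near_R1[OF e1] by blast
  define \<delta> where "\<delta> = \<epsilon> / (4 * (Cg * L / cg + rate_c + 1))"
  have dn: "Cg * L / cg + rate_c + 1 > 0" using Cg L cg rate_c_pos by (intro add_nonneg_pos add_nonneg_nonneg) auto
  have \<delta>: "\<delta> > 0" using \<epsilon> dn by (simp add: \<delta>_def)
  have \<delta>e: "Cg * L * \<delta> / cg + rate_c * \<delta> \<le> \<epsilon> / 4"
  proof -
    have "Cg * L * \<delta> / cg + rate_c * \<delta> \<le> (Cg * L / cg + rate_c + 1) * \<delta>" using \<delta> by (simp add: algebra_simps)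
    also have "\<dots> = \<epsilon> / 4" unfolding \<delta>_def by (rule cancel[OF dn])
    finally show ?thesis .
  qed
  obtain s0 where s0: "s0 > 0" "\<And>r s. \<delta> \<le> r \<Longrightarrow> r \<le> R \<Longrightarrow> \<bar>s\<bar> \<le> s0 \<Longrightarrow>
     f (r + s) \<le> f r + f' r * s + (f'' r + e2) / 2 * s\<^sup>2"
    using f_Taylor[OF \<delta> R(3) e2(1)] by blast
  obtain D2 where D2: "\<And>r. \<delta> \<le> r \<Longrightarrow> r \<le> R \<Longrightarrow> \<bar>f'' r\<bar> \<le> D2"
  proof -
    have "bounded (f'' ` {\<delta>..R})"
      by (intro compact_imp_bounded compact_continuous_image continuous_on_subset[OF f''_continuous]) (use \<delta> in auto)
    then obtain D2 where "\<forall>v\<in>f'' ` {\<delta>..R}. norm v \<le> D2" by (auto simp: bounded_iff)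
    then show ?thesis using that[of D2] by auto
  qed
  \<comment> \<open>Largest displacement for which both the Taylor bound and the distance bound
    \<open>R_1\<close> are guaranteed.\<close>
  define s where "s = min s0 (R_1 - R)"
  have s: "s > 0" "s \<le> s0" "s \<le> R_1 - R" using s0 R by (auto simp: s_def)
  \<comment> \<open>The four caps serve, in order: confinement of the Euler scheme to the larger
    ball, displacement by at most \<open>s\<close>, smallness of \<open>eta\<close>, and the lower
    bound 1/2 on the rescaling factor. The first three leave the other half to terms with
    \<open>h\<close>.\<close>
  define v where "v = min (1/2) (min (s / 2) (min (\<epsilon> / 8) (s1 * \<delta>)))"
  have v: "v > 0" "v \<le> 1/2" "v \<le> s/2" "v \<le> \<epsilon> / 8" "v \<le> s1 * \<delta>" using s \<epsilon> s1 \<delta> by (auto simp: v_def)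
  \<comment> \<open>The sum of all coefficients of \<open>a\<close> that occur, so that
    \<open>w * a = v\<close> bounds each product by \<open>v\<close>.\<close>
  define w where "w = As + \<Lambda> + 2 * Cg * L * As + 4"
  have nn: "As \<ge> 0" "\<Lambda> \<ge> 0" "2 * Cg * L * As \<ge> 0" using As_nonneg Lambda_pos Cg L by auto
  have wp: "w > 0" using nn by (simp add: w_def)
  define a where "a = v / w"
  have a: "a > 0" using v wp by (simp add: a_def)
  have wa: "w * a = v" using wp by (simp add: a_def)
  have ab: "As * a \<le> v" "\<Lambda> * a \<le> v" "2 * Cg * L * As * a \<le> v" "4 * a \<le> v"
  proof -
    have m: "u * a \<le> v" if "u \<le> w" for u using mult_right_mono[OF that less_imp_le[OF a]] wa by simp
    show "As * a \<le> v" "\<Lambda> * a \<le> v" "2 * Cg * L * As * a \<le> v" "4 * a \<le> v"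
      using nn by (auto intro!: m simp: w_def)
  qed
  define D where "D = 2 * Dr + (Q + 1) + (D2 + 1) * (Q + 1)\<^sup>2 + (\<Lambda> + (D2 + 1) * \<Lambda> * (Q + 1)) + (D2 + 1) * \<Lambda>\<^sup>2"
  \<comment> \<open>One nonnegative constant in front of the bad event for all three
    regimes.\<close>
  define Dm where "Dm = max D (max Dr 0)"
  let ?p = "2 * cbad / a ^ 4 + 3"
  have "\<forall>\<^sub>F h in at_right 0. (0::real) < h \<and> h * 1 \<le> 1 \<and> h * C \<le> 1/2 \<and> h * rate_c \<le> 1
      \<and> h * (Q\<^sup>2 / \<delta> + 2 * Cg * L * C) \<le> min (1/2) (\<epsilon> / 8) \<and> h * (Q + 1) \<le> s / 2 \<and> h * ((D2 + 1) * (Q + 1)\<^sup>2) \<le> \<epsilon> / 4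
      \<and> h * (Dm * ?p) \<le> \<epsilon> / 4"
    using s(1) \<epsilon> by (intro eventually_conj eventually_at_right_mult_le eventually_at_right_less; simp)
  then obtain h0 where h0: "h0 > 0" and hb: "\<And>h. 0 < h \<Longrightarrow> h < h0 \<Longrightarrow> h \<le> 1 \<and> h * C \<le> 1/2 \<and> h * rate_c \<le> 1
      \<and> h * (Q\<^sup>2 / \<delta> + 2 * Cg * L * C) \<le> min (1/2) (\<epsilon> / 8) \<and> h * (Q + 1) \<le> s / 2 \<and> h * ((D2 + 1) * (Q + 1)\<^sup>2) \<le> \<epsilon> / 4
      \<and> h * (Dm * ?p) \<le> \<epsilon> / 4"
    unfolding eventually_at_right_field by auto
  have main: "(\<integral>\<^sup>+w. ennreal (f (step_dist h a (dirn \<delta> R x y) x y w)) \<partial>P) \<le> ennreal (exp (- rate_c * h) * f (gnorm G (x - y)) + \<epsilon> * h) \<and>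
     (AE w in P. step_dist h a (dirn \<delta> R x y) x y w \<le> max (gnorm G (x - y)) R_1)"
    if h: "0 < h" "h < h0" and K: "norm x \<le> K" "norm y \<le> K" for h x y
  proof -
    let ?r = "gnorm G (x - y)"
    note hb = hb[OF h]
    have h1: "h \<le> 1" "h * C \<le> 1/2" "h * rate_c \<le> 1" "h * (Q + 1) \<le> s / 2" "h * ((D2 + 1) * (Q + 1)\<^sup>2) \<le> \<epsilon> / 4"
      "h * (Dm * ?p) \<le> \<epsilon> / 4"
      using hb by auto
    have small: "h * C + As * a \<le> 1" using h1(2) ab(1) v(2) by linarith
    have et: "eta \<delta> h a = h * (Q\<^sup>2 / \<delta> + 2 * Cg * L * C) + 2 * Cg * L * As * a"
      by (simp add: eta_def rho_def distrib_left mult_ac)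
    have et1: "eta \<delta> h a \<le> 1" "eta \<delta> h a \<le> \<epsilon> / 4" using hb ab(3) v unfolding et by linarith+
    have "rho h a \<le> eta \<delta> h a" unfolding eta_def using h \<delta> by simp
    then have rh: "rho h a \<le> \<epsilon> / 4" using et1 by simp
    have "h * (Q + eta \<delta> h a) \<le> h * (Q + 1)" using et1 h by (intro mult_left_mono) auto
    then have sb: "\<Lambda> * a + h * (Q + eta \<delta> h a) \<le> s" using ab(2) v(3) h1(4) by linarith
    have as: "4 * a \<le> s1 * \<delta>" using ab(4) v(5) by linarith
    have pe: "D' * pe h a \<le> h * (\<epsilon> / 4)" if "D' \<le> Dm" for D'
    proof -
      have "pe h a = h\<^sup>2 * ?p" by (simp add: pe_def algebra_simps)
      moreover have "?p \<ge> 0" using a by (simp add: cbad_def)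
      ultimately have "D' * pe h a \<le> Dm * (h\<^sup>2 * ?p)" using that by (intro mult_mono) (auto simp: Dm_def)
      also have "\<dots> = h * (h * (Dm * ?p))" by (simp add: power2_eq_square)
      also have "\<dots> \<le> h * (\<epsilon> / 4)" using h1(6) h by (intro mult_left_mono) auto
      finally show ?thesis .
    qed
    \<comment> \<open>The linear decay is replaced by the larger exponential, because exponentials
      multiply exactly over the steps.\<close>
    have wrap: "ennreal ((1 - rate_c * h) * f ?r + h * E + D' * pe h a) \<le> ennreal (exp (- rate_c * h) * f ?r + \<epsilon> * h)"
      if E: "E \<le> 3 * \<epsilon> / 4" and D': "D' \<le> Dm" for E D'
    proof (rule ennreal_leI)
      have "(1 - rate_c * h) * f ?r \<le> exp (- rate_c * h) * f ?r"
        using exp_ge_add_one_self[of "- rate_c * h"] by (intro mult_right_mono f_nonneg) auto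
      moreover have "h * E \<le> h * (3 * \<epsilon> / 4)" using E h by (intro mult_left_mono) auto
      ultimately have "(1 - rate_c * h) * f ?r + h * E + D' * pe h a \<le> exp (- rate_c * h) * f ?r + (h * (3 * \<epsilon> / 4) + h * (\<epsilon> / 4))"
        using pe[OF D'] by linarith
      also have "h * (3 * \<epsilon> / 4) + h * (\<epsilon> / 4) = \<epsilon> * h" by (simp add: algebra_simps)
      finally show "(1 - rate_c * h) * f ?r + h * E + D' * pe h a \<le> exp (- rate_c * h) * f ?r + \<epsilon> * h" .
    qed
    have Dm: "Dr \<le> Dm" "D \<le> Dm" by (auto simp: Dm_def)
    have E1: "Cg * L * \<delta> / cg + rho h a + rate_c * \<delta> \<le> 3 * \<epsilon> / 4" using \<delta>e rh \<epsilon> by linarith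
    have E2: "\<Lambda>\<^sup>2 / 2 * e2 + eta \<delta> h a + h * (D2 + 1) * (Q + 1)\<^sup>2 \<le> 3 * \<epsilon> / 4"
      using add_mono[OF add_mono[OF Le2 et1(2)] h1(5)] by (simp add: mult.assoc)
    have E3: "\<Lambda>\<^sup>2 / 2 * e1 + eta \<delta> h a \<le> 3 * \<epsilon> / 4" using add_mono[OF Le1 et1(2)] \<epsilon> by linarith
    have "AE w in P. step_dist h a (dirn \<delta> R x y) x y w \<le> max ?r R_1"
      using sb s by (intro step_range[OF h(1) a K small \<delta> as]) auto
    moreover have "(\<integral>\<^sup>+w. ennreal (f (step_dist h a (dirn \<delta> R x y) x y w)) \<partial>P) \<le> ennreal (exp (- rate_c * h) * f ?r + \<epsilon> * h)"
    proof -
      consider (near) "?r < \<delta>" | (refl) "\<delta> \<le> ?r" "?r \<le> R" | (far) "\<delta> \<le> ?r" "R < ?r" by linarith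
      then show ?thesis
      proof cases
        case near
        then have "dirn \<delta> R x y = 0" by (simp add: dirn_def)
        then show ?thesis
          using order_trans[OF expectation_near[OF h(1) a K small h1(3) \<delta> less_imp_le[OF near]] wrap[OF E1 Dm(1)]] by simp
      next
        case refl
        have "(\<integral>\<^sup>+w. ennreal (f (step_dist h a (dirn \<delta> R x y) x y w)) \<partial>P) \<le>
           ennreal ((1 - rate_c * h) * f ?r + h * (\<Lambda>\<^sup>2 / 2 * e2 + eta \<delta> h a + h * (D2 + 1) * (Q + 1)\<^sup>2) + D * pe h a)"
          unfolding D_def
          by (rule expectation_refl[OF h(1) h1(1) a K small \<delta> refl as s0(2) less_imp_le[OF e2(1)] e2(2) D2 _ et1(1)])
             (use sb s in auto)
        also have "\<dots> \<le> ennreal (exp (- rate_c * h) * f ?r + \<epsilon> * h)"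
          by (rule wrap[OF E2 Dm(2)])
        finally show ?thesis .
      next
        case far
        then have "dirn \<delta> R x y = 0" by (simp add: dirn_def)
        then show ?thesis
          using order_trans[OF expectation_far[OF h(1) a K small h1(3) \<delta> far(1) R(4)[OF less_imp_le[OF far(2)]] less_imp_le[OF e1]] wrap[OF E3 Dm(1)]]
          by simp
      qed
    qed
    ultimately show ?thesis by (rule conjI[rotated])
  qed
  show ?thesis
    by (intro exI[of _ R] exI[of _ \<delta>] exI[of _ a] exI[of _ h0] conjI[OF \<delta>] conjI[OF h0] allI impI contracting_step_def[THEN iffD2] main)
qed

lemma (in diffusion) one_step:
  assumes \<epsilon>: "\<epsilon> > 0"
  shows "\<exists>R \<delta> a h0. \<delta> > 0 \<and> h0 > 0 \<and> (\<forall>h. 0 < h \<longrightarrow> h < h0 \<longrightarrow> contracting_step K \<epsilon> h a \<delta> R)"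
proof -
  obtain L where L: "L \<ge> 0" "\<And>x y. norm x \<le> K + 1 \<Longrightarrow> norm y \<le> K + 1 \<Longrightarrow> norm (b x - b y) \<le> L * norm (x - y)"
    by (rule b_Lipschitz_on_cball[of "K + 1"]) blast
  obtain C where C: "C \<ge> 0" "\<And>x. norm x \<le> K + 1 \<Longrightarrow> norm (b x) \<le> C"
    by (rule b_bounded_on_cball[of "K + 1"]) blast
  obtain cg Cg where g: "cg > 0" "Cg > 0" "\<And>z. cg * norm z \<le> gnorm G z" "\<And>z. gnorm G z \<le> Cg * norm z"
    by (rule gnorm_norm_equiv) blast
  obtain s1 where s1: "s1 > 0" "\<And>z. s1 * gnorm G z \<le> S z"
    by (rule S_gnorm_equiv) blast
  interpret local_bounds G \<sigma> b M B X K L C cg Cg s1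
    by unfold_locales (use L C g s1 in auto)
  show ?thesis by (rule one_step_local[OF \<epsilon>])
qed

section \<open>Iterating the coupling\<close>

text \<open>The steps must add up to exactly \<open>t\<close>, since the marginals of the coupling
  are needed at that time; for \<open>t = 0\<close> no step is taken.\<close>

lemma step_count:
  assumes "h0 > 0" "t \<ge> 0"
  shows "\<exists>h N. 0 < h \<and> h < h0 \<and> real N * h = t"
proof (cases "t = 0")
  case True
  then show ?thesis using assms by (intro exI[of _ "h0 / 2"] exI[of _ 0]) auto
next
  case False
  obtain N :: nat where N: "t / h0 < real N" using reals_Archimedean2 by blast
  have "t / h0 > 0" using assms False by simp
  then have Np: "real N > 0" using N by linarith
  then show ?thesis using N assms False
    by (intro exI[of _ "t / real N"] exI[of _ N]) (auto simp: field_simps)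
qed

text \<open>Division by \<open>c\<close> is legitimate because it is finite and positive; the
  infimum itself may be infinite.\<close>

lemma le_cmult_INF_ennreal:
  fixes I :: "'i \<Rightarrow> ennreal"
  assumes c: "c > 0" and le: "\<And>i. i \<in> A \<Longrightarrow> v \<le> ennreal c * I i"
  shows "v \<le> ennreal c * (INF i\<in>A. I i)"
proof -
  have one: "ennreal (1 / c) * ennreal c = 1" "ennreal c * ennreal (1 / c) = 1"
    using c by (simp_all add: ennreal_mult[symmetric])
  have "ennreal (1 / c) * v \<le> (INF i\<in>A. I i)"
  proof (rule INF_greatest)
    fix i assume "i \<in> A"
    then have "ennreal (1 / c) * v \<le> ennreal (1 / c) * (ennreal c * I i)" by (intro mult_left_mono le) auto
    also have "\<dots> = I i" by (simp only: mult.assoc[symmetric] one mult_1)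
    finally show "ennreal (1 / c) * v \<le> I i" .
  qed
  then have "ennreal c * (ennreal (1 / c) * v) \<le> ennreal c * (INF i\<in>A. I i)" by (intro mult_left_mono) auto
  then show ?thesis by (simp only: mult.assoc[symmetric] one mult_1)
qed

context diffusion
begin

section \<open>Measurable coupling kernels and the semigroup property\<close>

abbreviation "pairs \<equiv> borel \<Otimes>\<^sub>M borel :: ((real ^ 'n) \<times> (real ^ 'n)) measure"

lemma matrix_inv_measurable: "(*v) (matrix_inv \<sigma>) \<in> borel_measurable borel"
  by (intro borel_measurable_continuous_onI linear_continuous_on matrix_vector_mul_bounded_linear)

lemma dirn_measurable: "(\<lambda>q. dirn \<delta> R (fst q) (snd q)) \<in> borel_measurable pairs"
proof -
  have d: "(\<lambda>q. fst q - snd q) \<in> borel_measurable pairs"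
    by (rule borel_measurable_diff[OF measurable_fst measurable_snd])
  have g: "(\<lambda>q. gnorm G (fst q - snd q)) \<in> borel_measurable pairs"
    by (rule measurable_compose[OF d borel_measurable_gnorm])
  have m: "(\<lambda>q. matrix_inv \<sigma> *v (fst q - snd q)) \<in> borel_measurable pairs"
    by (rule measurable_compose[OF d matrix_inv_measurable])
  have "{q \<in> space pairs. \<delta> \<le> gnorm G (fst q - snd q) \<and> gnorm G (fst q - snd q) \<le> R} \<in> sets pairs"
    using g by measurable
  moreover have "(\<lambda>q. (1 / S (fst q - snd q)) *\<^sub>R (matrix_inv \<sigma> *v (fst q - snd q))) \<in> borel_measurable pairs"
    unfolding S_def by (rule borel_measurable_scaleR[OF borel_measurable_divide[OF borel_measurable_const measurable_compose[OF m borel_measurable_norm]] m])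
  ultimately show ?thesis
    unfolding dirn_def by (intro measurable_If borel_measurable_const)
qed

definition "step_pair h a \<delta> R q w = (F h (fst q) w, F h (snd q) (refl_path h a (dirn \<delta> R (fst q) (snd q)) w))"
definition "sync_pair s q w = (F s (fst q) w, F s (snd q) w)"

definition "step_kernel h a \<delta> R q = distr P pairs (step_pair h a \<delta> R q)"
definition "sync_kernel s q = distr P pairs (sync_pair s q)"

lemma F_fst_measurable:
  assumes "s \<ge> 0" "g \<in> measurable N borel" "k \<in> measurable N path_space"
  shows "(\<lambda>v. F s (g v) (k v)) \<in> borel_measurable N"
  using measurable_compose[OF measurable_Pair[OF assms(2,3)] F_measurable[OF assms(1)]] by simp

lemma step_pair_measurable:
  assumes h: "h \<ge> 0"
  shows "(\<lambda>(q, w). step_pair h a \<delta> R q w) \<in> measurable (pairs \<Otimes>\<^sub>M path_space) pairs"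
proof -
  let ?N = "pairs \<Otimes>\<^sub>M path_space :: (((real ^ 'n) \<times> (real ^ 'n)) \<times> (real \<Rightarrow> real ^ 'n)) measure"
  have x: "(\<lambda>v. fst (fst v)) \<in> borel_measurable ?N" "(\<lambda>v. snd (fst v)) \<in> borel_measurable ?N"
    by (rule measurable_compose[OF measurable_fst measurable_fst] measurable_compose[OF measurable_fst measurable_snd])+
  have d: "(\<lambda>v. dirn \<delta> R (fst (fst v)) (snd (fst v))) \<in> borel_measurable ?N"
    by (rule measurable_compose[OF measurable_fst dirn_measurable])
  have r: "(\<lambda>v. refl_path h a (dirn \<delta> R (fst (fst v)) (snd (fst v))) (snd v)) \<in> measurable ?N path_space"
    using measurable_compose[OF measurable_Pair[OF d measurable_snd] refl_path_measurable[OF h]] by simp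
  show ?thesis
    unfolding step_pair_def case_prod_beta
    by (intro measurable_Pair F_fst_measurable h x r measurable_snd)
qed

lemma sync_pair_measurable:
  assumes s: "s \<ge> 0"
  shows "(\<lambda>(q, w). sync_pair s q w) \<in> measurable (pairs \<Otimes>\<^sub>M path_space) pairs"
proof -
  let ?N = "pairs \<Otimes>\<^sub>M path_space :: (((real ^ 'n) \<times> (real ^ 'n)) \<times> (real \<Rightarrow> real ^ 'n)) measure"
  have x: "(\<lambda>v. fst (fst v)) \<in> borel_measurable ?N" "(\<lambda>v. snd (fst v)) \<in> borel_measurable ?N"
    by (rule measurable_compose[OF measurable_fst measurable_fst] measurable_compose[OF measurable_fst measurable_snd])+
  show ?thesis
    unfolding sync_pair_def case_prod_beta
    by (intro measurable_Pair F_fst_measurable s x measurable_snd)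
qed

lemma step_pair_measurable1: "h \<ge> 0 \<Longrightarrow> step_pair h a \<delta> R q \<in> measurable P pairs"
  using measurable_compose[OF measurable_Pair1'[of q pairs path_space] step_pair_measurable[of h a \<delta> R]]
  by (simp add: space_pair_measure measurable_cong_sets[OF sets_P refl])

lemma sync_pair_measurable1: "s \<ge> 0 \<Longrightarrow> sync_pair s q \<in> measurable P pairs"
  using measurable_compose[OF measurable_Pair1'[of q pairs path_space] sync_pair_measurable[of s]]
  by (simp add: space_pair_measure measurable_cong_sets[OF sets_P refl])

lemma step_kernel_measurable: "h \<ge> 0 \<Longrightarrow> step_kernel h a \<delta> R \<in> measurable pairs (prob_algebra pairs)"
  unfolding step_kernel_def[abs_def]
  by (rule measurable_distr_prob_space2[OF measurable_const[OF P_in_prob_algebra] step_pair_measurable])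

lemma sync_kernel_measurable: "s \<ge> 0 \<Longrightarrow> sync_kernel s \<in> measurable pairs (prob_algebra pairs)"
  unfolding sync_kernel_def[abs_def]
  by (rule measurable_distr_prob_space2[OF measurable_const[OF P_in_prob_algebra] sync_pair_measurable])

text \<open>The direction is frozen at the initial pair, so the reflected path has law
  \<open>P\<close> and the second component moves by the same flow along a path of the right
  law.\<close>

lemma step_kernel_marginals:
  assumes h: "h \<ge> 0" and \<delta>: "\<delta> > 0"
  shows "distr (step_kernel h a \<delta> R q) borel fst = p h (fst q)"
    and "distr (step_kernel h a \<delta> R q) borel snd = p h (snd q)"
proof -
  have "distr (step_kernel h a \<delta> R q) borel fst = distr P borel (fst \<circ> step_pair h a \<delta> R q)"
    unfolding step_kernel_def by (rule distr_distr[OF measurable_fst step_pair_measurable1[OF h]])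
  also have "fst \<circ> step_pair h a \<delta> R q = F h (fst q)" by (auto simp: step_pair_def)
  finally show "distr (step_kernel h a \<delta> R q) borel fst = p h (fst q)" by (simp add: p_eq[OF h])
  let ?T = "refl_path h a (dirn \<delta> R (fst q) (snd q))"
  have "distr (step_kernel h a \<delta> R q) borel snd = distr P borel (snd \<circ> step_pair h a \<delta> R q)"
    unfolding step_kernel_def by (rule distr_distr[OF measurable_snd step_pair_measurable1[OF h]])
  also have "snd \<circ> step_pair h a \<delta> R q = F h (snd q) \<circ> ?T" by (auto simp: step_pair_def)
  also have "distr P borel (F h (snd q) \<circ> ?T) = distr (distr P path_space ?T) borel (F h (snd q))"
    by (rule distr_distr[OF F_measurable1[OF h] refl_path_measurable_P[OF h], symmetric])
  also have "distr P path_space ?T = P" by (rule refl_path_P_law[OF norm_dirn[OF \<delta>] h])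
  finally show "distr (step_kernel h a \<delta> R q) borel snd = p h (snd q)" by (simp add: p_eq[OF h])
qed

lemma sync_kernel_marginals:
  assumes s: "s \<ge> 0"
  shows "distr (sync_kernel s q) borel fst = p s (fst q)"
    and "distr (sync_kernel s q) borel snd = p s (snd q)"
proof -
  have "distr (sync_kernel s q) borel fst = distr P borel (fst \<circ> sync_pair s q)"
    unfolding sync_kernel_def by (rule distr_distr[OF measurable_fst sync_pair_measurable1[OF s]])
  also have "fst \<circ> sync_pair s q = F s (fst q)" by (auto simp: sync_pair_def)
  finally show "distr (sync_kernel s q) borel fst = p s (fst q)" by (simp add: p_eq[OF s])
  have "distr (sync_kernel s q) borel snd = distr P borel (snd \<circ> sync_pair s q)"
    unfolding sync_kernel_def by (rule distr_distr[OF measurable_snd sync_pair_measurable1[OF s]])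
  also have "snd \<circ> sync_pair s q = F s (snd q)" by (auto simp: sync_pair_def)
  finally show "distr (sync_kernel s q) borel snd = p s (snd q)" by (simp add: p_eq[OF s])
qed

lemma p_in_prob_algebra: "s \<ge> 0 \<Longrightarrow> p s x \<in> space (prob_algebra borel)"
  using measurable_space[OF p_measurable[of s], of x] by simp

lemma Markov_nn_integral:
  assumes h: "h \<ge> 0" and H: "H \<in> borel_measurable (borel \<Otimes>\<^sub>M path_space)"
  shows "(\<integral>\<^sup>+z. (\<integral>\<^sup>+w. H (z, w) \<partial>P) \<partial>p h x) = (\<integral>\<^sup>+\<omega>. H (F h x (sample_path W \<omega>), sample_path (time_shift h W) \<omega>) \<partial>M)"
proof -
  have sp: "sets (p h x \<Otimes>\<^sub>M P) = sets (borel \<Otimes>\<^sub>M path_space)" by (intro sets_pair_measure_cong) simp_all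
  have "(\<integral>\<^sup>+z. (\<integral>\<^sup>+w. H (z, w) \<partial>P) \<partial>p h x) = integral\<^sup>N (p h x \<Otimes>\<^sub>M P) H"
    by (rule P.nn_integral_fst) (use H in \<open>simp only: measurable_cong_sets[OF sp refl]\<close>)
  also have "\<dots> = integral\<^sup>N (distr M (borel \<Otimes>\<^sub>M path_space) (\<lambda>\<omega>. (F h x (sample_path W \<omega>), sample_path (time_shift h W) \<omega>))) H"
    by (simp only: flow_Markov[OF h])
  also have "\<dots> = (\<integral>\<^sup>+\<omega>. H (F h x (sample_path W \<omega>), sample_path (time_shift h W) \<omega>) \<partial>M)"
    by (rule nn_integral_distr[OF measurable_Pair[OF measurable_compose[OF path_W_measurable F_measurable1[OF h]]
        path_measurable[OF wiener_shift[OF wiener_W h]]]]) (use H in \<open>simp only: measurable_distr_eq1\<close>)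
  finally show ?thesis .
qed

text \<open>Independence of the later path turns the composition into an integral over a single
  path, and the flow property identifies the integrand.\<close>

lemma Chapman_Kolmogorov:
  assumes h: "h \<ge> 0" and s: "s \<ge> 0" shows "p h x \<bind> p s = p (h + s) x"
proof (rule measure_eqI)
  have sp: "sets (p h x \<bind> p s) = sets borel"
    by (rule sets_bind'[OF p_in_prob_algebra[OF h] p_measurable[OF s]])
  then show "sets (p h x \<bind> p s) = sets (p (h + s) x)" by simp
  fix A assume "A \<in> sets (p h x \<bind> p s)"
  then have A: "A \<in> sets borel" by (simp only: sp)
  have hs: "h + s \<ge> 0" using h s by simp
  have ep: "emeasure (p u z) A = (\<integral>\<^sup>+w. indicator A (F u z w) \<partial>P)" if u: "u \<ge> 0" for u z
  proof -
    have "emeasure (p u z) A = (\<integral>\<^sup>+y. indicator A y \<partial>distr P borel (F u z))"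
      using A by (simp add: p_eq[OF u])
    also have "\<dots> = (\<integral>\<^sup>+w. indicator A (F u z w) \<partial>P)"
      by (rule nn_integral_distr) (use A F_measurable1[OF u] in \<open>simp_all add: measurable_cong_sets[OF sets_P refl]\<close>)
    finally show ?thesis .
  qed
  have "emeasure (p h x \<bind> p s) A = (\<integral>\<^sup>+z. emeasure (p s z) A \<partial>p h x)"
    by (rule emeasure_bind_prob_algebra[OF p_in_prob_algebra[OF h] p_measurable[OF s] A])
  also have "\<dots> = (\<integral>\<^sup>+z. (\<integral>\<^sup>+w. (\<lambda>(z, w). indicator A (F s z w)) (z, w) \<partial>P) \<partial>p h x)"
    by (simp add: ep[OF s])
  also have "\<dots> = (\<integral>\<^sup>+\<omega>. (\<lambda>(z, w). indicator A (F s z w)) (F h x (sample_path W \<omega>), sample_path (time_shift h W) \<omega>) \<partial>M)"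
  proof (rule Markov_nn_integral[OF h])
    have "(\<lambda>u. indicator A ((\<lambda>(z, w). F s z w) u) :: ennreal) \<in> borel_measurable (borel \<Otimes>\<^sub>M path_space)"
      by (rule measurable_compose[OF F_measurable[OF s] borel_measurable_indicator[OF A]])
    then show "(\<lambda>(z, w). indicator A (F s z w) :: ennreal) \<in> borel_measurable (borel \<Otimes>\<^sub>M path_space)"
      by (simp add: case_prod_beta)
  qed
  also have "\<dots> = (\<integral>\<^sup>+\<omega>. indicator A (F (h + s) x (sample_path W \<omega>)) \<partial>M)"
    by (rule nn_integral_cong_AE) (use flow_property[OF h, of x] in \<open>eventually_elim, use s in simp\<close>)
  also have "\<dots> = (\<integral>\<^sup>+w. indicator A (F (h + s) x w) \<partial>P)"
    unfolding P_def
    by (rule nn_integral_distr[symmetric, OF path_W_measurable])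
       (use measurable_compose[OF F_measurable1[OF hs] borel_measurable_indicator[OF A]] in \<open>simp only: measurable_distr_eq1\<close>)
  also have "\<dots> = emeasure (p (h + s) x) A" by (rule ep[OF hs, symmetric])
  finally show "emeasure (p h x \<bind> p s) A = emeasure (p (h + s) x) A" .
qed

lemma p_0: "p 0 x = return borel x"
proof -
  have "F 0 x = (\<lambda>w. x)" by (rule ext) (rule flow_0)
  then show ?thesis by (simp add: p_eq)
qed

section \<open>The iterated coupling and exit from a ball\<close>

definition active :: "real \<Rightarrow> (real ^ 'n) \<times> (real ^ 'n) \<Rightarrow> bool" where
  "active k q \<longleftrightarrow> norm (fst q) \<le> k \<and> norm (snd q) \<le> k"

text \<open>After leaving the ball the coupling is synchronous for the rest of the time, so that the
  distance stays bounded without any control of the drift there.\<close>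

primrec coupling_kernel :: "real \<Rightarrow> real \<Rightarrow> real \<Rightarrow> real \<Rightarrow> real \<Rightarrow> nat \<Rightarrow> (real ^ 'n) \<times> (real ^ 'n) \<Rightarrow> ((real ^ 'n) \<times> (real ^ 'n)) measure" where
  "coupling_kernel k h a \<delta> R 0 q = return pairs q"
| "coupling_kernel k h a \<delta> R (Suc m) q =
     (if active k q then step_kernel h a \<delta> R q \<bind> coupling_kernel k h a \<delta> R m
      else sync_kernel (real (Suc m) * h) q)"

lemma active_sets: "{q \<in> space pairs. active k q} \<in> sets pairs"
  unfolding active_def
  by (rule sets.sets_Collect_conj; rule borel_measurable_le;
      rule measurable_compose[OF measurable_fst borel_measurable_norm] measurable_compose[OF measurable_snd borel_measurable_norm] borel_measurable_const)

lemma coupling_kernel_measurable: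
  assumes h: "h \<ge> 0" shows "coupling_kernel k h a \<delta> R m \<in> measurable pairs (prob_algebra pairs)"
proof (induction m)
  case 0
  have "coupling_kernel k h a \<delta> R 0 = return pairs" by (rule ext) simp
  then show ?case by (simp add: measurable_return_prob_space)
next
  case (Suc m)
  have "(\<lambda>q. step_kernel h a \<delta> R q \<bind> coupling_kernel k h a \<delta> R m) \<in> measurable pairs (prob_algebra pairs)"
    by (rule measurable_bind_prob_space[OF step_kernel_measurable[OF h] Suc])
  moreover have "sync_kernel (real (Suc m) * h) \<in> measurable pairs (prob_algebra pairs)"
    by (rule sync_kernel_measurable) (use h in simp)
  moreover have "coupling_kernel k h a \<delta> R (Suc m) = (\<lambda>q. if active k q then step_kernel h a \<delta> R q \<bind> coupling_kernel k h a \<delta> R m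
      else sync_kernel (real (Suc m) * h) q)" by (rule ext) simp
  ultimately show ?case using active_sets[of k] by (simp only:) (rule measurable_If)
qed

text \<open>The choice between the branches depends on the current pair only, and the synchronous
  branch runs for exactly the time that remains; both branches therefore have the same
  marginals.\<close>

lemma coupling_kernel_marginals:
  assumes h: "h \<ge> 0" and \<delta>: "\<delta> > 0"
  shows "distr (coupling_kernel k h a \<delta> R m q) borel fst = p (real m * h) (fst q) \<and>
    distr (coupling_kernel k h a \<delta> R m q) borel snd = p (real m * h) (snd q)"
proof (induction m arbitrary: q)
  case 0
  show ?case
    by (simp add: p_0 distr_return[OF measurable_fst] distr_return[OF measurable_snd] space_pair_measure)
next
  case (Suc m)
  have mh: "real m * h \<ge> 0" using h by simp
  have t: "h + real m * h = real (Suc m) * h" by (simp add: algebra_simps)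
  show ?case
  proof (cases "active k q")
    case True
    let ?s = "step_kernel h a \<delta> R q"
    have s: "?s \<in> space (prob_algebra pairs)"
      using measurable_space[OF step_kernel_measurable[OF h, of a \<delta> R], of q] by (simp add: space_pair_measure)
    then have ss: "sets ?s = sets pairs" "space ?s \<noteq> {}"
      by (auto simp: space_prob_algebra dest: prob_space.not_empty)
    have km: "coupling_kernel k h a \<delta> R m \<in> measurable ?s (subprob_algebra pairs)"
      using measurable_prob_algebraD[OF coupling_kernel_measurable[OF h, of k a \<delta> R m]] by (simp only: measurable_cong_sets[OF ss(1) refl])
    have pm: "p (real m * h) \<in> measurable borel (subprob_algebra borel)"
      by (rule measurable_prob_algebraD[OF p_measurable[OF mh]])
    have fm: "fst \<in> measurable ?s borel" "snd \<in> measurable ?s borel"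
      using measurable_fst[of borel borel] measurable_snd[of borel borel] by (simp_all only: measurable_cong_sets[OF ss(1) refl])
    have "distr (?s \<bind> coupling_kernel k h a \<delta> R m) borel fst = ?s \<bind> (\<lambda>q. distr (coupling_kernel k h a \<delta> R m q) borel fst)"
      by (rule distr_bind[OF km ss(2) measurable_fst])
    also have "\<dots> = ?s \<bind> (\<lambda>q. p (real m * h) (fst q))" using Suc by simp
    also have "\<dots> = distr ?s borel fst \<bind> p (real m * h)" by (rule bind_distr[OF fm(1) pm ss(2), symmetric])
    also have "\<dots> = p (real (Suc m) * h) (fst q)"
      by (simp only: step_kernel_marginals[OF h \<delta>] Chapman_Kolmogorov[OF h mh] t)
    finally have 1: "distr (?s \<bind> coupling_kernel k h a \<delta> R m) borel fst = p (real (Suc m) * h) (fst q)" .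
    have "distr (?s \<bind> coupling_kernel k h a \<delta> R m) borel snd = ?s \<bind> (\<lambda>q. distr (coupling_kernel k h a \<delta> R m q) borel snd)"
      by (rule distr_bind[OF km ss(2) measurable_snd])
    also have "\<dots> = ?s \<bind> (\<lambda>q. p (real m * h) (snd q))" using Suc by simp
    also have "\<dots> = distr ?s borel snd \<bind> p (real m * h)" by (rule bind_distr[OF fm(2) pm ss(2), symmetric])
    also have "\<dots> = p (real (Suc m) * h) (snd q)"
      by (simp only: step_kernel_marginals[OF h \<delta>] Chapman_Kolmogorov[OF h mh] t)
    finally show ?thesis using 1 True by (simp only: coupling_kernel.simps if_True)
  next
    case False
    have "0 \<le> real (Suc m) * h" using h by simp
    from sync_kernel_marginals[OF this, of q] show ?thesis using False by (simp only: coupling_kernel.simps if_False)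
  qed
qed

text \<open>The starting time counts and the final time does not, because the kernel tests the ball
  before each step. Only one component is involved: the exit of a pair is bounded by a sum of terms
  that do not depend on the coupling.\<close>

definition exit_set :: "real \<Rightarrow> real \<Rightarrow> nat \<Rightarrow> ((real ^ 'n) \<times> (real \<Rightarrow> real ^ 'n)) set" where
  "exit_set k h m = {(x, w). \<exists>j<m. k < norm (F (real j * h) x w)}"

definition exit_prob :: "real \<Rightarrow> real \<Rightarrow> nat \<Rightarrow> real ^ 'n \<Rightarrow> ennreal" where
  "exit_prob k h m x = (\<integral>\<^sup>+w. indicator (exit_set k h m) (x, w) \<partial>P)"

lemma exit_indicator_measurable:
  assumes h: "h \<ge> 0"
  shows "(indicator (exit_set k h m) :: _ \<Rightarrow> ennreal) \<in> borel_measurable (borel \<Otimes>\<^sub>M path_space)"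
proof -
  let ?N = "borel \<Otimes>\<^sub>M path_space :: ((real ^ 'n) \<times> (real \<Rightarrow> real ^ 'n)) measure"
  have j: "{u \<in> space ?N. k < norm (F (real j * h) (fst u) (snd u))} \<in> sets ?N" for j
  proof -
    have "(\<lambda>u. F (real j * h) (fst u) (snd u)) \<in> borel_measurable ?N"
      using F_measurable[of "real j * h"] h by (simp add: case_prod_beta)
    from measurable_compose[OF this borel_measurable_norm]
    show ?thesis unfolding borel_measurable_iff_greater by blast
  qed
  have "exit_set k h m \<inter> space ?N = (\<Union>j\<in>{..<m}. {u \<in> space ?N. k < norm (F (real j * h) (fst u) (snd u))})"
    by (auto simp: exit_set_def)
  also have "\<dots> \<in> sets ?N" by (intro sets.finite_UN j) auto
  finally show ?thesis by (simp add: borel_measurable_indicator_iff)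
qed

lemma exit_prob_measurable: "h \<ge> 0 \<Longrightarrow> exit_prob k h m \<in> borel_measurable borel"
  unfolding exit_prob_def[abs_def]
  by (rule P.borel_measurable_nn_integral_fst)
     (simp only: measurable_cong_sets[OF sets_pair_measure_cong[OF refl sets_P] refl] exit_indicator_measurable)

lemma exit_prob_outside:
  assumes "norm x > k" shows "exit_prob k h (Suc m) x = 1"
proof -
  have "(x, w) \<in> exit_set k h (Suc m)" for w
    using assms by (auto simp: exit_set_def flow_0 intro!: exI[of _ 0])
  then show ?thesis using P.emeasure_space_1 by (simp add: exit_prob_def)
qed

text \<open>After one step, exit at index \<open>j\<close> is exit at index \<open>j + 1\<close> of
  the original trajectory. Exit at index 0 is lost, hence only an inequality.\<close>

lemma exit_prob_step:
  assumes h: "h \<ge> 0"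
  shows "(\<integral>\<^sup>+z. exit_prob k h m z \<partial>p h x) \<le> exit_prob k h (Suc m) x"
proof -
  have "(\<integral>\<^sup>+z. exit_prob k h m z \<partial>p h x)
      = (\<integral>\<^sup>+\<omega>. indicator (exit_set k h m) (F h x (sample_path W \<omega>), sample_path (time_shift h W) \<omega>) \<partial>M)"
    unfolding exit_prob_def by (rule Markov_nn_integral[OF h exit_indicator_measurable[OF h]])
  also have "\<dots> \<le> (\<integral>\<^sup>+\<omega>. indicator (exit_set k h (Suc m)) (x, sample_path W \<omega>) \<partial>M)"
  proof (rule nn_integral_mono_AE)
    show "AE \<omega> in M. (indicator (exit_set k h m) (F h x (sample_path W \<omega>), sample_path (time_shift h W) \<omega>) :: ennreal) \<le>
        indicator (exit_set k h (Suc m)) (x, sample_path W \<omega>)"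
      using flow_property[OF h, of x]
    proof eventually_elim
      case (elim \<omega>)
      have "(x, sample_path W \<omega>) \<in> exit_set k h (Suc m)" if ex: "(F h x (sample_path W \<omega>), sample_path (time_shift h W) \<omega>) \<in> exit_set k h m"
      proof -
        obtain j where j: "j < m" "k < norm (F (real j * h) (F h x (sample_path W \<omega>)) (sample_path (time_shift h W) \<omega>))"
          using ex by (auto simp: exit_set_def)
        have "real j * h \<ge> 0" using h by simp
        then have "F (real j * h) (F h x (sample_path W \<omega>)) (sample_path (time_shift h W) \<omega>) = F (real (Suc j) * h) x (sample_path W \<omega>)"
          using elim by (simp add: algebra_simps)
        then have "k < norm (F (real (Suc j) * h) x (sample_path W \<omega>))" using j(2) by simp
        then show ?thesis using j(1) by (auto simp: exit_set_def simp del: of_nat_Suc intro!: exI[of _ "Suc j"])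
      qed
      then show ?case by (auto simp: indicator_def)
    qed
  qed
  also have "\<dots> = exit_prob k h (Suc m) x"
    unfolding exit_prob_def P_def
    by (rule nn_integral_distr[symmetric, OF path_W_measurable])
       (use measurable_compose[OF measurable_Pair1'[of x borel path_space] exit_indicator_measurable[OF h, of k "Suc m"]] in
         \<open>simp add: measurable_distr_eq1\<close>)
  finally show ?thesis .
qed

abbreviation "cost q \<equiv> ennreal (f (gnorm G (fst q - snd q)))"

lemma cost_measurable: "(\<lambda>q. cost q) \<in> borel_measurable pairs"
proof -
  have d: "(\<lambda>q. gnorm G (fst q - snd q)) \<in> borel_measurable pairs"
    by (rule gnorm_diff_measurable[OF measurable_fst measurable_snd])
  have "(\<lambda>r. indicator {0..} r *\<^sub>R f r) \<in> borel_measurable borel"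
    by (rule borel_measurable_continuous_on_indicator[OF _ f_continuous]) simp
  from measurable_compose[OF d this] have "(\<lambda>q. f (gnorm G (fst q - snd q))) \<in> borel_measurable pairs"
    by (simp add: indicator_def)
  then show ?thesis by (rule measurable_compose[OF _ measurable_ennreal])
qed

text \<open>The factor in front of the exit probabilities does not grow in the induction, because a
  step cannot raise max(r, R_1). Outside the ball one exit probability equals 1, and the synchronous
  bound on the distance is all that is needed.\<close>

lemma step_kernel_contraction:
  assumes h: "h > 0" and \<epsilon>: "\<epsilon> \<ge> 0" and \<delta>: "\<delta> > 0"
    and step: "contracting_step k \<epsilon> h a \<delta> R"
  shows "(\<integral>\<^sup>+v. cost v \<partial>coupling_kernel k h a \<delta> R m q) \<le>
     ennreal (exp (- rate_c * (real m * h)) * f (gnorm G (fst q - snd q)) + real m * h * \<epsilon>) +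
     ennreal (max (gnorm G (fst q - snd q)) R_1) * (exit_prob k h m (fst q) + exit_prob k h m (snd q))"
proof (induction m arbitrary: q)
  case 0
  have "(\<integral>\<^sup>+v. cost v \<partial>return pairs q) = cost q"
    by (rule nn_integral_return[OF _ cost_measurable]) (simp add: space_pair_measure)
  then show ?case by simp
next
  case (Suc m)
  let ?r = "gnorm G (fst q - snd q)"
  let ?D = "max ?r R_1"
  let ?E = "exp (- rate_c * (real m * h))"
  have h0: "h \<ge> 0" using h by simp
  have D0: "?D \<ge> 0" using R1_pos by simp
  show ?case
  proof (cases "active k q")
    case True
    then have K: "norm (fst q) \<le> k" "norm (snd q) \<le> k" by (auto simp: active_def)
    let ?s = "step_kernel h a \<delta> R q"
    have s: "?s \<in> space (prob_algebra pairs)"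
      using measurable_space[OF step_kernel_measurable[OF h0, of a \<delta> R], of q] by (simp add: space_pair_measure)
    have ss: "sets ?s = sets pairs" and ps: "prob_space ?s" using s by (auto simp: space_prob_algebra)
    interpret s: prob_space ?s by (rule ps)
    have km: "coupling_kernel k h a \<delta> R m \<in> measurable ?s (subprob_algebra pairs)"
      using measurable_prob_algebraD[OF coupling_kernel_measurable[OF h0, of k a \<delta> R m]] by (simp only: measurable_cong_sets[OF ss refl])
    let ?ex = "\<lambda>v. exit_prob k h m (fst v) + exit_prob k h m (snd v)"
    have exm: "(\<lambda>v. exit_prob k h m (fst v)) \<in> borel_measurable pairs" "(\<lambda>v. exit_prob k h m (snd v)) \<in> borel_measurable pairs"
      by (rule measurable_compose[OF measurable_fst exit_prob_measurable[OF h0]]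
               measurable_compose[OF measurable_snd exit_prob_measurable[OF h0]])+
    have E: "0 \<le> ?E" "?E \<le> 1" using rate_c_pos h by auto
    have c0: "real m * h * \<epsilon> \<ge> 0" using h \<epsilon> by simp
    have sd: "gnorm G (fst (step_pair h a \<delta> R q w) - snd (step_pair h a \<delta> R q w)) = step_dist h a (dirn \<delta> R (fst q) (snd q)) (fst q) (snd q) w" for w
      by (simp add: step_pair_def step_dist_def)
    have spm: "step_pair h a \<delta> R q \<in> measurable P pairs" by (rule step_pair_measurable1[OF h0])
    have int_f: "(\<integral>\<^sup>+v. cost v \<partial>?s) \<le> ennreal (exp (- rate_c * h) * f ?r + \<epsilon> * h)"
    proof -
      have "(\<integral>\<^sup>+v. cost v \<partial>?s) = (\<integral>\<^sup>+w. cost (step_pair h a \<delta> R q w) \<partial>P)"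
        unfolding step_kernel_def by (rule nn_integral_distr[OF spm]) (simp only: measurable_distr_eq1 cost_measurable)
      then show ?thesis using step K by (simp only: sd contracting_step_def)
    qed
    have ae: "AE v in ?s. gnorm G (fst v - snd v) \<le> ?D"
      unfolding step_kernel_def
    proof (subst AE_distr_iff[OF spm])
      show "{v \<in> space pairs. gnorm G (fst v - snd v) \<le> ?D} \<in> sets pairs"
        using gnorm_diff_measurable[OF measurable_fst[of borel borel] measurable_snd] unfolding borel_measurable_iff_le by blast
      show "AE w in P. gnorm G (fst (step_pair h a \<delta> R q w) - snd (step_pair h a \<delta> R q w)) \<le> ?D"
        unfolding sd using step K by (simp only: contracting_step_def)
    qed
    have "(\<integral>\<^sup>+v. cost v \<partial>coupling_kernel k h a \<delta> R (Suc m) q)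
      = (\<integral>\<^sup>+q'. (\<integral>\<^sup>+v. cost v \<partial>coupling_kernel k h a \<delta> R m q') \<partial>?s)"
      using True by (simp only: coupling_kernel.simps if_True) (rule nn_integral_bind[OF cost_measurable km])
    also have "\<dots> \<le> (\<integral>\<^sup>+v. (ennreal ?E * cost v + ennreal (real m * h * \<epsilon>)) + ennreal ?D * ?ex v \<partial>?s)"
    proof (rule nn_integral_mono_AE)
      show "AE v in ?s. (\<integral>\<^sup>+v. cost v \<partial>coupling_kernel k h a \<delta> R m v) \<le>
         (ennreal ?E * cost v + ennreal (real m * h * \<epsilon>)) + ennreal ?D * ?ex v"
        using ae
      proof eventually_elim
        case (elim v)
        have "ennreal (?E * f (gnorm G (fst v - snd v)) + real m * h * \<epsilon>) = ennreal ?E * cost v + ennreal (real m * h * \<epsilon>)"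
          using E c0 f_nonneg[of "gnorm G (fst v - snd v)"] by (simp add: ennreal_plus ennreal_mult)
        moreover have "ennreal (max (gnorm G (fst v - snd v)) R_1) * ?ex v \<le> ennreal ?D * ?ex v"
          using elim by (intro mult_right_mono ennreal_leI) auto
        ultimately show ?case using order_trans[OF Suc.IH[of v] add_left_mono] by simp
      qed
    qed
    also have "\<dots> = ennreal ?E * (\<integral>\<^sup>+v. cost v \<partial>?s) + ennreal (real m * h * \<epsilon>)
        + ennreal ?D * ((\<integral>\<^sup>+v. exit_prob k h m (fst v) \<partial>?s) + (\<integral>\<^sup>+v. exit_prob k h m (snd v) \<partial>?s))"
    proof -
      have [measurable]: "(\<lambda>v. cost v) \<in> borel_measurable ?s"
        "(\<lambda>v. exit_prob k h m (fst v)) \<in> borel_measurable ?s" "(\<lambda>v. exit_prob k h m (snd v)) \<in> borel_measurable ?s"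
        using cost_measurable exm by (simp_all only: measurable_cong_sets[OF ss refl])
      show ?thesis by (simp add: nn_integral_add nn_integral_cmult s.emeasure_space_1)
    qed
    also have "\<dots> \<le> ennreal ?E * ennreal (exp (- rate_c * h) * f ?r + \<epsilon> * h) + ennreal (real m * h * \<epsilon>)
        + ennreal ?D * (exit_prob k h (Suc m) (fst q) + exit_prob k h (Suc m) (snd q))"
    proof (intro add_mono mult_left_mono int_f order_refl)
      have fm: "fst \<in> measurable ?s borel" "snd \<in> measurable ?s borel"
        using measurable_fst[of borel borel] measurable_snd[of borel borel] by (simp_all only: measurable_cong_sets[OF ss refl])
      have "(\<integral>\<^sup>+v. exit_prob k h m (fst v) \<partial>?s) = (\<integral>\<^sup>+z. exit_prob k h m z \<partial>distr ?s borel fst)"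
        by (rule nn_integral_distr[OF fm(1), symmetric]) (simp only: measurable_distr_eq1 exit_prob_measurable[OF h0])
      then show "(\<integral>\<^sup>+v. exit_prob k h m (fst v) \<partial>?s) \<le> exit_prob k h (Suc m) (fst q)"
        unfolding step_kernel_marginals[OF h0 \<delta>] using exit_prob_step[OF h0] by simp
      have "(\<integral>\<^sup>+v. exit_prob k h m (snd v) \<partial>?s) = (\<integral>\<^sup>+z. exit_prob k h m z \<partial>distr ?s borel snd)"
        by (rule nn_integral_distr[OF fm(2), symmetric]) (simp only: measurable_distr_eq1 exit_prob_measurable[OF h0])
      then show "(\<integral>\<^sup>+v. exit_prob k h m (snd v) \<partial>?s) \<le> exit_prob k h (Suc m) (snd q)"
        unfolding step_kernel_marginals[OF h0 \<delta>] using exit_prob_step[OF h0] by simp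
    qed auto
    also have "ennreal ?E * ennreal (exp (- rate_c * h) * f ?r + \<epsilon> * h) + ennreal (real m * h * \<epsilon>)
       = ennreal (?E * (exp (- rate_c * h) * f ?r + \<epsilon> * h) + real m * h * \<epsilon>)"
      using E c0 \<epsilon> h f_nonneg[of ?r] by (simp add: ennreal_plus ennreal_mult)
    also have "\<dots> \<le> ennreal (exp (- rate_c * (real (Suc m) * h)) * f ?r + real (Suc m) * h * \<epsilon>)"
    proof (rule ennreal_leI)
      \<comment> \<open>Later contraction only shrinks the error of the first step, so errors at
        most add up.\<close>
      have "?E * (\<epsilon> * h) \<le> 1 * (\<epsilon> * h)" using E \<epsilon> h by (intro mult_right_mono) auto
      moreover have "exp (- rate_c * (real (Suc m) * h)) = ?E * exp (- rate_c * h)"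
        by (simp add: exp_add[symmetric] algebra_simps)
      ultimately show "?E * (exp (- rate_c * h) * f ?r + \<epsilon> * h) + real m * h * \<epsilon> \<le>
          exp (- rate_c * (real (Suc m) * h)) * f ?r + real (Suc m) * h * \<epsilon>"
        by (simp add: algebra_simps)
    qed
    finally show ?thesis by (simp add: add_right_mono)
  next
    case False
    let ?s = "real (Suc m) * h"
    have s0: "?s \<ge> 0" using h by simp
    have "(\<integral>\<^sup>+v. cost v \<partial>coupling_kernel k h a \<delta> R (Suc m) q)
       = (\<integral>\<^sup>+w. ennreal (f (gnorm G (F ?s (fst q) w - F ?s (snd q) w))) \<partial>P)"
      using False nn_integral_distr[OF sync_pair_measurable1[OF s0], of "\<lambda>v. cost v" q] cost_measurable
      by (simp only: coupling_kernel.simps if_False sync_kernel_def measurable_distr_eq1) (simp add: sync_pair_def)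
    also have "\<dots> \<le> (\<integral>\<^sup>+w. ennreal ?D \<partial>P)"
    proof (rule nn_integral_mono_AE)
      show "AE w in P. ennreal (f (gnorm G (F ?s (fst q) w - F ?s (snd q) w))) \<le> ennreal ?D"
        using synchronous[OF s0, of "fst q" "snd q"]
      proof eventually_elim
        case (elim w)
        have "f (gnorm G (F ?s (fst q) w - F ?s (snd q) w)) \<le> ?D"
          using elim f_le[of "gnorm G (F ?s (fst q) w - F ?s (snd q) w)"] R1_ge_R0 by auto
        then show ?case by (rule ennreal_leI)
      qed
    qed
    also have "\<dots> = ennreal ?D * 1" using P.emeasure_space_1[unfolded space_P] by simp
    also have "\<dots> \<le> ennreal ?D * (exit_prob k h (Suc m) (fst q) + exit_prob k h (Suc m) (snd q))"
    proof (rule mult_left_mono)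
      have "k < norm (fst q) \<or> k < norm (snd q)" using False by (auto simp: active_def)
      then show "1 \<le> exit_prob k h (Suc m) (fst q) + exit_prob k h (Suc m) (snd q)"
        using exit_prob_outside[of k "fst q" h m] exit_prob_outside[of k "snd q" h m] by auto
    qed simp
    finally show ?thesis by (rule order_trans) simp
  qed
qed

section \<open>Letting the ball grow\<close>

lemma exit_prob_eq:
  assumes h: "h \<ge> 0"
  shows "exit_prob k h m x = (\<integral>\<^sup>+\<omega>. indicator (exit_set k h m) (x, sample_path W \<omega>) \<partial>M)"
  unfolding exit_prob_def P_def
  by (rule nn_integral_distr[OF path_W_measurable])
     (use measurable_compose[OF measurable_Pair1'[of x borel path_space] exit_indicator_measurable[OF h, of k m]] in
       \<open>simp add: measurable_distr_eq1\<close>)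

lemma exit_prob_le_1: "exit_prob k h m x \<le> 1"
proof -
  have "exit_prob k h m x \<le> (\<integral>\<^sup>+w. 1 \<partial>P)"
    unfolding exit_prob_def by (intro nn_integral_mono) (simp add: indicator_def)
  then show ?thesis using P.emeasure_space_1[unfolded space_P] by simp
qed

text \<open>This is where non-explosion enters: almost every trajectory is bounded on
  \<open>[0, t]\<close>, so the indicators vanish from some index on, whatever the step sizes.
  Dominated convergence with the constant 1 finishes the argument.\<close>

lemma exit_prob_tendsto:
  assumes h: "\<And>n. h n > 0" and N: "\<And>n. real (N n) * h n = t" and t: "t \<ge> 0"
  shows "(\<lambda>n. exit_prob (real n) (h n) (N n) x) \<longlonglongrightarrow> 0"
proof -
  let ?u = "\<lambda>n \<omega>. indicator (exit_set (real n) (h n) (N n)) (x, sample_path W \<omega>) :: ennreal"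
  have "(\<lambda>n. \<integral>\<^sup>+\<omega>. ?u n \<omega> \<partial>M) \<longlonglongrightarrow> (\<integral>\<^sup>+\<omega>. 0 \<partial>M)"
  proof (rule nn_integral_dominated_convergence[where w = "\<lambda>_. 1"])
    show "?u n \<in> borel_measurable M" for n
      by (rule measurable_compose[OF path_W_measurable measurable_compose[OF measurable_Pair1'
            exit_indicator_measurable[OF less_imp_le[OF h]]]]) simp
    show "(\<integral>\<^sup>+\<omega>. 1 \<partial>M) < \<infinity>" by (simp add: M.emeasure_space_1)
    show "AE \<omega> in M. (\<lambda>n. ?u n \<omega>) \<longlonglongrightarrow> 0"
      using X_ode[of x] F_eq_X[of x]
    proof eventually_elim
      case (elim \<omega>)
      have "continuous_on {0..t} (\<lambda>s. X x s \<omega>)" using elim(1) t by (auto simp: ode_solution_def)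
      from compact_imp_bounded[OF compact_continuous_image[OF this compact_Icc]]
      obtain c where c: "\<And>s. s \<in> {0..t} \<Longrightarrow> norm (X x s \<omega>) \<le> c" unfolding bounded_iff by blast
      obtain n0 :: nat where n0: "c \<le> real n0" using real_arch_simple by blast
      have "?u n \<omega> = 0" if "n \<ge> n0" for n
      proof -
        have "norm (F (real j * h n) x (sample_path W \<omega>)) \<le> real n" if j: "j < N n" for j
        proof -
          have "real j * h n \<le> real (N n) * h n" using j h[of n] by (intro mult_right_mono) auto
          then have "real j * h n \<in> {0..t}" using N[of n] h[of n] by simp
          then have "norm (F (real j * h n) x (sample_path W \<omega>)) \<le> c" using c elim(2) by simp
          then show ?thesis using n0 \<open>n \<ge> n0\<close> by linarith
        qed
        then have "(x, sample_path W \<omega>) \<notin> exit_set (real n) (h n) (N n)"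
          unfolding exit_set_def mem_Collect_eq prod.case by (meson not_less)
        then show ?thesis by simp
      qed
      then show ?case by (intro tendsto_eventually) (auto simp: eventually_sequentially)
    qed
  qed (auto simp: indicator_def)
  then show ?thesis by (simp add: exit_prob_eq[OF less_imp_le[OF h]])
qed

text \<open>Radius \<open>n\<close> and error \<open>1 / (n + 1)\<close> are tied to one index, so a
  single limit removes both. The parameters of the steps are hidden from here on.\<close>

lemma coupling_sequence:
  assumes t: "t \<ge> 0"
  obtains C :: "nat \<Rightarrow> (real ^ 'n) \<times> (real ^ 'n) \<Rightarrow> ((real ^ 'n) \<times> (real ^ 'n)) measure" and E :: "nat \<Rightarrow> real ^ 'n \<Rightarrow> ennreal"
  where "\<And>n. C n \<in> measurable pairs (prob_algebra pairs)"
    "\<And>n q. distr (C n q) borel fst = p t (fst q)" "\<And>n q. distr (C n q) borel snd = p t (snd q)"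
    "\<And>n. E n \<in> borel_measurable borel" "\<And>n x. E n x \<le> 1" "\<And>x. (\<lambda>n. E n x) \<longlonglongrightarrow> 0"
    "\<And>n q. (\<integral>\<^sup>+v. cost v \<partial>C n q) \<le>
     ennreal (exp (- rate_c * t) * f (gnorm G (fst q - snd q)) + t * (1 / real (Suc n))) +
     ennreal (max (gnorm G (fst q - snd q)) R_1) * (E n (fst q) + E n (snd q))"
proof -
  define ok :: "nat \<Rightarrow> real \<Rightarrow> real \<Rightarrow> real \<Rightarrow> real \<Rightarrow> nat \<Rightarrow> bool" where
    "ok n R \<delta> a h N \<longleftrightarrow> \<delta> > 0 \<and> h > 0 \<and> real N * h = t \<and> contracting_step (real n) (1 / real (Suc n)) h a \<delta> R" for n R \<delta> a h N
  have "\<exists>R \<delta> a h N. ok n R \<delta> a h N" for n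
  proof -
    have "1 / real (Suc n) > 0" by simp
    from one_step[OF this, of "real n"] obtain R \<delta> a h0 where *: "\<delta> > 0" "h0 > 0"
      "\<And>h. 0 < h \<Longrightarrow> h < h0 \<Longrightarrow> contracting_step (real n) (1 / real (Suc n)) h a \<delta> R"
      by blast
    obtain h N where h: "0 < h" "h < h0" "real N * h = t" using step_count[OF *(2) t] by blast
    have "ok n R \<delta> a h N" unfolding ok_def using *(1) *(3)[OF h(1,2)] h by simp
    then show ?thesis by blast
  qed
  then obtain R \<delta> a h N where ok: "\<And>n. ok n (R n) (\<delta> n) (a n) (h n) (N n)" by metis
  have pos: "\<delta> n > 0" "h n > 0" "h n \<ge> 0" "real (N n) * h n = t" for n using ok[of n] by (auto simp: ok_def)
  show ?thesis
  proof (rule that[of "\<lambda>n. coupling_kernel (real n) (h n) (a n) (\<delta> n) (R n) (N n)" "\<lambda>n. exit_prob (real n) (h n) (N n)"])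
    fix n q
    show "coupling_kernel (real n) (h n) (a n) (\<delta> n) (R n) (N n) \<in> measurable pairs (prob_algebra pairs)"
      by (rule coupling_kernel_measurable[OF pos(3)])
    show "distr (coupling_kernel (real n) (h n) (a n) (\<delta> n) (R n) (N n) q) borel fst = p t (fst q)"
      "distr (coupling_kernel (real n) (h n) (a n) (\<delta> n) (R n) (N n) q) borel snd = p t (snd q)"
      using coupling_kernel_marginals[OF pos(3,1)] by (simp_all add: pos(4))
    show "exit_prob (real n) (h n) (N n) \<in> borel_measurable borel" by (rule exit_prob_measurable[OF pos(3)])
    show "exit_prob (real n) (h n) (N n) x \<le> 1" for x by (rule exit_prob_le_1)
    have e: "1 / real (Suc n) \<ge> 0" by simp
    have st: "contracting_step (real n) (1 / real (Suc n)) (h n) (a n) (\<delta> n) (R n)"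
      using ok[of n] by (simp only: ok_def)
    from step_kernel_contraction[OF pos(2) e pos(1) st, of "N n" q]
    show "(\<integral>\<^sup>+v. cost v \<partial>coupling_kernel (real n) (h n) (a n) (\<delta> n) (R n) (N n) q) \<le>
     ennreal (exp (- rate_c * t) * f (gnorm G (fst q - snd q)) + t * (1 / real (Suc n))) +
     ennreal (max (gnorm G (fst q - snd q)) R_1) * (exit_prob (real n) (h n) (N n) (fst q) + exit_prob (real n) (h n) (N n) (snd q))"
      by (simp only: pos(4))
  next
    show "(\<lambda>n. exit_prob (real n) (h n) (N n) x) \<longlonglongrightarrow> 0" for x
      by (rule exit_prob_tendsto[OF pos(2) pos(4) t])
  qed
qed

lemma gnorm_le_f: "gnorm G z \<le> 2 / ph R_0 * f (gnorm G z)"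
  using f_ge[of "gnorm G z"] phi_pos[of R_0] by (simp add: field_simps)

text \<open>Mixing the kernels over a coupling of the initial laws gives couplings at time
  \<open>t\<close>. The Kantorovich distance does not depend on \<open>n\<close>, so only the limit
  of the bounds remains; no limit of the couplings themselves is required.\<close>

lemma coupling_contraction:
  assumes t: "t \<ge> 0" and mu: "prob_space \<mu>" "sets \<mu> = sets borel" and nu: "prob_space \<nu>" "sets \<nu> = sets borel"
    and eta: "\<eta> \<in> couplings \<mu> \<nu>"
  shows "W_f G \<kappa> (\<mu> \<bind> p t) (\<nu> \<bind> p t) \<le> ennreal (exp (- rate_c * t)) * (\<integral>\<^sup>+q. cost q \<partial>\<eta>)"
proof -
  let ?I = "\<integral>\<^sup>+q. cost q \<partial>\<eta>"
  have es: "sets \<eta> = sets pairs" and ef: "distr \<eta> borel fst = \<mu>" "distr \<eta> borel snd = \<nu>"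
    using eta by (auto simp: couplings_def)
  have fm: "fst \<in> measurable \<eta> borel" "snd \<in> measurable \<eta> borel"
    using measurable_fst[of borel borel] measurable_snd[of borel borel] by (simp_all only: measurable_cong_sets[OF es refl])
  have "prob_space \<eta>" by (rule prob_space_distrD[OF fm(1)]) (simp add: ef mu)
  then interpret e: prob_space \<eta> .
  have ein: "\<eta> \<in> space (prob_algebra pairs)" by (simp add: space_prob_algebra es e.prob_space_axioms)
  have fmeas [measurable]: "cost \<in> borel_measurable \<eta>"
    using cost_measurable by (simp only: measurable_cong_sets[OF es refl])
  show ?thesis
  \<comment> \<open>With infinite cost the right-hand side is infinite, as the exponential factor is
    positive. Otherwise the finite cost makes the dominating function integrable.\<close>
  proof (cases "?I = \<infinity>")
    case True
    then show ?thesis by (simp add: ennreal_mult_top)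
  next
    case False
    show ?thesis
    proof (rule coupling_sequence[OF t])
      fix C E assume
        C: "\<And>n. C n \<in> measurable pairs (prob_algebra pairs)"
        and marg: "\<And>n q. distr (C n q) borel fst = p t (fst q)" "\<And>n q. distr (C n q) borel snd = p t (snd q)"
        and E: "\<And>n. E n \<in> borel_measurable borel" "\<And>n x. E n x \<le> 1" "\<And>x. (\<lambda>n. E n x) \<longlonglongrightarrow> 0"
        and bound: "\<And>n q. (\<integral>\<^sup>+v. cost v \<partial>C n q) \<le>
           ennreal (exp (- rate_c * t) * f (gnorm G (fst q - snd q)) + t * (1 / real (Suc n))) +
           ennreal (max (gnorm G (fst q - snd q)) R_1) * (E n (fst q) + E n (snd q))"
      let ?M = "\<lambda>q. ennreal (max (gnorm G (fst q - snd q)) R_1)"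
      let ?H = "\<lambda>n q. ?M q * (E n (fst q) + E n (snd q))"
      have Em [measurable]: "(\<lambda>q. E n (fst q)) \<in> borel_measurable \<eta>" "(\<lambda>q. E n (snd q)) \<in> borel_measurable \<eta>" for n
        by (rule measurable_compose[OF fm(1) E(1)] measurable_compose[OF fm(2) E(1)])+
      have gm: "(\<lambda>q. gnorm G (fst q - snd q)) \<in> borel_measurable \<eta>"
        by (rule gnorm_diff_measurable[OF fm])
      have Mm [measurable]: "?M \<in> borel_measurable \<eta>"
      proof -
        have "(\<lambda>q. max (gnorm G (fst q - snd q)) R_1) \<in> borel_measurable \<eta>"
          using gm by (intro borel_measurable_max borel_measurable_const)
        then show ?thesis by simp
      qed
      have le: "W_f G \<kappa> (\<mu> \<bind> p t) (\<nu> \<bind> p t) \<le> ennreal (exp (- rate_c * t)) * ?I + ennreal (t * (1 / real (Suc n))) + (\<integral>\<^sup>+q. ?H n q \<partial>\<eta>)" for n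
      proof -
        have Cn: "C n \<in> measurable \<eta> (subprob_algebra pairs)"
          using measurable_prob_algebraD[OF C] by (simp only: measurable_cong_sets[OF es refl])
        have pm: "p t \<in> measurable borel (subprob_algebra borel)" by (rule measurable_prob_algebraD[OF p_measurable[OF t]])
        have "distr (\<eta> \<bind> C n) borel fst = \<eta> \<bind> (\<lambda>q. p t (fst q))"
          using distr_bind[OF Cn e.not_empty measurable_fst] by (simp add: marg)
        also have "\<dots> = \<mu> \<bind> p t" using bind_distr[OF fm(1) pm e.not_empty] by (simp add: ef)
        finally have m1: "distr (\<eta> \<bind> C n) borel fst = \<mu> \<bind> p t" .
        have "distr (\<eta> \<bind> C n) borel snd = \<eta> \<bind> (\<lambda>q. p t (snd q))"
          using distr_bind[OF Cn e.not_empty measurable_snd] by (simp add: marg)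
        also have "\<dots> = \<nu> \<bind> p t" using bind_distr[OF fm(2) pm e.not_empty] by (simp add: ef)
        finally have m2: "distr (\<eta> \<bind> C n) borel snd = \<nu> \<bind> p t" .
        have "sets (\<eta> \<bind> C n) = sets pairs" by (rule sets_bind'[OF ein C])
        then have "\<eta> \<bind> C n \<in> couplings (\<mu> \<bind> p t) (\<nu> \<bind> p t)" using m1 m2 by (simp add: couplings_def)
        then have "W_f G \<kappa> (\<mu> \<bind> p t) (\<nu> \<bind> p t) \<le> (\<integral>\<^sup>+v. cost v \<partial>(\<eta> \<bind> C n))"
          unfolding W_f_def kantorovich_def case_prod_beta by (rule INF_lower)
        also have "\<dots> = (\<integral>\<^sup>+q. (\<integral>\<^sup>+v. cost v \<partial>C n q) \<partial>\<eta>)"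
          by (rule nn_integral_bind[OF cost_measurable Cn])
        also have "\<dots> \<le> (\<integral>\<^sup>+q. (ennreal (exp (- rate_c * t)) * cost q + ennreal (t * (1 / real (Suc n)))) + ?H n q \<partial>\<eta>)"
        proof (rule nn_integral_mono)
          fix q
          have "ennreal (exp (- rate_c * t) * f (gnorm G (fst q - snd q)) + t * (1 / real (Suc n)))
            = ennreal (exp (- rate_c * t)) * cost q + ennreal (t * (1 / real (Suc n)))"
            using t f_nonneg[of "gnorm G (fst q - snd q)"] by (simp add: ennreal_plus ennreal_mult)
          then show "(\<integral>\<^sup>+v. cost v \<partial>C n q) \<le> (ennreal (exp (- rate_c * t)) * cost q + ennreal (t * (1 / real (Suc n)))) + ?H n q"
            using bound[of n q] by simp
        qed
        also have "\<dots> = ennreal (exp (- rate_c * t)) * ?I + ennreal (t * (1 / real (Suc n))) + (\<integral>\<^sup>+q. ?H n q \<partial>\<eta>)"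
          by (simp add: nn_integral_add nn_integral_cmult e.emeasure_space_1)
        finally show ?thesis .
      qed
      have H0: "(\<lambda>n. \<integral>\<^sup>+q. ?H n q \<partial>\<eta>) \<longlonglongrightarrow> (\<integral>\<^sup>+q. 0 \<partial>\<eta>)"
      \<comment> \<open>Each exit probability is at most 1, hence the factor 2; the maximum is
        integrable because the distance is at most a constant times the cost.\<close>
      proof (rule nn_integral_dominated_convergence[where w = "\<lambda>q. ?M q * 2"])
        show "AE q in \<eta>. ?H n q \<le> ?M q * 2" for n
          using add_mono[OF E(2) E(2)] by (intro AE_I2 mult_left_mono) (auto simp: one_add_one)
        show "AE q in \<eta>. (\<lambda>n. ?H n q) \<longlonglongrightarrow> 0"
        proof (rule AE_I2)
          fix q
          have "(\<lambda>n. ?H n q) \<longlonglongrightarrow> ?M q * (0 + 0)"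
            by (intro ennreal_tendsto_cmult tendsto_add E(3)) simp
          then show "(\<lambda>n. ?H n q) \<longlonglongrightarrow> 0" by simp
        qed
        have "(\<integral>\<^sup>+q. ?M q * 2 \<partial>\<eta>) \<le> (\<integral>\<^sup>+q. (ennreal (2 / ph R_0) * cost q + ennreal R_1) * 2 \<partial>\<eta>)"
        proof (intro nn_integral_mono mult_right_mono)
          fix q :: "(real ^ 'n) \<times> (real ^ 'n)"
          let ?r = "gnorm G (fst q - snd q)"
          have "2 / ph R_0 * f ?r \<ge> 0" using f_nonneg[of ?r] less_imp_le[OF phi_pos[of R_0]] by simp
          then have "max ?r R_1 \<le> 2 / ph R_0 * f ?r + R_1" using gnorm_le_f[of "fst q - snd q"] R1_pos by simp
          then have "?M q \<le> ennreal (2 / ph R_0 * f ?r + R_1)" by (rule ennreal_leI)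
          then show "?M q \<le> ennreal (2 / ph R_0) * cost q + ennreal R_1"
            using f_nonneg[of ?r] R1_pos less_imp_le[OF phi_pos[of R_0]]
            by (subst ennreal_mult[symmetric], simp, simp, subst ennreal_plus[symmetric]) auto
        qed simp
        also have "\<dots> = (ennreal (2 / ph R_0) * ?I + ennreal R_1) * 2"
          by (simp add: nn_integral_add nn_integral_cmult nn_integral_multc e.emeasure_space_1)
        also have "\<dots> < \<infinity>" using False by (simp add: ennreal_mult_less_top ennreal_mult_eq_top_iff less_top[symmetric])
        finally show "(\<integral>\<^sup>+q. ?M q * 2 \<partial>\<eta>) < \<infinity>" .
      qed (use Mm Em in measurable)
      have "(\<lambda>n. ennreal (t * (1 / real (Suc n)))) \<longlonglongrightarrow> ennreal (t * 0)"
        by (intro tendsto_ennrealI tendsto_mult tendsto_const LIMSEQ_Suc[OF lim_1_over_n])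
      then have "(\<lambda>n. ennreal (exp (- rate_c * t)) * ?I + ennreal (t * (1 / real (Suc n))) + (\<integral>\<^sup>+q. ?H n q \<partial>\<eta>))
          \<longlonglongrightarrow> ennreal (exp (- rate_c * t)) * ?I + ennreal (t * 0) + (\<integral>\<^sup>+q. 0 \<partial>\<eta>)"
        by (intro tendsto_add tendsto_const H0)
      then have "W_f G \<kappa> (\<mu> \<bind> p t) (\<nu> \<bind> p t) \<le> ennreal (exp (- rate_c * t)) * ?I + ennreal (t * 0) + (\<integral>\<^sup>+q. 0 \<partial>\<eta>)"
        by (rule tendsto_lowerbound) (use le in auto)
      then show ?thesis by simp
    qed
  qed
qed

section \<open>Contraction in the two Kantorovich distances\<close>

lemma W_f_contraction:
  assumes "t \<ge> 0" "prob_space \<mu>" "sets \<mu> = sets borel" "prob_space \<nu>" "sets \<nu> = sets borel"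
  shows "W_f G \<kappa> (\<mu> \<bind> p t) (\<nu> \<bind> p t) \<le> ennreal (exp (- rate_c * t)) * W_f G \<kappa> \<mu> \<nu>"
proof -
  have eq: "W_f G \<kappa> \<mu> \<nu> = (INF \<eta>\<in>couplings \<mu> \<nu>. \<integral>\<^sup>+q. cost q \<partial>\<eta>)"
    unfolding W_f_def kantorovich_def case_prod_beta ..
  show ?thesis
    unfolding eq by (rule le_cmult_INF_ennreal) (use coupling_contraction[OF assms] in auto)
qed

lemma W_f_le_W1: "W_f G \<kappa> \<mu> \<nu> \<le> W1 G \<mu> \<nu>"
  unfolding W_f_def W1_def kantorovich_def case_prod_beta
  by (intro INF_mono' nn_integral_mono ennreal_leI f_le gnorm_nonneg)

text \<open>The slope of \<open>f\<close> never falls below \<open>ph R_0 / 2\<close>, since the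
  weight is smallest from \<open>R_0\<close> on and \<open>gf\<close> is at least 1/2; this is the
  origin of the constant.\<close>

lemma W1_le_W_f: "W1 G \<mu> \<nu> \<le> ennreal (2 / ph R_0) * W_f G \<kappa> \<mu> \<nu>"
  unfolding W_f_def kantorovich_def case_prod_beta
proof (rule le_cmult_INF_ennreal)
  show "2 / ph R_0 > 0" using phi_pos[of R_0] by simp
  fix \<eta> :: "((real ^ 'n) \<times> (real ^ 'n)) measure" assume eta: "\<eta> \<in> couplings \<mu> \<nu>"
  then have es: "sets \<eta> = sets pairs" by (auto simp: couplings_def)
  have "W1 G \<mu> \<nu> \<le> (\<integral>\<^sup>+q. ennreal (gnorm G (fst q - snd q)) \<partial>\<eta>)"
    unfolding W1_def kantorovich_def case_prod_beta by (rule INF_lower[OF eta])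
  also have "\<dots> \<le> (\<integral>\<^sup>+q. ennreal (2 / ph R_0) * cost q \<partial>\<eta>)"
  proof (rule nn_integral_mono)
    fix q :: "(real ^ 'n) \<times> (real ^ 'n)"
    have "ennreal (gnorm G (fst q - snd q)) \<le> ennreal (2 / ph R_0 * f (gnorm G (fst q - snd q)))"
      by (rule ennreal_leI[OF gnorm_le_f])
    then show "ennreal (gnorm G (fst q - snd q)) \<le> ennreal (2 / ph R_0) * cost q"
      using less_imp_le[OF phi_pos[of R_0]] f_nonneg[of "gnorm G (fst q - snd q)"]
      by (subst ennreal_mult[symmetric]) (simp_all only: divide_nonneg_nonneg zero_le_numeral gnorm_nonneg)
  qed
  also have "\<dots> = ennreal (2 / ph R_0) * (\<integral>\<^sup>+q. cost q \<partial>\<eta>)"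
    by (rule nn_integral_cmult) (simp only: measurable_cong_sets[OF es refl] cost_measurable)
  finally show "W1 G \<mu> \<nu> \<le> ennreal (2 / ph R_0) * (\<integral>\<^sup>+q. cost q \<partial>\<eta>)" .
qed

text \<open>The contraction holds for the modified distance only; passing to it and back costs the
  constant once, independently of \<open>t\<close>, because \<open>f r \<le> r\<close> makes one of
  the two comparisons free.\<close>

lemma W1_contraction:
  assumes "t \<ge> 0" "prob_space \<mu>" "sets \<mu> = sets borel" "prob_space \<nu>" "sets \<nu> = sets borel"
  shows "W1 G (\<mu> \<bind> p t) (\<nu> \<bind> p t) \<le> ennreal (2 / ph R_0 * exp (- rate_c * t)) * W1 G \<mu> \<nu>"
proof -
  have "W1 G (\<mu> \<bind> p t) (\<nu> \<bind> p t) \<le> ennreal (2 / ph R_0) * (ennreal (exp (- rate_c * t)) * W1 G \<mu> \<nu>)"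
    by (rule order_trans[OF W1_le_W_f mult_left_mono[OF order_trans[OF W_f_contraction[OF assms] mult_left_mono[OF W_f_le_W1]]]]) auto
  also have "\<dots> = ennreal (2 / ph R_0 * exp (- rate_c * t)) * W1 G \<mu> \<nu>"
    using less_imp_le[OF phi_pos[of R_0]] by (subst ennreal_mult) (auto simp: mult.assoc)
  finally show ?thesis .
qed

end

theorem corollary2:
  fixes \<sigma> G :: "real ^ 'n ^ 'n"
    and b :: "real ^ 'n \<Rightarrow> real ^ 'n"
    and M :: "'w measure"
    and B :: "real \<Rightarrow> 'w \<Rightarrow> real ^ 'n"
    and X :: "real ^ 'n \<Rightarrow> real \<Rightarrow> 'w \<Rightarrow> real ^ 'n"
    and \<kappa> :: "real \<Rightarrow> real"
    and p :: "real \<Rightarrow> real ^ 'n \<Rightarrow> (real ^ 'n) measure"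
    and c t :: real
    and \<mu> \<nu> :: "(real ^ 'n) measure"
  defines "\<kappa> \<equiv> kappa \<sigma> G b"
    and "p \<equiv> transition_kernel M X"
    and "c \<equiv> rate \<sigma> G \<kappa>"
  assumes "det \<sigma> > 0"
    and "sym_pos_def G"
    and "local_lipschitz (UNIV :: real set) UNIV (\<lambda>_. b)"
    and "brownian_motion M B"
    and "\<And>x. strong_solution M B b \<sigma> x (X x)"
    and "\<And>r. r > 0 \<Longrightarrow> bdd_below (kappa_set \<sigma> G b r)"
    and "continuous_on {0<..} \<kappa>"
    and "Liminf at_top (\<lambda>r. ereal (\<kappa> r)) > 0"
    and "(\<integral>\<^sup>+ r\<in>{0<..1}. ennreal (r * neg_part (\<kappa> r)) \<partial>lborel) < \<infinity>"
    and "t \<ge> 0"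
    and "prob_space \<mu>" "sets \<mu> = sets borel"
    and "prob_space \<nu>" "sets \<nu> = sets borel"
  shows "W_f G \<kappa> (\<mu> \<bind> p t) (\<nu> \<bind> p t) \<le> ennreal (exp (- c * t)) * W_f G \<kappa> \<mu> \<nu> \<and>
         W1 G (\<mu> \<bind> p t) (\<nu> \<bind> p t)
           \<le> ennreal (2 / phi \<kappa> (R0 \<kappa>) * exp (- c * t)) * W1 G \<mu> \<nu>"
proof -
  interpret diffusion G \<sigma> b M B X
    using assms by unfold_locales (simp_all add: \<kappa>_def)
  show ?thesis
    unfolding c_def \<kappa>_def p_def rate_c_eq
    using W_f_contraction W1_contraction assms by blast
qed

end
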